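(* Let $m,n\ge3$. The following are equivalent: (a) there is a unique maximal (in the weak order) $K_{3,3}$-matroid on $K_{m,n}$; (b) ${\rm val}_{K_{3,3}}$ is submodular on $E(K_{m,n})$.
   Context: A $K_{3,3}$-matroid on $K_{m,n}$ is a matroid on $E(K_{m,n})$ in which the edge set of every subgraph isomorphic to $K_{3,3}$ is a circuit. Weak order: ${\mathcal M}_1\preceq{\mathcal M}_2$ if every independent set of ${\mathcal M}_1$ is independent in ${\mathcal M}_2$. With ${\mathcal X}$ the family of edge sets of copies of $K_{3,3}$ in $K_{m,n}$: a proper ${\mathcal X}$-sequence is $(X_1,\dots,X_k)$ in ${\mathcal X}$ with $X_i\not\subseteq\bigcup_{j<i}X_j$ for $i\ge2$; for $F\subseteq E(K_{m,n})$, ${\rm val}(F,{\mathcal S})=|F\cup\bigcup_iX_i|-k$, and ${\rm val}_{K_{3,3}}(F)=\min_{\mathcal S}{\rm val}(F,{\mathcal S})$. *)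

theory Defs
  imports Main
begin

type_synonym 'v graph = "'v set \<times> 'v set set"

abbreviation verts :: "'v graph \<Rightarrow> 'v set" where
  "verts \<equiv> fst"

abbreviation edges :: "'v graph \<Rightarrow> 'v set set" where
  "edges \<equiv> snd"

definition simple_graph :: "'v graph \<Rightarrow> bool" where
  "simple_graph G \<longleftrightarrow> (\<forall>e\<in>edges G. e \<subseteq> verts G \<and> card e = 2)"

definition subgraph :: "'v graph \<Rightarrow> 'v graph \<Rightarrow> bool" where
  "subgraph H G \<longleftrightarrow> simple_graph H \<and> verts H \<subseteq> verts G \<and> edges H \<subseteq> edges G"

definition graph_iso :: "'v graph \<Rightarrow> 'w graph \<Rightarrow> bool" where
  "graph_iso G H \<longleftrightarrow> (\<exists>f. bij_betw f (verts G) (verts H) \<and>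
     (\<forall>u\<in>verts G. \<forall>v\<in>verts G. {u, v} \<in> edges G \<longleftrightarrow> {f u, f v} \<in> edges H))"

definition complete_bipartite :: "nat \<Rightarrow> nat \<Rightarrow> (nat + nat) graph" where
  "complete_bipartite m n =
     (Inl ` {..<m} \<union> Inr ` {..<n}, {{Inl i, Inr j} | i j. i < m \<and> j < n})"

definition K33_copies :: "'v graph \<Rightarrow> 'v set set set" where
  "K33_copies G = {edges H | H. subgraph H G \<and> graph_iso H (complete_bipartite 3 3)}"

text \<open>A matroid on the ground set \<open>E\<close> is given by its family \<open>M\<close> of independent sets.\<close>

definition matroid_on :: "'e set \<Rightarrow> 'e set set \<Rightarrow> bool" where
  "matroid_on E M \<longleftrightarrow> finite E \<and> M \<subseteq> Pow E \<and> {} \<in> M \<and>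
     (\<forall>I J. J \<in> M \<and> I \<subseteq> J \<longrightarrow> I \<in> M) \<and>
     (\<forall>I J. I \<in> M \<and> J \<in> M \<and> card I < card J \<longrightarrow> (\<exists>e\<in>J - I. insert e I \<in> M))"

definition circuit :: "'e set \<Rightarrow> 'e set set \<Rightarrow> 'e set \<Rightarrow> bool" where
  "circuit E M C \<longleftrightarrow> C \<subseteq> E \<and> C \<notin> M \<and> (\<forall>D. D \<subset> C \<longrightarrow> D \<in> M)"

definition weak_le :: "'e set set \<Rightarrow> 'e set set \<Rightarrow> bool" where
  "weak_le M1 M2 \<longleftrightarrow> (\<forall>I. I \<in> M1 \<longrightarrow> I \<in> M2)"

definition K33_matroid :: "'v graph \<Rightarrow> 'v set set set \<Rightarrow> bool" where
  "K33_matroid G M \<longleftrightarrow> matroid_on (edges G) M \<and> (\<forall>X\<in>K33_copies G. circuit (edges G) M X)"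

definition maximal_K33_matroid :: "'v graph \<Rightarrow> 'v set set set \<Rightarrow> bool" where
  "maximal_K33_matroid G M \<longleftrightarrow> K33_matroid G M \<and>
     (\<forall>N. K33_matroid G N \<and> weak_le M N \<longrightarrow> N = M)"

text \<open>Sequences are lists, indexed from 0. The empty sequence is proper, so that
  the minimum below is at most \<open>card F\<close>.\<close>

definition proper_seq :: "'e set set \<Rightarrow> 'e set list \<Rightarrow> bool" where
  "proper_seq \<X> S \<longleftrightarrow> set S \<subseteq> \<X> \<and>
     (\<forall>i. 1 \<le> i \<and> i < length S \<longrightarrow> \<not> S ! i \<subseteq> (\<Union>j<i. S ! j))"

definition val_seq :: "'e set \<Rightarrow> 'e set list \<Rightarrow> int" where
  "val_seq F S = int (card (F \<union> \<Union>(set S))) - int (length S)"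

definition val_min :: "'e set set \<Rightarrow> 'e set \<Rightarrow> int" where
  "val_min \<X> F = Min {val_seq F S | S. proper_seq \<X> S}"

definition val_K33 :: "'v graph \<Rightarrow> 'v set set \<Rightarrow> int" where
  "val_K33 G F = val_min (K33_copies G) F"

definition submodular_on :: "'e set \<Rightarrow> ('e set \<Rightarrow> int) \<Rightarrow> bool" where
  "submodular_on E f \<longleftrightarrow>
     (\<forall>A B. A \<subseteq> E \<and> B \<subseteq> E \<longrightarrow> f (A \<union> B) + f (A \<inter> B) \<le> f A + f B)"

end

theory Submission
  imports Defs Complex_Main "HOL-Library.Function_Algebras" "HOL-Combinatorics.Transposition"
begin

text \<open>
  The interesting direction is that a greatest \<open>K\<^sub>3\<^sub>,\<^sub>3\<close>-matroid \<open>M\<close> has rank function \<open>val\<close>.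
  Call a maximal complete bipartite subgraph \<open>K\<^sub>a\<^sub>,\<^sub>b\<close> with \<open>a, b \<ge> 3\<close> of a flat \<open>F\<close> a blob of \<open>F\<close>;
  it has rank \<open>2(a + b) - 4\<close>, and two blobs share at most one vertex on each side, hence at most one edge.
  The core is the formula \<open>r(F) = |F| - (\<Sum> (a - 2)(b - 2))\<close>, summed over the blobs of \<open>F\<close>, proved by
  induction on \<open>r(F)\<close>. The function \<open>\<rho>(P) = |P| - (\<Sum> null(P \<inter> B))\<close> on subsets of \<open>F\<close> is submodular.
  If \<open>\<rho> \<ge> r\<close> and \<open>\<rho>(F) > r(F)\<close>, then \<open>\<rho>\<close> defines a larger \<open>K\<^sub>3\<^sub>,\<^sub>3\<close>-matroid of rank \<open>r(F) + 1\<close>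
  (an erection of a truncation of \<open>M\<close>), which is impossible. That \<open>\<rho> \<ge> r\<close> follows from a counting argument:
  invariance of \<open>M\<close> under permutations of the vertices bounds the blobs through a vertex, and a double count
  then yields a vertex lying in exactly one blob; deleting it reduces a minimal counterexample.
  The same vertex, removed repeatedly, produces a proper sequence showing \<open>val(F) \<le> r(F)\<close>.
\<close>

section \<open>Rank, closure and flats\<close>

text \<open>That \<open>M\<close> is greatest enters in three separate ways. Explicit matroids below
  it bound its ranks from below: the uniform one makes all sets of eight edges independent, and
  rank-two matrix completion gives \<open>2 * (m + n) \<le> r E + 4\<close>, which together with
  saturation fixes the rank of every large enough \<open>K A B\<close> and makes all of them flats.
  Being canonical, \<open>M\<close> inherits the symmetries of the graph. Finally, no K33-matroid
  has larger rank than \<open>M\<close> on any set.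

  The obstacle is that \<rho> \<ge> r is needed on all subsets of \<open>F\<close>, while the
  induction knows the formula only for flats of smaller rank. A violating set is therefore chosen so
  extremal that its traces on the blobs become flats.

  The constant 3 in the bound at a vertex \<open>v\<close> is 4 + 1 - 2: 4 from the rank
  \<open>2 * (a + b) - 4\<close>, 1 because the closure of a star of two or more blobs does not fill
  the complete bipartite graph around it, and 2 charged for \<open>v\<close> itself. The double
  count then closes against the 2 per vertex of the rank bound, and is tightest when all blobs are
  copies of K33.\<close>

definition rk :: "'e set set \<Rightarrow> 'e set \<Rightarrow> nat" where
  "rk M A = Max (card ` {I \<in> M. I \<subseteq> A})"

definition nul :: "'e set set \<Rightarrow> 'e set \<Rightarrow> nat" where
  "nul M A = card A - rk M A"

definition cl :: "'e set \<Rightarrow> 'e set set \<Rightarrow> 'e set \<Rightarrow> 'e set" where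
  "cl E M A = {e \<in> E. rk M (insert e A) = rk M A}"

definition flat :: "'e set \<Rightarrow> 'e set set \<Rightarrow> 'e set \<Rightarrow> bool" where
  "flat E M F \<longleftrightarrow> F \<subseteq> E \<and> cl E M F \<subseteq> F"

locale matroid =
  fixes E :: "'e set" and M :: "'e set set"
  assumes matroid: "matroid_on E M"
begin

abbreviation "r \<equiv> rk M"
abbreviation "null \<equiv> nul M"
abbreviation "cls \<equiv> cl E M"
abbreviation "isflat \<equiv> flat E M"

lemma finE: "finite E"
  using matroid unfolding matroid_on_def by simp

lemma indep_sub: "I \<in> M \<Longrightarrow> I \<subseteq> E"
  using matroid unfolding matroid_on_def by auto

lemma empty_indep: "{} \<in> M"
  using matroid unfolding matroid_on_def by simp

lemma indep_mono:
  assumes "J \<in> M" "I \<subseteq> J"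
  shows "I \<in> M"
proof -
  have "\<forall>I J. J \<in> M \<and> I \<subseteq> J \<longrightarrow> I \<in> M"
    using matroid unfolding matroid_on_def by simp
  with assms show ?thesis by blast
qed

lemma augment: "I \<in> M \<Longrightarrow> J \<in> M \<Longrightarrow> card I < card J \<Longrightarrow> \<exists>e\<in>J - I. insert e I \<in> M"
  using matroid unfolding matroid_on_def by simp

lemma finM: "finite M"
proof (rule finite_subset)
  show "M \<subseteq> Pow E" using indep_sub by blast
qed (simp add: finE)

lemma fin_sub: "A \<subseteq> E \<Longrightarrow> finite A"
  using finE finite_subset by blast

lemma fin_indep: "I \<in> M \<Longrightarrow> finite I"
  using indep_sub fin_sub by blast

lemma card_le_rk: "I \<in> M \<Longrightarrow> I \<subseteq> A \<Longrightarrow> card I \<le> r A"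
  unfolding rk_def using finM by (intro Max_ge) auto

lemma ex_basis: "\<exists>B\<in>M. B \<subseteq> A \<and> card B = r A"
proof -
  have "r A \<in> card ` {I \<in> M. I \<subseteq> A}"
    unfolding rk_def using finM empty_indep by (intro Max_in) auto
  then show ?thesis by auto
qed

lemma ex_basis_ge:
  assumes "I \<in> M" "I \<subseteq> A"
  shows "\<exists>B\<in>M. I \<subseteq> B \<and> B \<subseteq> A \<and> card B = r A"
proof -
  let ?S = "{B \<in> M. I \<subseteq> B \<and> B \<subseteq> A}"
  have "finite ?S" "?S \<noteq> {}" using finM assms by auto
  then obtain B where B: "B \<in> ?S" and mx: "\<And>C. C \<in> ?S \<Longrightarrow> card C \<le> card B"
    using ex_is_arg_min_if_finite[of ?S "\<lambda>B. - int (card B)"] by (auto simp: is_arg_min_def linorder_not_less)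
  have "card B = r A"
  proof (rule ccontr)
    assume "card B \<noteq> r A"
    then have "card B < r A" using card_le_rk[of B A] B by auto
    then obtain C where C: "C \<in> M" "C \<subseteq> A" "card B < card C" using ex_basis by metis
    then obtain e where e: "e \<in> C - B" "insert e B \<in> M" using augment B by blast
    then have "insert e B \<in> ?S" using B C by auto
    then have "card (insert e B) \<le> card B" using mx by blast
    then show False using e B fin_indep by (simp add: card_insert_if)
  qed
  then show ?thesis using B by blast
qed

lemma rk_le_card:
  assumes "finite A"
  shows "r A \<le> card A"
proof -
  obtain I where "I \<in> M" "I \<subseteq> A" "card I = r A" using ex_basis[of A] by blast
  then show ?thesis using card_mono[of A I] assms by simp
qed

lemma rk_mono:
  assumes "A \<subseteq> B"
  shows "r A \<le> r B"
proof -
  obtain I where "I \<in> M" "I \<subseteq> A" "card I = r A" using ex_basis[of A] by blast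
  then show ?thesis using card_le_rk[of I B] assms by simp
qed

lemma rk_indep: "I \<in> M \<Longrightarrow> r I = card I"
  using card_le_rk[of I I] rk_le_card[of I] fin_indep[of I] by simp

lemma indep_iff:
  assumes "A \<subseteq> E"
  shows "A \<in> M \<longleftrightarrow> r A = card A"
proof
  assume "r A = card A"
  then obtain B where "B \<in> M" "B \<subseteq> A" "card B = card A" using ex_basis[of A] by auto
  then show "A \<in> M" using card_subset_eq[of A B] fin_sub[OF assms] by simp
qed (rule rk_indep)

lemma rk_submod: "r (A \<union> B) + r (A \<inter> B) \<le> r A + r B"
proof -
  obtain I where I: "I \<in> M" "I \<subseteq> A \<inter> B" "card I = r (A \<inter> B)" using ex_basis by blast
  then obtain J where J: "J \<in> M" "I \<subseteq> J" "J \<subseteq> A \<union> B" "card J = r (A \<union> B)"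
    using ex_basis_ge[of I "A \<union> B"] by blast
  have fJ: "finite J" using J fin_indep by blast
  have "J = (J \<inter> A) \<union> (J \<inter> B)" using J by auto
  then have "card J + card ((J \<inter> A) \<inter> (J \<inter> B)) = card (J \<inter> A) + card (J \<inter> B)"
    using fJ card_Un_Int[of "J \<inter> A" "J \<inter> B"] by simp
  moreover have "card I \<le> card ((J \<inter> A) \<inter> (J \<inter> B))" using I J fJ by (intro card_mono) auto
  moreover have "card (J \<inter> A) \<le> r A" "card (J \<inter> B) \<le> r B"
    using J indep_mono by (auto intro!: card_le_rk)
  ultimately show ?thesis using I J by linarith
qed

lemma rk_Un_le: "finite B \<Longrightarrow> r (A \<union> B) \<le> r A + card B"
  using rk_submod[of A B] rk_le_card[of B] by linarith

lemma rk_insert_le: "r (insert e A) \<le> Suc (r A)"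
  using rk_Un_le[of "{e}" A] by simp

lemma rk_insert_ge: "r A \<le> r (insert e A)"
  by (rule rk_mono) auto

lemma rk_null: "finite A \<Longrightarrow> r A + null A = card A"
  using rk_le_card[of A] unfolding nul_def by simp

lemma null_supermod:
  assumes "finite A" "finite B"
  shows "null A + null B \<le> null (A \<union> B) + null (A \<inter> B)"
proof -
  have "card A + card B = card (A \<union> B) + card (A \<inter> B)" using assms card_Un_Int by blast
  then show ?thesis
    using rk_submod[of A B] rk_null[of A] rk_null[of B] rk_null[of "A \<union> B"] rk_null[of "A \<inter> B"] assms
    by simp
qed

lemma null_mono: "finite B \<Longrightarrow> A \<subseteq> B \<Longrightarrow> null A \<le> null B"
proof -
  assume a: "finite B" "A \<subseteq> B"
  then have "r B \<le> r A + card (B - A)" using rk_Un_le[of "B - A" A] by (simp add: Un_absorb1)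
  moreover have "card B = card A + card (B - A)"
    using a by (metis card_Diff_subset card_mono finite_subset le_add_diff_inverse)
  ultimately show ?thesis unfolding nul_def by simp
qed

lemma null_indep: "I \<in> M \<Longrightarrow> null I = 0"
  by (simp add: nul_def rk_indep)

lemma cl_sub: "cls A \<subseteq> E" by (auto simp: cl_def)

lemma sub_cl: "A \<subseteq> E \<Longrightarrow> A \<subseteq> cls A"
  by (auto simp: cl_def insert_absorb)

lemma rk_sub_cl:
  assumes "B \<subseteq> cls A"
  shows "r (A \<union> B) = r A"
proof (rule order_antisym)
  obtain I where I: "I \<in> M" "I \<subseteq> A" "card I = r A" using ex_basis by blast
  obtain J where J: "J \<in> M" "I \<subseteq> J" "J \<subseteq> A \<union> B" "card J = r (A \<union> B)"
    using ex_basis_ge[of I "A \<union> B"] I by blast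
  have "J \<subseteq> I"
  proof (rule ccontr)
    assume "\<not> J \<subseteq> I"
    then obtain e where e: "e \<in> J" "e \<notin> I" by blast
    have "insert e I \<in> M" using indep_mono[of J "insert e I"] J e by auto
    then have "Suc (r A) \<le> r (insert e A)"
      using card_le_rk[of "insert e I" "insert e A"] I e fin_indep[of I] by auto
    moreover have "r (insert e A) = r A"
      using e J assms by (cases "e \<in> A") (auto simp: cl_def insert_absorb)
    ultimately show False by simp
  qed
  then show "r (A \<union> B) \<le> r A" using I J by auto
qed (simp add: rk_mono)

lemma rk_cl: "A \<subseteq> E \<Longrightarrow> r (cls A) = r A"
  using rk_sub_cl[of "cls A" A] sub_cl by (simp add: Un_absorb1)

lemma in_cl_mono:
  assumes "e \<in> E" "B \<subseteq> A" "r (insert e B) = r B"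
  shows "e \<in> cls A"
proof -
  have "r (insert e A) + r (insert e B \<inter> A) \<le> r (insert e B) + r A"
    using rk_submod[of "insert e B" A] assms by (simp add: Un_absorb1)
  moreover have "r B \<le> r (insert e B \<inter> A)" using assms by (intro rk_mono) auto
  ultimately have "r (insert e A) \<le> r A" using assms by simp
  then show ?thesis using assms rk_insert_ge[of A e] by (auto simp: cl_def)
qed

lemma cl_mono: "A \<subseteq> B \<Longrightarrow> cls A \<subseteq> cls B"
  using in_cl_mono[of _ A B] by (auto simp: cl_def)

lemma flat_sub: "isflat F \<Longrightarrow> F \<subseteq> E"
  by (simp add: flat_def)

lemma cl_sub_flat: "isflat F \<Longrightarrow> A \<subseteq> F \<Longrightarrow> cls A \<subseteq> F"
  using cl_mono[of A F] by (auto simp: flat_def)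

lemma flat_cl:
  assumes "A \<subseteq> E"
  shows "isflat (cls A)"
proof -
  have "e \<in> cls A" if "e \<in> cls (cls A)" for e
  proof -
    have "r (insert e (cls A)) = r A" "e \<in> E" using that rk_cl assms by (auto simp: cl_def)
    moreover have "r (insert e A) \<le> r (insert e (cls A))" using sub_cl[OF assms] by (intro rk_mono) auto
    ultimately show ?thesis using rk_insert_ge[of A e] by (auto simp: cl_def)
  qed
  then show ?thesis using cl_sub by (auto simp: flat_def)
qed

lemma flat_Int: "isflat F \<Longrightarrow> isflat G \<Longrightarrow> isflat (F \<inter> G)"
  using cl_mono[of "F \<inter> G" F] cl_mono[of "F \<inter> G" G] by (auto simp: flat_def)

lemma sub_cl_of_rk_eq:
  assumes "A \<subseteq> B" "B \<subseteq> E" "r B \<le> r A"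
  shows "B \<subseteq> cls A"
proof
  fix e assume e: "e \<in> B"
  then have "r (insert e A) \<le> r B" using assms by (intro rk_mono) auto
  then show "e \<in> cls A" using e assms rk_insert_ge[of A e] by (auto simp: cl_def)
qed

lemma flat_eq_of_rk: "isflat F \<Longrightarrow> F \<subseteq> B \<Longrightarrow> B \<subseteq> E \<Longrightarrow> r B \<le> r F \<Longrightarrow> B = F"
  using sub_cl_of_rk_eq[of F B] by (auto simp: flat_def)

lemma circuit_in_cl:
  assumes "circuit E M X" "e \<in> X" "X - {e} \<subseteq> A"
  shows "e \<in> cls A"
proof (rule in_cl_mono)
  show "e \<in> E" using assms by (auto simp: circuit_def)
  show "X - {e} \<subseteq> A" using assms by blast
  have f: "finite X" using assms fin_sub by (auto simp: circuit_def)
  have "X - {e} \<in> M" using assms by (auto simp: circuit_def)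
  then have "r (X - {e}) = card (X - {e})" using rk_indep by blast
  moreover have "r X \<noteq> card X" using assms indep_iff by (auto simp: circuit_def)
  ultimately have "r X \<le> r (X - {e})" using rk_le_card[OF f] f assms by (auto simp: card_Diff_singleton_if)
  then show "r (insert e (X - {e})) = r (X - {e})"
    using assms rk_mono[of "X - {e}" X] by (simp add: insert_absorb)
qed

text \<open>An element of the circuit outside \<open>A\<close> is spanned by the rest of the union,
  so deleting it keeps the rank and lowers the nullity by one, while \<open>A\<close> survives.
  Iterated along a proper sequence, this bounds its length by the nullity of its union.\<close>

lemma null_circuit_Un:
  assumes "circuit E M X" "\<not> X \<subseteq> A" "A \<subseteq> E"
  shows "Suc (null A) \<le> null (A \<union> X)"
proof -
  obtain e where e: "e \<in> X" "e \<notin> A" using assms by blast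
  let ?B = "(A \<union> X) - {e}"
  have XE: "X \<subseteq> E" using assms by (auto simp: circuit_def)
  have f: "finite (A \<union> X)" using assms XE fin_sub by simp
  have "e \<in> cls ?B" using circuit_in_cl[OF assms(1) e(1), of ?B] by blast
  then have "r (insert e ?B) = r ?B" by (simp add: cl_def)
  then have "r (A \<union> X) = r ?B" using e by (simp add: insert_absorb)
  moreover have "card (A \<union> X) = Suc (card ?B)" using f e by (metis UnI2 card_Suc_Diff1)
  ultimately have "null (A \<union> X) = Suc (null ?B)"
    using rk_null[of ?B] rk_null[of "A \<union> X"] f by simp
  moreover have "null A \<le> null ?B" using f e by (intro null_mono) auto
  ultimately show ?thesis by simp
qed

end

text \<open>Submodularity is asked only locally, for two elements that each leave the value
  unchanged. This form can be checked for a rank function given by cases, as in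
  \<open>Dress_step\<close>. The local condition extends to all elements spanned by
  \<open>A\<close>, and exchange follows.\<close>

lemma matroid_of_rank:
  fixes f :: "'e set \<Rightarrow> nat"
  assumes E: "finite E" and f0: "f {} = 0"
    and up: "\<And>A x. A \<subseteq> E \<Longrightarrow> x \<in> E \<Longrightarrow> f A \<le> f (insert x A)"
    and unit: "\<And>A x. A \<subseteq> E \<Longrightarrow> x \<in> E \<Longrightarrow> f (insert x A) \<le> Suc (f A)"
    and loc: "\<And>A x y. A \<subseteq> E \<Longrightarrow> x \<in> E \<Longrightarrow> y \<in> E \<Longrightarrow> f (insert x A) = f A \<Longrightarrow> f (insert y A) = f A
      \<Longrightarrow> f (insert x (insert y A)) = f A"
  defines "M \<equiv> {I. I \<subseteq> E \<and> f I = card I}"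
  shows "matroid_on E M" "\<And>A. A \<subseteq> E \<Longrightarrow> rk M A = f A"
proof -
  have span: "f (A \<union> B) = f A" if "A \<subseteq> E" "B \<subseteq> E" "\<And>e. e \<in> B \<Longrightarrow> f (insert e A) = f A" for A B
  proof -
    have "finite B" using that E finite_subset by blast
    \<comment> \<open>The second conjunct strengthens the induction: \<open>loc\<close> is applied
      at \<open>A \<union> B\<close>, so elements not yet added must still be spanned there.\<close>
    then have "B \<subseteq> E \<longrightarrow> (\<forall>e\<in>B. f (insert e A) = f A) \<longrightarrow> f (A \<union> B) = f A
       \<and> (\<forall>e\<in>E. f (insert e A) = f A \<longrightarrow> f (insert e (A \<union> B)) = f A)"
    proof (induction B)
      case empty
      then show ?case by simp
    next
      case (insert b B)
      show ?case
      proof (intro impI)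
        assume a: "insert b B \<subseteq> E" "\<forall>e\<in>insert b B. f (insert e A) = f A"
        then have IH: "f (A \<union> B) = f A" "\<forall>e\<in>E. f (insert e A) = f A \<longrightarrow> f (insert e (A \<union> B)) = f A"
          using insert.IH by auto
        have 1: "f (insert b (A \<union> B)) = f A" using IH a by simp
        have "f (insert e (insert b (A \<union> B))) = f A" if "e \<in> E" "f (insert e A) = f A" for e
          using loc[of "A \<union> B" e b] IH 1 that a \<open>A \<subseteq> E\<close> by auto
        with 1 show "f (A \<union> insert b B) = f A \<and>
          (\<forall>e\<in>E. f (insert e A) = f A \<longrightarrow> f (insert e (A \<union> insert b B)) = f A)" by simp
      qed
    qed
    with that show ?thesis by simp
  qed
  have grow: "f A \<le> f (A \<union> B) \<and> f (A \<union> B) \<le> f A + card B" if "A \<subseteq> E" "B \<subseteq> E" for A B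
  proof -
    have "finite B" using that E finite_subset by blast
    then show ?thesis using that(2)
    proof (induction B)
      case (insert b B)
      then show ?case using up[of "A \<union> B" b] unit[of "A \<union> B" b] that(1) by auto
    qed simp
  qed
  have mono: "f A \<le> f B" if "A \<subseteq> B" "B \<subseteq> E" for A B
    using grow[of A B] that by (metis Un_absorb1 order.trans)
  have le_card: "f A \<le> card A" if "A \<subseteq> E" for A using grow[of "{}" A] that f0 by simp
  have max_ext: "\<exists>e\<in>J - I. insert e I \<in> M" if "I \<in> M" "J \<subseteq> E" "card I < f J" for I J
  proof (rule ccontr)
    assume n: "\<not> ?thesis"
    have I: "I \<subseteq> E" "f I = card I" "finite I" using that E finite_subset by (auto simp: M_def)
    have "f (insert e I) = f I" if e: "e \<in> J" for e
    proof (cases "e \<in> I")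
      case False
      then have "f (insert e I) \<noteq> card (insert e I)" using n e I \<open>J \<subseteq> E\<close> by (auto simp: M_def)
      then show ?thesis using up[of I e] unit[of I e] I False e \<open>J \<subseteq> E\<close> by fastforce
    qed (simp add: insert_absorb)
    then have "f (I \<union> J) = f I" using span I \<open>J \<subseteq> E\<close> by blast
    moreover have "f J \<le> f (I \<union> J)" using mono[of J "I \<union> J"] I \<open>J \<subseteq> E\<close> by blast
    ultimately show False using that I by simp
  qed
  have down: "I \<in> M" if "J \<in> M" "I \<subseteq> J" for I J
  proof -
    have J: "J \<subseteq> E" "f J = card J" "finite J" using that E finite_subset by (auto simp: M_def)
    have "f J \<le> f I + card (J - I)" using grow[of I "J - I"] that J by (metis Diff_subset Un_Diff_cancel Un_absorb1 order.trans)
    moreover have "card J = card I + card (J - I)" using J that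
      by (metis card_Diff_subset card_mono finite_subset le_add_diff_inverse)
    ultimately show ?thesis using le_card[of I] J that by (auto simp: M_def)
  qed
  show mat: "matroid_on E M"
    unfolding matroid_on_def
  proof (intro conjI allI impI)
    show "{} \<in> M" using f0 by (simp add: M_def)
    fix I J assume "I \<in> M \<and> J \<in> M \<and> card I < card J"
    then show "\<exists>e\<in>J - I. insert e I \<in> M" using max_ext[of I J] by (auto simp: M_def)
  next
    fix I J assume "J \<in> M \<and> I \<subseteq> J"
    then show "I \<in> M" using down[of J I] by blast
  next
    show "M \<subseteq> Pow E" by (auto simp: M_def)
  qed (rule E)
  interpret matroid E M using mat by unfold_locales
  fix A assume A: "A \<subseteq> E"
  obtain B where B: "B \<in> M" "B \<subseteq> A" "card B = r A" using ex_basis by blast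
  have "\<not> r A < f A"
  proof
    assume "r A < f A"
    then obtain e where "e \<in> A - B" "insert e B \<in> M" using max_ext B A by metis
    then show False using card_le_rk[of "insert e B" A] B fin_indep[of B] by auto
  qed
  moreover have "r A \<le> f A" using mono[OF B(2) A] B by (simp add: M_def)
  ultimately show "rk M A = f A" by simp
qed

section \<open>Edge sets of complete bipartite graphs\<close>

text \<open>The identity matrix on \<open>J\<close> factors through \<open>I\<close>, which is
  impossible if \<open>J\<close> is larger. Concretely, the unit functions at points of
  \<open>J\<close> are independent and lie in the span of \<open>card I\<close> functions.\<close>

lemma delta_span_card:
  fixes u :: "'e \<Rightarrow> 'e \<Rightarrow> real" and c :: "'e \<Rightarrow> 'e \<Rightarrow> real"
  assumes I: "finite I" and J: "finite J"
    and eq: "\<And>f g. f \<in> J \<Longrightarrow> g \<in> J \<Longrightarrow> (\<Sum>e\<in>I. c f e * u e g) = (if f = g then 1 else 0)"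
  shows "card J \<le> card I"
proof -
  interpret fv: vector_space "\<lambda>(a::real) (f::'e \<Rightarrow> real). (\<lambda>x. a * f x)"
    by unfold_locales (auto simp: fun_eq_iff plus_fun_def algebra_simps)
  define d :: "'e \<Rightarrow> 'e \<Rightarrow> real" where "d f = (\<lambda>x. if x = f then 1 else 0)" for f
  \<comment> \<open>The hypothesis controls \<open>u\<close> only on \<open>J\<close>; cutting it
    off elsewhere makes the identities hold between functions on the whole type.\<close>
  define u' where "u' e = (\<lambda>x. if x \<in> J then u e x else 0)" for e
  have fsum: "(\<Sum>x\<in>S. h x) y = (\<Sum>x\<in>S. h x y)" if "finite S" for S :: "'b set" and h :: "'b \<Rightarrow> 'e \<Rightarrow> real" and y
    using that by induction (auto simp: plus_fun_def zero_fun_def)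
  have inj: "inj d" by (rule injI) (metis d_def zero_neq_one)
  have ind: "fv.independent (d ` J)"
  proof (rule fv.independent_if_scalars_zero)
    show "finite (d ` J)" using J by simp
    fix k x assume z: "(\<Sum>x\<in>d ` J. (\<lambda>y. k x * x y)) = 0" and x: "x \<in> d ` J"
    then obtain f where f: "f \<in> J" "x = d f" by blast
    have "0 = (\<Sum>x\<in>d ` J. (\<lambda>y. k x * x y)) f" using z by (simp add: zero_fun_def)
    also have "\<dots> = (\<Sum>x\<in>d ` J. k x * x f)" using J by (subst fsum) auto
    also have "\<dots> = (\<Sum>g\<in>J. k (d g) * d g f)" using inj by (subst sum.reindex) (auto simp: inj_on_def inj_def)
    also have "\<dots> = (\<Sum>g\<in>J. if g = f then k (d f) else 0)" by (rule sum.cong) (auto simp: d_def)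
    also have "\<dots> = k x" using f J by simp
    finally show "k x = 0" by simp
  qed
  have span: "d ` J \<subseteq> fv.span (u' ` I)"
  proof
    fix x assume "x \<in> d ` J"
    then obtain f where f: "f \<in> J" "x = d f" by blast
    have "x = (\<Sum>e\<in>I. (\<lambda>y. c f e * u' e y))"
    proof
      fix y
      show "x y = (\<Sum>e\<in>I. (\<lambda>y. c f e * u' e y)) y"
        using eq[OF f(1), of y] f I by (subst fsum) (cases "y \<in> J"; auto simp: d_def u'_def)+
    qed
    also have "\<dots> \<in> fv.span (u' ` I)"
      by (intro fv.span_sum fv.span_scale fv.span_base) auto
    finally show "x \<in> fv.span (u' ` I)" .
  qed
  have "card (d ` J) \<le> card (u' ` I)"
    using fv.independent_span_bound[of "u' ` I" "d ` J"] ind span I by blast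
  moreover have "card (d ` J) = card J" using inj by (intro card_image) (auto simp: inj_on_def inj_def)
  moreover have "card (u' ` I) \<le> card I" using I by (rule card_image_le)
  ultimately show ?thesis by simp
qed

text \<open>This is the linear matroid of the evaluation functionals on \<open>W\<close>. If no
  element of \<open>J\<close> extends \<open>I\<close>, then functions of \<open>W\<close> vanishing
  on \<open>I\<close> vanish on \<open>J\<close>; interpolants on \<open>J\<close> are thus
  combinations of those for \<open>I\<close>, and \<open>delta_span_card\<close> bounds
  \<open>card J\<close>.\<close>

lemma interpolation_matroid:
  fixes W :: "('e \<Rightarrow> real) set"
  assumes E: "finite E" and W0: "(\<lambda>x. 0) \<in> W"
    and add: "\<And>v w. v \<in> W \<Longrightarrow> w \<in> W \<Longrightarrow> (\<lambda>x. v x + w x) \<in> W"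
    and scal: "\<And>a w. w \<in> W \<Longrightarrow> (\<lambda>x. a * w x) \<in> W"
  shows "matroid_on E {I. I \<subseteq> E \<and> (\<forall>g. \<exists>w\<in>W. \<forall>e\<in>I. w e = g e)}" (is "matroid_on E ?N")
  unfolding matroid_on_def
proof (intro conjI allI impI)
  fix I J assume "I \<in> ?N \<and> J \<in> ?N \<and> card I < card J"
  then have I: "I \<in> ?N" and J: "J \<in> ?N" and lt: "card I < card J" by blast+
  have fin: "finite I" "finite J" using I J E finite_subset by blast+
  show "\<exists>e\<in>J - I. insert e I \<in> ?N"
  proof (rule ccontr)
    assume no: "\<not> ?thesis"
    have vanish: "w f = 0" if w: "w \<in> W" "\<And>e. e \<in> I \<Longrightarrow> w e = 0" and f: "f \<in> J" for w f
    proof (rule ccontr)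
      assume nz: "w f \<noteq> 0"
      then have "f \<notin> I" using w by blast
      have "\<exists>v\<in>W. \<forall>e\<in>insert f I. v e = g e" for g
      proof -
        have "\<forall>g. \<exists>v\<in>W. \<forall>e\<in>I. v e = g e" using I by simp
        then obtain v where v: "v \<in> W" "\<And>e. e \<in> I \<Longrightarrow> v e = g e" by metis
        let ?v = "\<lambda>x. v x + ((g f - v f) / w f) * w x"
        have "?v \<in> W" using add[OF v(1) scal[OF w(1)]] .
        moreover have "\<forall>e\<in>insert f I. ?v e = g e" using v w nz by auto
        ultimately show ?thesis by (intro bexI[of _ ?v])
      qed
      then have "insert f I \<in> ?N" using I J f by simp blast
      then show False using no f \<open>f \<notin> I\<close> by blast
    qed
    have "\<forall>e. \<exists>w\<in>W. \<forall>x\<in>I. w x = (if x = e then 1 else 0)"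
    proof
      fix e
      have "\<forall>g. \<exists>w\<in>W. \<forall>x\<in>I. w x = g x" using I by simp
      from spec[OF this, of "\<lambda>x. if x = e then 1 else 0"]
      show "\<exists>w\<in>W. \<forall>x\<in>I. w x = (if x = e then 1 else 0)" .
    qed
    then obtain u where u: "\<And>e. u e \<in> W" "\<And>e x. x \<in> I \<Longrightarrow> u e x = (if x = e then 1 else 0)" by metis
    have "\<forall>e. \<exists>w\<in>W. \<forall>x\<in>J. w x = (if x = e then 1 else 0)"
    proof
      fix e
      have "\<forall>g. \<exists>w\<in>W. \<forall>x\<in>J. w x = g x" using J by simp
      from spec[OF this, of "\<lambda>x. if x = e then 1 else 0"]
      show "\<exists>w\<in>W. \<forall>x\<in>J. w x = (if x = e then 1 else 0)" .
    qed
    then obtain v where v: "\<And>e. v e \<in> W" "\<And>e x. x \<in> J \<Longrightarrow> v e x = (if x = e then 1 else 0)" by metis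
    have sumW: "(\<lambda>x. \<Sum>e\<in>S. a e * u e x) \<in> W" if "finite S" for S and a :: "'e \<Rightarrow> real"
      using that by induction (auto intro!: W0 add scal u(1))
    have "(\<Sum>e\<in>I. v f e * u e g) = (if f = g then 1 else 0)" if "f \<in> J" "g \<in> J" for f g
    proof -
      let ?w = "\<lambda>x. v f x + (-1) * (\<Sum>e\<in>I. v f e * u e x)"
      have "?w \<in> W" by (intro add scal v(1) sumW fin)
      moreover have "?w x = 0" if x: "x \<in> I" for x
      proof -
        have "(\<Sum>e\<in>I. v f e * u e x) = (\<Sum>e\<in>I. if e = x then v f x else 0)"
          using u(2)[OF x] by (intro sum.cong) auto
        then show ?thesis using x fin by simp
      qed
      ultimately have "?w g = 0" by (rule vanish) (use that in auto)
      then show ?thesis using v(2) that by auto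
    qed
    then have "card J \<le> card I" using delta_span_card[OF fin, of v u] by blast
    then show False using lt by simp
  qed
next
  fix I J assume "J \<in> ?N \<and> I \<subseteq> J"
  then have IJ: "I \<subseteq> J" "J \<subseteq> E" and J: "\<forall>g. \<exists>w\<in>W. \<forall>e\<in>J. w e = g e" by simp_all
  have "\<exists>w\<in>W. \<forall>e\<in>I. w e = g e" for g using spec[OF J, of g] IJ by blast
  then show "I \<in> ?N" using IJ by auto
qed (use E W0 in auto)

lemma uniform_matroid:
  assumes "finite E"
  shows "matroid_on E {I. I \<subseteq> E \<and> card I \<le> k}"
  unfolding matroid_on_def
proof (intro conjI allI impI)
  fix I J assume a: "J \<in> {I. I \<subseteq> E \<and> card I \<le> k} \<and> I \<subseteq> J"
  then have "card I \<le> card J" using assms by (intro card_mono) (auto intro: finite_subset)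
  then show "I \<in> {I. I \<subseteq> E \<and> card I \<le> k}" using a by auto
next
  fix I J assume a: "I \<in> {I. I \<subseteq> E \<and> card I \<le> k} \<and> J \<in> {I. I \<subseteq> E \<and> card I \<le> k} \<and> card I < card J"
  then have f: "finite I" using assms finite_subset by blast
  then obtain e where "e \<in> J - I" using a by (metis Diff_eq_empty_iff card_mono ex_in_conv leD)
  moreover have "insert e I \<in> {I. I \<subseteq> E \<and> card I \<le> k}" if "e \<in> J - I"
    using a that f by auto
  ultimately show "\<exists>e\<in>J - I. insert e I \<in> {I. I \<subseteq> E \<and> card I \<le> k}" by blast
qed (use assms in auto)

lemma card3_split:
  assumes "card A = 3" "x \<in> A"
  obtains a a' where "A = {x, a, a'}" "a \<noteq> a'" "x \<noteq> a" "x \<noteq> a'"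
proof -
  have "card (A - {x}) = 2" using assms card_ge_0_finite[of A] by simp
  then obtain a a' where aa: "A - {x} = {a, a'}" "a \<noteq> a'" by (meson card_2_iff)
  then have "A = {x, a, a'}" "x \<noteq> a" "x \<noteq> a'" using assms by auto
  then show ?thesis using aa that by blast
qed

lemma ex_two:
  assumes "2 \<le> card A"
  obtains a b where "a \<in> A" "b \<in> A" "a \<noteq> b"
proof -
  obtain T where T: "T \<subseteq> A" "card T = 2" using assms obtain_subset_with_card_n by metis
  then obtain a b where "T = {a, b}" "a \<noteq> b" by (meson card_2_iff)
  then show ?thesis using T that by blast
qed

text \<open>Edges are abstract values named injectively by a pair of indices. The same locale then
  covers the concrete two-element edges and the graph with its two sides exchanged.\<close>

locale grid =
  fixes edge :: "nat \<Rightarrow> nat \<Rightarrow> 'e" and m n :: nat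
  assumes edge_inj [simp]: "edge i j = edge i' j' \<longleftrightarrow> i = i' \<and> j = j'"
    and m3: "3 \<le> m" and n3: "3 \<le> n"
begin

definition K :: "nat set \<Rightarrow> nat set \<Rightarrow> 'e set" where
  "K A B = {edge i j | i j. i \<in> A \<and> j \<in> B}"

definition E :: "'e set" where "E = K {..<m} {..<n}"

definition XX :: "'e set set" where
  "XX = {K A B | A B. A \<subseteq> {..<m} \<and> B \<subseteq> {..<n} \<and> card A = 3 \<and> card B = 3}"

lemma in_K [simp]: "edge i j \<in> K A B \<longleftrightarrow> i \<in> A \<and> j \<in> B"
  by (auto simp: K_def)

lemma K_cases: "e \<in> K A B \<Longrightarrow> \<exists>i j. e = edge i j \<and> i \<in> A \<and> j \<in> B"
  by (auto simp: K_def)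

lemma K_subI: "(\<And>i j. i \<in> A \<Longrightarrow> j \<in> B \<Longrightarrow> edge i j \<in> S) \<Longrightarrow> K A B \<subseteq> S"
  by (auto simp: K_def)

lemma K_mono: "A \<subseteq> C \<Longrightarrow> B \<subseteq> D \<Longrightarrow> K A B \<subseteq> K C D"
  by (auto simp: K_def)

lemma K_Int: "K A B \<inter> K C D = K (A \<inter> C) (B \<inter> D)"
  by (auto simp: K_def)

lemma K_image: "K A B = case_prod edge ` (A \<times> B)"
  by (auto simp: K_def)

lemma finite_K: "finite A \<Longrightarrow> finite B \<Longrightarrow> finite (K A B)"
  by (simp add: K_image)

lemma card_K: "card (K A B) = card A * card B"
  unfolding K_image by (subst card_image) (auto simp: inj_on_def card_cartesian_product)

lemma K_sub_E: "A \<subseteq> {..<m} \<Longrightarrow> B \<subseteq> {..<n} \<Longrightarrow> K A B \<subseteq> E"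
  unfolding E_def by (rule K_mono)

lemma in_E [simp]: "edge i j \<in> E \<longleftrightarrow> i < m \<and> j < n"
  by (simp add: E_def)

lemma E_cases: "e \<in> E \<Longrightarrow> \<exists>i j. e = edge i j \<and> i < m \<and> j < n"
  unfolding E_def using K_cases by fastforce

lemma finite_E: "finite E"
  by (simp add: E_def finite_K)

lemma K_sub_D:
  assumes "K A B \<subseteq> K C D" "A \<noteq> {}" "B \<noteq> {}"
  shows "A \<subseteq> C" "B \<subseteq> D"
proof -
  have 1: "i \<in> C \<and> j \<in> D" if "i \<in> A" "j \<in> B" for i j
  proof -
    have "edge i j \<in> K A B" using that by simp
    then have "edge i j \<in> K C D" using assms(1) by blast
    then show ?thesis by simp
  qed
  show "A \<subseteq> C" "B \<subseteq> D" using 1 assms by blast+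
qed

lemma XX_I: "A \<subseteq> {..<m} \<Longrightarrow> B \<subseteq> {..<n} \<Longrightarrow> card A = 3 \<Longrightarrow> card B = 3 \<Longrightarrow> K A B \<in> XX"
  unfolding XX_def by blast

lemma XX_sub_E: "X \<in> XX \<Longrightarrow> X \<subseteq> E"
  unfolding XX_def using K_sub_E by blast

lemma card_XX: "X \<in> XX \<Longrightarrow> card X = 9"
  unfolding XX_def by (auto simp: card_K)

lemma finite_X: "X \<in> XX \<Longrightarrow> finite X"
  using XX_sub_E finite_E finite_subset by blast

lemma finite_left: "A \<subseteq> {..<m} \<Longrightarrow> finite A" and finite_right: "B \<subseteq> {..<n} \<Longrightarrow> finite B"
  using finite_subset by blast+

text \<open>The matroid of edge sets on which the functions of \<open>W\<close> interpolate arbitrary values is a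
  completion matroid of matrices of rank two; it supplies the lower bound on the rank of \<open>M\<close>.\<close>

definition W :: "('e \<Rightarrow> real) set" where
  "W = {w. \<exists>p q c d. \<forall>i j. w (edge i j) = p i + q i * real j + c j + d j * real i}"

lemma W_I: "(\<And>i j. w (edge i j) = p i + q i * real j + c j + d j * real i) \<Longrightarrow> w \<in> W"
  unfolding W_def by blast

text \<open>Such an \<open>I\<close> lies in two full rows and two full columns. The values in rows
  \<open>a\<close> and \<open>a'\<close> determine the affine part \<open>c j + d j * real i\<close>
  of each column; in every other row the two entries in columns \<open>b\<close> and
  \<open>b'\<close> then determine \<open>p i + q i * real j\<close>.\<close>

lemma W_cross:
  assumes "a \<noteq> a'" "b \<noteq> b'" and I: "\<And>i j. edge i j \<in> I \<Longrightarrow> i \<in> {a, a'} \<or> j \<in> {b, b'}" "I \<subseteq> E"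
  shows "\<exists>w\<in>W. \<forall>e\<in>I. w e = g e"
proof -
  define d where "d j = (g (edge a' j) - g (edge a j)) / (real a' - real a)" for j
  define c where "c j = g (edge a j) - d j * real a" for j
  define h where "h i j = g (edge i j) - c j - d j * real i" for i j
  define q where "q i = (if i \<in> {a, a'} then 0 else (h i b' - h i b) / (real b' - real b))" for i
  define p where "p i = (if i \<in> {a, a'} then 0 else h i b - q i * real b)" for i
  define w where "w e = (let (i, j) = inv (case_prod edge) e in p i + q i * real j + c j + d j * real i)" for e
  have inj: "inj (case_prod edge)" by (auto simp: inj_def)
  have w: "w (edge i j) = p i + q i * real j + c j + d j * real i" for i j
    using inv_f_f[OF inj, of "(i, j)"] by (simp add: w_def)
  have "w \<in> W" unfolding W_def using w by blast
  moreover have "w (edge i j) = g (edge i j)" if "edge i j \<in> I" for i j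
  proof -
    have da: "d j * (real a' - real a) = g (edge a' j) - g (edge a j)" using assms by (simp add: d_def)
    have 1: "w (edge a j) = g (edge a j)" by (simp add: w p_def q_def c_def)
    have 2: "w (edge a' j) = g (edge a' j)" using da by (simp add: w p_def q_def c_def algebra_simps)
    have 3: "w (edge i j) = g (edge i j)" if ij: "j \<in> {b, b'}" "i \<notin> {a, a'}"
    proof -
      have "q i * (real b' - real b) = h i b' - h i b" using assms ij by (simp add: q_def)
      then have "q i * real b' = h i b' - h i b + q i * real b" by (simp add: algebra_simps)
      then have "p i + q i * real j = h i j" using ij by (auto simp: p_def)
      then show ?thesis by (simp add: w h_def)
    qed
    show ?thesis using I(1)[OF that] 1 2 3 by blast
  qed
  ultimately show ?thesis using I(2) E_cases by (metis subsetD)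
qed

definition NW :: "'e set set" where
  "NW = {I. I \<subseteq> E \<and> (\<forall>g. \<exists>w\<in>W. \<forall>e\<in>I. w e = g e)}"

lemma matroid_NW: "matroid_on E NW"
  unfolding NW_def
proof (rule interpolation_matroid[OF finite_E])
  show "(\<lambda>x. 0) \<in> W" unfolding W_def by (auto intro!: exI[of _ "\<lambda>_. 0"])
  fix v w :: "'e \<Rightarrow> real" and a :: real assume "w \<in> W"
  then obtain p q c d where w: "\<And>i j. w (edge i j) = p i + q i * real j + c j + d j * real i"
    unfolding W_def by blast
  then have "a * w (edge i j) = a * p i + (a * q i) * real j + a * c j + (a * d j) * real i" for i j
    by (simp add: algebra_simps)
  then show "(\<lambda>x. a * w x) \<in> W" by (rule W_I)
  assume "v \<in> W"
  then obtain p' q' c' d' where v: "\<And>i j. v (edge i j) = p' i + q' i * real j + c' j + d' j * real i"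
    unfolding W_def by blast
  have "v (edge i j) + w (edge i j)
      = (p' i + p i) + (q' i + q i) * real j + (c' j + c j) + (d' j + d j) * real i" for i j
    by (simp add: v w algebra_simps)
  then show "(\<lambda>x. v x + w x) \<in> W" by (rule W_I)
qed

lemma circuitI:
  assumes "matroid_on E N" "X \<subseteq> E" "X \<notin> N" "\<And>e. e \<in> X \<Longrightarrow> X - {e} \<in> N"
  shows "circuit E N X"
proof -
  interpret N: matroid E N by unfold_locales (rule assms)
  have "D \<in> N" if D: "D \<subset> X" for D
  proof -
    obtain e where e: "e \<in> X" "e \<notin> D" using D by blast
    then have "D \<subseteq> X - {e}" using D by blast
    then show ?thesis using assms(4)[OF e(1)] N.indep_mono by blast
  qed
  then show ?thesis using assms by (auto simp: circuit_def)
qed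

lemma circuit_NW:
  assumes "X \<in> XX"
  shows "circuit E NW X"
proof (rule circuitI[OF matroid_NW XX_sub_E[OF assms]])
  obtain A B where X: "X = K A B" "A \<subseteq> {..<m}" "B \<subseteq> {..<n}" "card A = 3" "card B = 3"
    using assms unfolding XX_def by blast
  show "X \<notin> NW"
  proof
    assume "X \<in> NW"
    then have int: "\<forall>g. \<exists>w\<in>W. \<forall>e\<in>X. w e = g e" by (simp add: NW_def)
    have "A \<noteq> {}" "B \<noteq> {}" using X by auto
    then obtain x y where "x \<in> A" "y \<in> B" by blast
    then obtain a a' b b' where A: "A = {x, a, a'}" "a \<noteq> a'" "x \<noteq> a" "x \<noteq> a'"
      and B: "B = {y, b, b'}" "b \<noteq> b'" "y \<noteq> b" "y \<noteq> b'"
      using card3_split X by metis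
    obtain w where w: "w \<in> W" "\<And>e. e \<in> X \<Longrightarrow> w e = (if e = edge x y then 1 else 0)"
      using spec[OF int, of "\<lambda>e. if e = edge x y then 1 else 0"] by blast
    obtain p q c d where wf: "\<And>i j. w (edge i j) = p i + q i * real j + c j + d j * real i"
      using w(1) unfolding W_def by blast
    define f where "f i j = w (edge i j)" for i j
    have v: "f x y = 1" "f x b = 0" "f x b' = 0" "f a y = 0" "f a b = 0" "f a b' = 0"
      "f a' y = 0" "f a' b = 0" "f a' b' = 0"
      using A B by (auto simp: f_def w(2) X(1))
    \<comment> \<open>the outer product of the affine relations on the two sides annihilates \<open>W\<close>\<close>
    have "(real a - real a') * ((real b - real b') * f x y + (real b' - real y) * f x b + (real y - real b) * f x b')
      + (real a' - real x) * ((real b - real b') * f a y + (real b' - real y) * f a b + (real y - real b) * f a b')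
      + (real x - real a) * ((real b - real b') * f a' y + (real b' - real y) * f a' b + (real y - real b) * f a' b') = 0"
      unfolding f_def wf by (simp add: algebra_simps)
    then have "(real a - real a') * (real b - real b') = 0" by (simp add: v)
    then show False using A B by simp
  qed
  fix e assume "e \<in> X"
  then obtain x y where e: "e = edge x y" "x \<in> A" "y \<in> B" using X K_cases by blast
  then obtain a a' b b' where A: "A = {x, a, a'}" "a \<noteq> a'" "x \<noteq> a" "x \<noteq> a'"
    and B: "B = {y, b, b'}" "b \<noteq> b'" "y \<noteq> b" "y \<noteq> b'"
    using card3_split X by metis
  \<comment> \<open>A K33 without the edge at row \<open>x\<close> and column \<open>y\<close>
    consists of the entries in the other two rows or the other two columns, the shape handled by
    \<open>W_cross\<close>.\<close>
  have "\<exists>w\<in>W. \<forall>e\<in>X - {e}. w e = g e" for g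
    using A B XX_sub_E[OF assms] by (intro W_cross[of a a' b b']) (auto simp: X(1) e(1))
  then show "X - {e} \<in> NW" using XX_sub_E[OF assms] by (auto simp: NW_def)
qed

definition xmat :: "'e set set \<Rightarrow> bool" where
  "xmat N \<longleftrightarrow> matroid_on E N \<and> (\<forall>X\<in>XX. circuit E N X)"

text \<open>Every copy of K33 has nine edges. This witness makes all sets of at most eight edges
  independent in a greatest matroid, and it also bounds \<open>val_min\<close> from below.\<close>

lemma xmat_uniform: "xmat {I. I \<subseteq> E \<and> card I \<le> 8}"
proof -
  have u: "matroid_on E {I. I \<subseteq> E \<and> card I \<le> 8}" by (rule uniform_matroid[OF finite_E])
  have "circuit E {I. I \<subseteq> E \<and> card I \<le> 8} X" if X: "X \<in> XX" for X
    by (rule circuitI[OF u XX_sub_E[OF X]]) (use X XX_sub_E card_XX finite_X in auto)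
  then show ?thesis using u by (simp add: xmat_def)
qed

lemma NW_big: "\<exists>I\<in>NW. card I = 2 * (m + n) - 4"
proof
  \<comment> \<open>A full cross of two rows and two columns has \<open>2 * n + 2 * (m - 2)\<close>
    edges.\<close>
  let ?I = "K {0,1} {..<n} \<union> K {2..<m} {0,1}"
  have sub: "?I \<subseteq> E" using m3 n3 by (auto simp: K_def E_def)
  have "\<exists>w\<in>W. \<forall>e\<in>?I. w e = g e" for g
    using sub by (intro W_cross[of 0 1 0 1]) auto
  then show "?I \<in> NW" using sub by (auto simp: NW_def)
  have "K {0,1} {..<n} \<inter> K {2..<m} {0,1} = {}" by (auto simp: K_Int K_def)
  then have "card ?I = card (K {0,1} {..<n}) + card (K {2..<m} {0,1})"
    by (intro card_Un_disjoint finite_K) auto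
  then show "card ?I = 2 * (m + n) - 4" using m3 n3 by (simp add: card_K algebra_simps)
qed

end

section \<open>Ranks and flats of complete bipartite graphs in a greatest matroid\<close>

locale k33 = grid edge m n for edge :: "nat \<Rightarrow> nat \<Rightarrow> 'e" and m n +
  fixes M :: "'e set set"
  assumes mat: "matroid_on E M"
    and circ: "X \<in> XX \<Longrightarrow> circuit E M X"
    and greatest: "matroid_on E N \<Longrightarrow> (\<And>X. X \<in> XX \<Longrightarrow> circuit E N X) \<Longrightarrow> N \<subseteq> M"
begin

sublocale matroid E M by unfold_locales (rule mat)

text \<open>Exchanging the two sides changes neither the ground set nor the matroid, so this
  interpretation transfers every statement about left vertices to right vertices.\<close>

lemma swap: "k33 (\<lambda>i j. edge j i) n m M"
proof -
  interpret g: grid "\<lambda>i j. edge j i" n m by unfold_locales (use m3 n3 in auto)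
  have K: "g.K A B = K B A" for A B by (auto simp: g.K_def K_def)
  have E: "g.E = E" by (simp add: g.E_def E_def K)
  have XX: "g.XX = XX" unfolding g.XX_def XX_def K by blast
  show ?thesis by unfold_locales (use mat circ greatest in \<open>auto simp: E XX\<close>)
qed

lemma swap_K: "grid.K (\<lambda>i j. edge j i) A B = K B A"
proof -
  interpret g: k33 "\<lambda>i j. edge j i" n m M by (rule swap)
  show ?thesis by (auto simp: g.K_def K_def)
qed

lemma swap_E: "grid.E (\<lambda>i j. edge j i) n m = E"
proof -
  interpret g: k33 "\<lambda>i j. edge j i" n m M by (rule swap)
  show ?thesis by (simp add: g.E_def E_def swap_K)
qed

lemma swap_XX: "grid.XX (\<lambda>i j. edge j i) n m = XX"
proof -
  interpret g: k33 "\<lambda>i j. edge j i" n m M by (rule swap)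
  show ?thesis unfolding g.XX_def XX_def swap_K by blast
qed

lemma small_indep:
  assumes "I \<subseteq> E" "card I \<le> 8"
  shows "I \<in> M"
proof -
  have "{I. I \<subseteq> E \<and> card I \<le> 8} \<subseteq> M"
    using xmat_uniform unfolding xmat_def by (intro greatest) auto
  then show ?thesis using assms by blast
qed

lemma rk_E_ge: "2 * (m + n) \<le> r E + 4"
proof -
  obtain I where I: "I \<in> NW" "card I = 2 * (m + n) - 4" using NW_big by blast
  then have "I \<in> M" using greatest[OF matroid_NW circuit_NW] by blast
  then show ?thesis using card_le_rk[of I E] I indep_sub by auto
qed

lemma edge_in_cl:
  assumes "A \<subseteq> {..<m}" "B \<subseteq> {..<n}" "card A = 3" "card B = 3" "v \<in> A" "y \<in> B" "K A B - {edge v y} \<subseteq> P"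
  shows "edge v y \<in> cls P"
  using circuit_in_cl[OF circ[OF XX_I[OF assms(1-4)]], of "edge v y" P] assms by simp

text \<open>Two vertices of \<open>A\<close>, the vertex \<open>v\<close>, the columns
  \<open>y1\<close>, \<open>y2\<close> and any third column of \<open>B\<close> form a K33 in which
  only the edge from \<open>v\<close> to that column can be missing. Attaching a new vertex to all
  of \<open>B\<close> therefore costs at most two in rank.\<close>

lemma star_in_cl:
  assumes A: "A \<subseteq> {..<m}" "2 \<le> card A" and B: "B \<subseteq> {..<n}" and K: "K A B \<subseteq> P" and PE: "P \<subseteq> E"
    and v: "v < m" and y: "y1 \<in> B" "y2 \<in> B" "y1 \<noteq> y2" "edge v y1 \<in> P" "edge v y2 \<in> P"
  shows "K {v} B \<subseteq> cls P"
proof (rule K_subI)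
  fix i y assume "i \<in> {v}" "y \<in> B"
  then have i: "i = v" and yB: "y \<in> B" by auto
  show "edge i y \<in> cls P"
  proof (cases "edge v y \<in> P")
    case True
    then show ?thesis using sub_cl[OF PE] i by blast
  next
    case False
    then have "v \<notin> A" using K yB by (meson in_K subsetD)
    obtain a a' where a: "a \<in> A" "a' \<in> A" "a \<noteq> a'" using ex_two[OF A(2)] by blast
    have ny: "y \<noteq> y1" "y \<noteq> y2" using False y by auto
    have "edge v y \<in> cls P"
    proof (rule edge_in_cl[of "{v, a, a'}" "{y, y1, y2}"])
      show "{v, a, a'} \<subseteq> {..<m}" "{y, y1, y2} \<subseteq> {..<n}" using a A v yB y B by auto
      have "v \<noteq> a" "v \<noteq> a'" using a \<open>v \<notin> A\<close> by auto
      then show "card {v, a, a'} = 3" using a by simp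
      show "card {y, y1, y2} = 3" using ny y by auto
      have "edge i j \<in> P" if "i \<in> {v, a, a'}" "j \<in> {y, y1, y2}" "\<not> (i = v \<and> j = y)" for i j
      proof (cases "i = v")
        case True
        then show ?thesis using that y by auto
      next
        case False
        then have "edge i j \<in> K A B" using that a yB y by auto
        then show ?thesis using K by blast
      qed
      then show "K {v, a, a'} {y, y1, y2} - {edge v y} \<subseteq> P" by (auto simp: K_def)
    qed auto
    then show ?thesis using i by simp
  qed
qed

lemma rk_Un_star_le:
  assumes A: "A \<subseteq> {..<m}" "2 \<le> card A" and B: "B \<subseteq> {..<n}" and K: "K A B \<subseteq> P" and PE: "P \<subseteq> E"
    and v: "v < m"
  shows "r (P \<union> K {v} B) \<le> r P + 2"
proof (cases "2 \<le> card B")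
  case False
  then have "r (P \<union> K {v} B) \<le> r P + card (K {v} B)"
    using finite_right[OF B] by (intro rk_Un_le finite_K) auto
  then show ?thesis using False by (simp add: card_K)
next
  case True
  then obtain y1 y2 where y: "y1 \<in> B" "y2 \<in> B" "y1 \<noteq> y2" using ex_two by blast
  let ?P = "P \<union> {edge v y1, edge v y2}"
  have PE': "?P \<subseteq> E" using PE v y B by auto
  have "K {v} B \<subseteq> cls ?P" using star_in_cl[OF A B _ PE' v y(1,2,3)] K by blast
  then have "r (?P \<union> K {v} B) = r ?P" by (rule rk_sub_cl)
  moreover have "r (P \<union> K {v} B) \<le> r (?P \<union> K {v} B)" by (rule rk_mono) auto
  moreover have "r ?P \<le> r P + card {edge v y1, edge v y2}" by (rule rk_Un_le) simp
  moreover have "card {edge v y1, edge v y2} = 2" using y by simp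
  ultimately show ?thesis by simp
qed

lemma rk_K_extend:
  assumes A: "A \<subseteq> {..<m}" "2 \<le> card A" and B: "B \<subseteq> {..<n}" and C: "C \<subseteq> {..<m}"
  shows "r (K (A \<union> C) B) \<le> r (K A B) + 2 * card C"
proof -
  have "finite C" using C finite_left by blast
  then show ?thesis using C
  proof (induction C)
    case (insert v C)
    have "K (A \<union> insert v C) B = K (A \<union> C) B \<union> K {v} B" by (auto simp: K_def)
    moreover have "r (K (A \<union> C) B \<union> K {v} B) \<le> r (K (A \<union> C) B) + 2"
      using A B insert.prems by (intro rk_Un_star_le[of A] K_mono K_sub_E) auto
    ultimately show ?case using insert by auto
  qed simp
qed

lemma rk_K_extend_right:
  assumes "A \<subseteq> {..<m}" "2 \<le> card B" and B: "B \<subseteq> {..<n}" and D: "D \<subseteq> {..<n}"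
  shows "r (K A (B \<union> D)) \<le> r (K A B) + 2 * card D"
proof -
  interpret g: k33 "\<lambda>i j. edge j i" n m M by (rule swap)
  show ?thesis using g.rk_K_extend[of B A D] assms by (simp add: swap_K)
qed

lemma rk_K_le:
  assumes A: "A \<subseteq> {..<m}" "2 \<le> card A" and B: "B \<subseteq> {..<n}"
  shows "r (K A B) + 4 \<le> 2 * (card A + card B)"
proof -
  obtain a a' where a: "a \<in> A" "a' \<in> A" "a \<noteq> a'" using ex_two[OF A(2)] by blast
  have "finite A" using A finite_left by blast
  have "r (K ({a,a'} \<union> (A - {a,a'})) B) \<le> r (K {a,a'} B) + 2 * card (A - {a,a'})"
    using a A B by (intro rk_K_extend) auto
  moreover have "{a,a'} \<union> (A - {a,a'}) = A" using a by auto
  moreover have "r (K {a,a'} B) \<le> 2 * card B"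
    using rk_le_card[of "K {a,a'} B"] finite_K[of "{a,a'}" B] finite_right[OF B] a by (simp add: card_K)
  moreover have "card (A - {a,a'}) + 2 = card A" using a \<open>finite A\<close> A by (simp add: card_Diff_subset)
  ultimately show ?thesis by simp
qed

text \<open>The lower bound comes from the whole graph: growing \<open>K A B\<close> to
  \<open>E\<close> costs at most two per new vertex, so a smaller rank here would contradict
  \<open>rk_E_ge\<close>.\<close>

lemma rk_K:
  assumes A: "A \<subseteq> {..<m}" "2 \<le> card A" and B: "B \<subseteq> {..<n}" "2 \<le> card B"
  shows "r (K A B) + 4 = 2 * (card A + card B)"
proof -
  have fA: "finite A" and fB: "finite B" using A B finite_left finite_right by blast+
  have "{..<m} = A \<union> ({..<m} - A)" "{..<n} = B \<union> ({..<n} - B)" using A B by auto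
  then have "r E \<le> r (K A {..<n}) + 2 * card ({..<m} - A)"
    using rk_K_extend[of A "{..<n}" "{..<m} - A"] A by (simp add: E_def)
  also have "r (K A {..<n}) \<le> r (K A B) + 2 * card ({..<n} - B)"
    using rk_K_extend_right[of A B "{..<n} - B"] A B \<open>{..<n} = B \<union> ({..<n} - B)\<close> by simp
  finally have "r E \<le> r (K A B) + 2 * card ({..<n} - B) + 2 * card ({..<m} - A)" by simp
  moreover have "card ({..<m} - A) + card A = m" "card ({..<n} - B) + card B = n"
    using A B fA fB card_mono[of "{..<m}" A] card_mono[of "{..<n}" B] by (auto simp: card_Diff_subset)
  ultimately have "2 * (card A + card B) \<le> r (K A B) + 4" using rk_E_ge by presburger
  then show ?thesis using rk_K_le[OF A B(1)] by simp
qed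

lemma null_K:
  assumes A: "A \<subseteq> {..<m}" "2 \<le> card A" and B: "B \<subseteq> {..<n}" "2 \<le> card B"
  shows "null (K A B) = (card A - 2) * (card B - 2)"
proof -
  have "finite (K A B)" using A B finite_K finite_left finite_right by blast
  then have "r (K A B) + null (K A B) = card A * card B" using rk_null by (simp add: card_K)
  moreover obtain a b where ab: "card A = a + 2" "card B = b + 2"
    using A B by (metis add.commute le_Suc_ex)
  ultimately show ?thesis using rk_K[OF A B] by (simp add: algebra_simps)
qed

text \<open>Over the complete graph on the remaining vertices, two edges at \<open>v\<close> already
  span all of \<open>E\<close>, so by the rank of \<open>E\<close> they must add two. Submodularity
  transfers this gain to the smaller \<open>P\<close>, and a subset \<open>N\<close> of the two
  edges must gain its full size.\<close>

lemma rk_Un_star: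
  assumes P: "P \<subseteq> E" "P \<inter> K {v} {..<n} = {}" and v: "v < m" and N: "N \<subseteq> {..<n}" "card N \<le> 2"
  shows "r (P \<union> K {v} N) = r P + card N"
proof -
  have "2 \<le> card {..<n}" using n3 by simp
  then obtain N2 where N2: "N \<subseteq> N2" "N2 \<subseteq> {..<n}" "card N2 = 2"
    using N exists_subset_between[of N 2 "{..<n}"] by auto
  let ?L = "{..<m} - {v}"
  have cL: "card ?L + 1 = m" using v by simp
  let ?Q = "K ?L {..<n}"
  obtain y1 y2 where y: "N2 = {y1, y2}" "y1 \<noteq> y2" using N2 by (meson card_2_iff)
  have QE: "?Q \<union> K {v} N2 \<subseteq> E" using N2 v by (auto simp: K_def E_def)
  have "K {v} {..<n} \<subseteq> cls (?Q \<union> K {v} N2)"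
  proof (rule star_in_cl[of ?L])
    show "?L \<subseteq> {..<m}" "2 \<le> card ?L" using m3 v by auto
    show "y1 \<in> {..<n}" "y2 \<in> {..<n}" "y1 \<noteq> y2" using N2 y by auto
    show "edge v y1 \<in> ?Q \<union> K {v} N2" "edge v y2 \<in> ?Q \<union> K {v} N2" using y by auto
  qed (use v QE in auto)
  then have "r (?Q \<union> K {v} N2 \<union> K {v} {..<n}) = r (?Q \<union> K {v} N2)" by (rule rk_sub_cl)
  moreover have "?Q \<union> K {v} N2 \<union> K {v} {..<n} = E" using v N2 by (auto simp: K_def E_def)
  ultimately have "2 * (m + n) \<le> r (?Q \<union> K {v} N2) + 4" using rk_E_ge by simp
  moreover have "r ?Q + 4 \<le> 2 * (card ?L + n)" using rk_K_le[of ?L "{..<n}"] m3 v by simp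
  ultimately have ge: "r ?Q + 2 \<le> r (?Q \<union> K {v} N2)" using cL by presburger
  have PQ: "P \<subseteq> ?Q"
  proof
    fix e assume e: "e \<in> P"
    then obtain i j where ij: "e = edge i j" "i < m" "j < n" using P E_cases by blast
    then have "i \<noteq> v" using e P(2) by (metis IntI empty_iff in_K insertI1 lessThan_iff)
    then show "e \<in> ?Q" using ij by simp
  qed
  have "r ((P \<union> K {v} N2) \<union> ?Q) + r ((P \<union> K {v} N2) \<inter> ?Q) \<le> r (P \<union> K {v} N2) + r ?Q"
    by (rule rk_submod)
  moreover have "(P \<union> K {v} N2) \<union> ?Q = ?Q \<union> K {v} N2" using PQ by auto
  moreover have "(P \<union> K {v} N2) \<inter> ?Q = P" using PQ by (auto simp: K_def)
  ultimately have 2: "r P + 2 \<le> r (P \<union> K {v} N2)" using ge by simp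
  have fin: "finite N2" using N2 finite_right by blast
  have "P \<union> K {v} N2 = (P \<union> K {v} N) \<union> K {v} (N2 - N)" using N2 by (auto simp: K_def)
  then have "r (P \<union> K {v} N2) \<le> r (P \<union> K {v} N) + card (K {v} (N2 - N))"
    using rk_Un_le[of "K {v} (N2 - N)" "P \<union> K {v} N"] fin by (simp add: finite_K)
  moreover have "card (K {v} (N2 - N)) + card N = 2"
    using N2 fin finite_subset[OF N2(1) fin] card_mono[OF fin N2(1)] by (simp add: card_K card_Diff_subset)
  moreover have "r (P \<union> K {v} N) \<le> r P + card (K {v} N)"
    using finite_subset[OF N2(1) fin] by (intro rk_Un_le finite_K) auto
  ultimately show ?thesis using 2 by (simp add: card_K)
qed

lemma rk_Un_star_right:
  assumes P: "P \<subseteq> E" "P \<inter> K {..<m} {y} = {}" and "y < n" and N: "N \<subseteq> {..<m}" "card N \<le> 2"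
  shows "r (P \<union> K N {y}) = r P + card N"
proof -
  interpret g: k33 "\<lambda>i j. edge j i" n m M by (rule swap)
  show ?thesis using g.rk_Un_star[of P y N] assms by (simp add: swap_K swap_E)
qed

text \<open>An edge outside has an endpoint that meets no edge of \<open>K A B\<close>, so it raises
  the rank by one.\<close>

lemma flat_K:
  assumes A: "A \<subseteq> {..<m}" and B: "B \<subseteq> {..<n}"
  shows "isflat (K A B)"
proof -
  have "e \<in> K A B" if e: "e \<in> cls (K A B)" for e
  proof (rule ccontr)
    assume ne: "e \<notin> K A B"
    have eE: "e \<in> E" and re: "r (insert e (K A B)) = r (K A B)" using e by (auto simp: cl_def)
    then obtain x y where xy: "e = edge x y" "x < m" "y < n" using E_cases by blast
    then have "x \<notin> A \<or> y \<notin> B" using ne by simp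
    then show False
    proof
      assume "x \<notin> A"
      then have "r (K A B \<union> K {x} {y}) = r (K A B) + 1"
        using rk_Un_star[of "K A B" x "{y}"] A B xy K_sub_E[OF A B] by (auto simp: K_Int) (simp add: K_def)
      moreover have "K A B \<union> K {x} {y} = insert e (K A B)" using xy by (auto simp: K_def)
      ultimately show False using re by simp
    next
      assume "y \<notin> B"
      then have "r (K A B \<union> K {x} {y}) = r (K A B) + 1"
        using rk_Un_star_right[of "K A B" y "{x}"] A B xy K_sub_E[OF A B] by (auto simp: K_Int) (simp add: K_def)
      moreover have "K A B \<union> K {x} {y} = insert e (K A B)" using xy by (auto simp: K_def)
      ultimately show False using re by simp
    qed
  qed
  then show ?thesis using K_sub_E[OF A B] by (auto simp: flat_def)
qed

lemma star_indep:
  assumes v: "v < m" and N: "N \<subseteq> {..<n}"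
  shows "K {v} N \<in> M"
proof -
  have "finite N" using N finite_right by blast
  then have "r (K {v} N) = card N" using N
  proof (induction N)
    case empty
    have "K {v} {} = {}" by (simp add: K_def)
    then show ?case using rk_indep[OF empty_indep] by simp
  next
    case (insert y N)
    have "K {v} (insert y N) = K {v} N \<union> K {v} {y}" by (auto simp: K_def)
    moreover have "K {v} N \<inter> K {..<m} {y} = {}" using insert by (auto simp: K_def)
    moreover have "K {v} N \<subseteq> E" using v insert by (intro K_sub_E) auto
    ultimately show ?case using rk_Un_star_right[of "K {v} N" y "{v}"] insert v by simp
  qed
  then show ?thesis using indep_iff[of "K {v} N"] K_sub_E[of "{v}" N] v N by (simp add: card_K)
qed

end

section \<open>Blobs\<close>

lemma ex_max_nat:
  fixes f :: "'a \<Rightarrow> nat"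
  assumes "finite S" "S \<noteq> {}"
  shows "\<exists>p\<in>S. \<forall>q\<in>S. f q \<le> f p"
proof -
  have "Max (f ` S) \<in> f ` S" using assms by (intro Max_in) auto
  then obtain p where "p \<in> S" "f p = Max (f ` S)" by auto
  moreover have "f q \<le> Max (f ` S)" if "q \<in> S" for q using assms that by simp
  ultimately show ?thesis by metis
qed

section \<open>Merging blobs and splitting their weights\<close>

context grid
begin

text \<open>Closure under the weak saturation steps that complete a \<open>K\<^sub>3\<^sub>,\<^sub>3\<close> minus an edge.\<close>

definition wclosed :: "'e set \<Rightarrow> bool" where
  "wclosed P \<longleftrightarrow> P \<subseteq> E \<and> (\<forall>X\<in>XX. \<forall>e. X - {e} \<subseteq> P \<longrightarrow> X \<subseteq> P)"

definition Blobs :: "'e set \<Rightarrow> (nat set \<times> nat set) set" where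
  "Blobs P = {(A, B). A \<subseteq> {..<m} \<and> B \<subseteq> {..<n} \<and> 3 \<le> card A \<and> 3 \<le> card B \<and> K A B \<subseteq> P \<and>
     (\<forall>C D. C \<subseteq> {..<m} \<longrightarrow> D \<subseteq> {..<n} \<longrightarrow> A \<subseteq> C \<longrightarrow> B \<subseteq> D \<longrightarrow> K C D \<subseteq> P \<longrightarrow> C = A \<and> D = B)}"

definition wt :: "'e set \<Rightarrow> nat" where
  "wt P = (\<Sum>(A, B)\<in>Blobs P. (card A - 2) * (card B - 2))"

lemma BlobsD:
  assumes "(A, B) \<in> Blobs P"
  shows "A \<subseteq> {..<m}" "B \<subseteq> {..<n}" "3 \<le> card A" "3 \<le> card B" "K A B \<subseteq> P"
    "finite A" "finite B" "A \<noteq> {}" "B \<noteq> {}"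
proof -
  show 1: "A \<subseteq> {..<m}" "B \<subseteq> {..<n}" "3 \<le> card A" "3 \<le> card B" "K A B \<subseteq> P"
    using assms unfolding Blobs_def by blast+
  then show "finite A" "finite B" using finite_left finite_right by blast+
  show "A \<noteq> {}" "B \<noteq> {}" using 1 by auto
qed

lemma Blobs_maximal:
  assumes "(A, B) \<in> Blobs P" "C \<subseteq> {..<m}" "D \<subseteq> {..<n}" "A \<subseteq> C" "B \<subseteq> D" "K C D \<subseteq> P"
  shows "C = A" "D = B"
  using assms unfolding Blobs_def by blast+

lemma BlobsI:
  assumes "A \<subseteq> {..<m}" "B \<subseteq> {..<n}" "3 \<le> card A" "3 \<le> card B" "K A B \<subseteq> P"
    "\<And>C D. C \<subseteq> {..<m} \<Longrightarrow> D \<subseteq> {..<n} \<Longrightarrow> A \<subseteq> C \<Longrightarrow> B \<subseteq> D \<Longrightarrow> K C D \<subseteq> P \<Longrightarrow> C = A \<and> D = B"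
  shows "(A, B) \<in> Blobs P"
  using assms unfolding Blobs_def by blast

lemma finite_Blobs: "finite (Blobs P)"
proof (rule finite_subset)
  show "Blobs P \<subseteq> Pow {..<m} \<times> Pow {..<n}" unfolding Blobs_def by blast
qed simp

lemma Blobs_ex:
  assumes "A \<subseteq> {..<m}" "B \<subseteq> {..<n}" "3 \<le> card A" "3 \<le> card B" "K A B \<subseteq> P"
  shows "\<exists>C D. (C, D) \<in> Blobs P \<and> A \<subseteq> C \<and> B \<subseteq> D"
proof -
  let ?S = "{(C, D). C \<subseteq> {..<m} \<and> D \<subseteq> {..<n} \<and> A \<subseteq> C \<and> B \<subseteq> D \<and> K C D \<subseteq> P}"
  have "?S \<subseteq> Pow {..<m} \<times> Pow {..<n}" by blast
  then have fin: "finite ?S" using finite_subset by fastforce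
  have ne: "?S \<noteq> {}" using assms by blast
  obtain p where p: "p \<in> ?S" "\<forall>q\<in>?S. card (fst q) + card (snd q) \<le> card (fst p) + card (snd p)"
    using ex_max_nat[OF fin ne, of "\<lambda>q. card (fst q) + card (snd q)"] by auto
  obtain C D where CD: "p = (C, D)" by (cases p)
  have 1: "C \<subseteq> {..<m}" "D \<subseteq> {..<n}" "A \<subseteq> C" "B \<subseteq> D" "K C D \<subseteq> P" using p(1) CD by auto
  have f: "finite C" "finite D" using 1 finite_left finite_right by blast+
  have "(C, D) \<in> Blobs P"
  proof (rule BlobsI)
    show "3 \<le> card C" "3 \<le> card D" using assms card_mono[OF f(1) 1(3)] card_mono[OF f(2) 1(4)] by auto
    fix C' D' assume a: "C' \<subseteq> {..<m}" "D' \<subseteq> {..<n}" "C \<subseteq> C'" "D \<subseteq> D'" "K C' D' \<subseteq> P"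
    have f': "finite C'" "finite D'" using a finite_left finite_right by blast+
    have "(C', D') \<in> ?S" using a 1 by auto
    then have "card C' + card D' \<le> card C + card D" using p(2) CD by fastforce
    moreover have "card C \<le> card C'" "card D \<le> card D'" using a f' card_mono by blast+
    ultimately have "card C = card C'" "card D = card D'" by auto
    then show "C' = C \<and> D' = D" using a f' card_subset_eq by metis
  qed (use 1 in auto)
  then show ?thesis using 1 by blast
qed

text \<open>With two common left vertices \<open>u\<close>, \<open>u'\<close> and two columns
  \<open>b\<close>, \<open>b'\<close> of \<open>B\<close>, the K33 on \<open>x\<close>,
  \<open>u\<close>, \<open>u'\<close> and \<open>y\<close>, \<open>b\<close>, \<open>b'\<close> has
  all its edges in the two given graphs except possibly the one joining \<open>x\<close> to
  \<open>y\<close>.\<close>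

lemma merge_aux:
  assumes P: "wclosed P" and A: "A \<subseteq> {..<m}" "B \<subseteq> {..<n}" "K A B \<subseteq> P" and C: "C \<subseteq> {..<m}" "D \<subseteq> {..<n}" "K C D \<subseteq> P"
    and c: "2 \<le> card (A \<inter> C)" "2 \<le> card B" and x: "x \<in> A" and y: "y \<in> D"
  shows "edge x y \<in> P"
proof (cases "x \<in> C \<or> y \<in> B")
  case True
  then have "edge x y \<in> K C D \<or> edge x y \<in> K A B" using x y by auto
  then show ?thesis using A C by blast
next
  case False
  obtain u u' where u: "u \<in> A \<inter> C" "u' \<in> A \<inter> C" "u \<noteq> u'" using ex_two[OF c(1)] by blast
  obtain b b' where b: "b \<in> B" "b' \<in> B" "b \<noteq> b'" using ex_two[OF c(2)] by blast
  have ne: "x \<noteq> u" "x \<noteq> u'" "y \<noteq> b" "y \<noteq> b'" using False u b by auto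
  have X: "K {x, u, u'} {y, b, b'} \<in> XX"
    using x y u b A C ne by (intro XX_I) auto
  have "edge i j \<in> P" if "i \<in> {x, u, u'}" "j \<in> {y, b, b'}" "\<not> (i = x \<and> j = y)" for i j
  proof -
    have "edge i j \<in> K A B \<or> edge i j \<in> K C D" using that x y u b by auto
    then show ?thesis using A C by blast
  qed
  then have "K {x, u, u'} {y, b, b'} - {edge x y} \<subseteq> P" by (auto simp: K_def)
  then have "K {x, u, u'} {y, b, b'} \<subseteq> P" using P X unfolding wclosed_def by blast
  moreover have "edge x y \<in> K {x, u, u'} {y, b, b'}" by simp
  ultimately show ?thesis by blast
qed

lemma merge:
  assumes P: "wclosed P" and A: "A \<subseteq> {..<m}" "B \<subseteq> {..<n}" "K A B \<subseteq> P" and C: "C \<subseteq> {..<m}" "D \<subseteq> {..<n}" "K C D \<subseteq> P"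
    and c: "2 \<le> card (A \<inter> C)" "2 \<le> card B" "2 \<le> card D"
  shows "K (A \<union> C) (B \<union> D) \<subseteq> P"
proof (rule K_subI)
  fix x y assume xy: "x \<in> A \<union> C" "y \<in> B \<union> D"
  have 1: "edge x y \<in> P" if "x \<in> A" "y \<in> D" using merge_aux[OF P A C c(1,2)] that by blast
  have 2: "edge x y \<in> P" if "x \<in> C" "y \<in> B"
    using merge_aux[OF P C A _ c(3)] c(1) that by (simp add: Int_commute)
  have 3: "edge x y \<in> P" if "x \<in> A" "y \<in> B" using A(3) that by (meson in_K subsetD)
  have 4: "edge x y \<in> P" if "x \<in> C" "y \<in> D" using C(3) that by (meson in_K subsetD)
  show "edge x y \<in> P" using xy 1 2 3 4 by blast
qed

text \<open>Otherwise \<open>merge\<close> would enlarge the blob. Two common left vertices suffice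
  for this, so distinct blobs of a \<open>wclosed\<close> set share at most one left vertex.\<close>

lemma absorb:
  assumes P: "wclosed P" and A: "(A, B) \<in> Blobs P" and C: "C \<subseteq> {..<m}" "D \<subseteq> {..<n}" "K C D \<subseteq> P" "2 \<le> card D"
    and c: "2 \<le> card (A \<inter> C)"
  shows "C \<subseteq> A" "D \<subseteq> B"
proof -
  note b = BlobsD[OF A]
  have k: "K (A \<union> C) (B \<union> D) \<subseteq> P" using merge[OF P b(1,2,5) C(1-3) c] b C by simp
  have s: "A \<union> C \<subseteq> {..<m}" "B \<union> D \<subseteq> {..<n}" using b C by auto
  have "A \<union> C = A" "B \<union> D = B" using Blobs_maximal[OF A s _ _ k] by blast+
  then show "C \<subseteq> A" "D \<subseteq> B" by blast+
qed

lemma Blobs_eq: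
  assumes P: "wclosed P" and "(A, B) \<in> Blobs P" "(C, D) \<in> Blobs P" "2 \<le> card (A \<inter> C)"
  shows "A = C" "B = D"
proof -
  have "C \<subseteq> A" "D \<subseteq> B" using absorb[OF P assms(2)] BlobsD[OF assms(3)] assms(4) by auto
  moreover have "A \<subseteq> C" "B \<subseteq> D"
    using absorb[OF P assms(3), of A B] BlobsD[OF assms(2)] assms(4) by (auto simp: Int_commute)
  ultimately show "A = C" "B = D" by auto
qed

lemma card_Int_ge:
  assumes "finite A" "u \<in> A" "u' \<in> A" "u \<in> C" "u' \<in> C" "u \<noteq> u'"
  shows "2 \<le> card (A \<inter> C)"
proof -
  have "card {u, u'} \<le> card (A \<inter> C)" using assms by (intro card_mono) auto
  then show ?thesis using assms by simp
qed

text \<open>A complete bipartite graph in \<open>P\<close> that meets a blob of \<open>F\<close> in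
  two left vertices is absorbed by it. Maximality inside \<open>P\<close> and inside the trace
  \<open>P \<inter> K C D\<close> therefore agree, and the blob of \<open>F\<close> around a blob of
  \<open>P\<close> is unique.\<close>

lemma Blobs_decomp:
  assumes F: "wclosed F" and P: "P \<subseteq> F"
  shows "Blobs P = (\<Union>(C, D)\<in>Blobs F. Blobs (P \<inter> K C D))"
    and "\<And>p q. p \<in> Blobs F \<Longrightarrow> q \<in> Blobs F \<Longrightarrow> p \<noteq> q \<Longrightarrow>
      Blobs (P \<inter> K (fst p) (snd p)) \<inter> Blobs (P \<inter> K (fst q) (snd q)) = {}"
proof -
  show "Blobs P = (\<Union>(C, D)\<in>Blobs F. Blobs (P \<inter> K C D))"
  proof (intro equalityI subsetI)
    fix p assume "p \<in> Blobs P"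
    then obtain A B where p: "p = (A, B)" "(A, B) \<in> Blobs P" by (cases p) auto
    note b = BlobsD[OF p(2)]
    obtain C D where CD: "(C, D) \<in> Blobs F" "A \<subseteq> C" "B \<subseteq> D"
      using Blobs_ex[of A B F] b P by blast
    have "(A, B) \<in> Blobs (P \<inter> K C D)"
    proof (rule BlobsI)
      show "K A B \<subseteq> P \<inter> K C D" using b CD K_mono by blast
      fix C' D' assume a: "C' \<subseteq> {..<m}" "D' \<subseteq> {..<n}" "A \<subseteq> C'" "B \<subseteq> D'" "K C' D' \<subseteq> P \<inter> K C D"
      then show "C' = A \<and> D' = B" using Blobs_maximal[OF p(2) a(1-4)] by simp
    qed (use b in auto)
    then show "p \<in> (\<Union>(C, D)\<in>Blobs F. Blobs (P \<inter> K C D))" using CD p by blast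
  next
    fix p assume "p \<in> (\<Union>(C, D)\<in>Blobs F. Blobs (P \<inter> K C D))"
    then obtain A B C D where p: "p = (A, B)" "(A, B) \<in> Blobs (P \<inter> K C D)" and CD: "(C, D) \<in> Blobs F"
      by (cases p) auto
    note b = BlobsD[OF p(2)]
    have AC: "A \<subseteq> C" using K_sub_D[of A B C D] b by blast
    have "(A, B) \<in> Blobs P"
    proof (rule BlobsI)
      fix C' D' assume a: "C' \<subseteq> {..<m}" "D' \<subseteq> {..<n}" "A \<subseteq> C'" "B \<subseteq> D'" "K C' D' \<subseteq> P"
      have "card A \<le> card (C \<inter> C')" using AC a BlobsD(6)[OF CD] by (intro card_mono) auto
      moreover have "card B \<le> card D'" using a finite_right by (intro card_mono) auto
      ultimately have "C' \<subseteq> C" "D' \<subseteq> D" using absorb[OF F CD a(1,2)] a P b by auto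
      then have "K C' D' \<subseteq> P \<inter> K C D" using a K_mono by blast
      then show "C' = A \<and> D' = B" using Blobs_maximal[OF p(2) a(1-4)] by simp
    qed (use b in auto)
    then show "p \<in> Blobs P" using p by simp
  qed
  fix p q assume pq: "p \<in> Blobs F" "q \<in> Blobs F" "p \<noteq> q"
  obtain C D C' D' where c: "p = (C, D)" "q = (C', D')" by (cases p, cases q) auto
  show "Blobs (P \<inter> K (fst p) (snd p)) \<inter> Blobs (P \<inter> K (fst q) (snd q)) = {}"
  proof (rule ccontr)
    assume "\<not> ?thesis"
    then obtain A B where ab: "(A, B) \<in> Blobs (P \<inter> K C D)" "(A, B) \<in> Blobs (P \<inter> K C' D')" using c by auto
    note b = BlobsD[OF ab(1)] and b' = BlobsD[OF ab(2)]
    have "A \<subseteq> C" "A \<subseteq> C'" using K_sub_D[of A B C D] K_sub_D[of A B C' D'] b b' by blast+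
    then have "card A \<le> card (C \<inter> C')" using BlobsD(6)[of C D F] pq c by (intro card_mono) auto
    then have "C = C'" "D = D'" using Blobs_eq[OF F, of C D C' D'] pq c b by auto
    then show False using pq c by simp
  qed
qed

lemma wt_decomp:
  assumes F: "wclosed F" and P: "P \<subseteq> F"
  shows "wt P = (\<Sum>(C, D)\<in>Blobs F. wt (P \<inter> K C D))"
proof -
  have "wt P = (\<Sum>p\<in>(\<Union>q\<in>Blobs F. Blobs (P \<inter> K (fst q) (snd q))). (card (fst p) - 2) * (card (snd p) - 2))"
    unfolding wt_def Blobs_decomp(1)[OF assms] by (simp add: case_prod_beta)
  also have "\<dots> = (\<Sum>q\<in>Blobs F. \<Sum>p\<in>Blobs (P \<inter> K (fst q) (snd q)). (card (fst p) - 2) * (card (snd p) - 2))"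
    using finite_Blobs Blobs_decomp(2)[OF assms] by (intro sum.UNION_disjoint) auto
  finally show ?thesis by (simp add: wt_def case_prod_beta)
qed

text \<open>Only the blob through \<open>v\<close> changes: it loses one left vertex, or disappears
  when it had just three. Either way its weight drops by \<open>card B0 - 2\<close>, and the other
  blobs survive.\<close>

lemma wt_remove_vertex:
  assumes P: "wclosed P" and AB: "(A0, B0) \<in> Blobs P" "v \<in> A0"
    and only: "\<And>A B. (A, B) \<in> Blobs P \<Longrightarrow> v \<in> A \<Longrightarrow> A = A0 \<and> B = B0"
  shows "wt P \<le> wt (P - K {v} {..<n}) + (card B0 - 2)"
proof -
  let ?P = "P - K {v} {..<n}"
  let ?f = "\<lambda>(A :: nat set, B :: nat set). (card A - 2) * (card B - 2)"
  note b = BlobsD[OF AB(1)]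
  have v_free: "v \<notin> C" if kd: "K C D \<subseteq> ?P" "D \<subseteq> {..<n}" "D \<noteq> {}" for C D
  proof
    assume "v \<in> C"
    obtain y where "y \<in> D" using kd(3) by blast
    then have "edge v y \<in> K C D" "edge v y \<in> K {v} {..<n}" using \<open>v \<in> C\<close> kd(2) by auto
    then show False using kd(1) by blast
  qed
  have sub: "Blobs P - {(A0, B0)} \<subseteq> Blobs ?P"
  proof
    fix p assume "p \<in> Blobs P - {(A0, B0)}"
    then obtain A B where p: "p = (A, B)" "(A, B) \<in> Blobs P" "(A, B) \<noteq> (A0, B0)" by (cases p) auto
    note b' = BlobsD[OF p(2)]
    have "v \<notin> A" using only p by blast
    have "(A, B) \<in> Blobs ?P"
    proof (rule BlobsI)
      show "K A B \<subseteq> ?P" using b'(5) \<open>v \<notin> A\<close> by (auto simp: K_def)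
      fix C D assume a: "C \<subseteq> {..<m}" "D \<subseteq> {..<n}" "A \<subseteq> C" "B \<subseteq> D" "K C D \<subseteq> ?P"
      then have "K C D \<subseteq> P" by blast
      then show "C = A \<and> D = B" using Blobs_maximal[OF p(2) a(1-4)] by simp
    qed (use b' in auto)
    then show "p \<in> Blobs ?P" using p by simp
  qed
  have eq: "wt P = ?f (A0, B0) + (\<Sum>p\<in>Blobs P - {(A0, B0)}. ?f p)"
    unfolding wt_def using finite_Blobs AB by (intro sum.remove) auto
  show ?thesis
  proof (cases "card A0 = 3")
    case True
    have "(\<Sum>p\<in>Blobs P - {(A0, B0)}. ?f p) \<le> wt ?P"
      unfolding wt_def using finite_Blobs sub by (intro sum_mono2) auto
    then show ?thesis using eq True by simp
  next
    case False
    let ?A = "A0 - {v}"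
    have cA: "card ?A + 1 = card A0" using b AB by (simp add: card_gt_0_iff)
    have new: "(?A, B0) \<in> Blobs ?P"
    proof (rule BlobsI)
      show "3 \<le> card ?A" using cA False b by simp
      show "K ?A B0 \<subseteq> ?P" using b(5) by (auto simp: K_def)
      fix C D assume a: "C \<subseteq> {..<m}" "D \<subseteq> {..<n}" "?A \<subseteq> C" "B0 \<subseteq> D" "K C D \<subseteq> ?P"
      have "card ?A \<le> card (A0 \<inter> C)" using a b by (intro card_mono) auto
      moreover have "card B0 \<le> card D" using a finite_right by (intro card_mono) auto
      moreover have "K C D \<subseteq> P" using a(5) by blast
      ultimately have "C \<subseteq> A0" "D \<subseteq> B0" using absorb[OF P AB(1) a(1,2)] b(3,4) cA False by simp_all
      moreover have "v \<notin> C" using v_free[of C D] a b by auto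
      ultimately show "C = ?A \<and> D = B0" using a by blast
    qed (use b in auto)
    \<comment> \<open>The shrunken blob was not maximal before, so it contributes a genuinely new
      term to the sum.\<close>
    have "(?A, B0) \<notin> Blobs P"
    proof
      assume "(?A, B0) \<in> Blobs P"
      then have "A0 = ?A" using Blobs_maximal(1)[of ?A B0 P A0 B0] b by auto
      then show False using AB by blast
    qed
    then have "(\<Sum>p\<in>insert (?A, B0) (Blobs P - {(A0, B0)}). ?f p) = ?f (?A, B0) + (\<Sum>p\<in>Blobs P - {(A0, B0)}. ?f p)"
      using finite_Blobs by (intro sum.insert) auto
    moreover have "(\<Sum>p\<in>insert (?A, B0) (Blobs P - {(A0, B0)}). ?f p) \<le> wt ?P"
      unfolding wt_def using finite_Blobs sub new by (intro sum_mono2) auto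
    moreover have "?f (A0, B0) = ?f (?A, B0) + (card B0 - 2)"
    proof -
      have "4 \<le> card A0" using False b(3) by simp
      then obtain a where "card A0 = 4 + a" using le_Suc_ex by blast
      moreover obtain b' where "card B0 = 3 + b'" using b(4) le_Suc_ex by blast
      ultimately show ?thesis using cA by (simp add: algebra_simps)
    qed
    ultimately show ?thesis using eq by simp
  qed
qed

end

section \<open>Nullity traced on fixed blobs\<close>

context k33
begin

text \<open>The bipartite counterpart of the rank formula conjectured by Dress for rigidity matroids.\<close>

definition Dress :: "'e set \<Rightarrow> bool" where
  "Dress F \<longleftrightarrow> null F = wt F"

text \<open>In the notation of the overview, \<rho>(P) is \<open>card P - snull F P\<close>. In
  contrast to \<open>wt P\<close>, the blobs stay those of \<open>F\<close> while \<open>P\<close>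
  varies, so supermodularity in \<open>P\<close> is inherited from the nullity. At
  \<open>P = F\<close> it equals \<open>wt F\<close>.\<close>

definition snull :: "'e set \<Rightarrow> 'e set \<Rightarrow> nat" where
  "snull F P = (\<Sum>(A, B)\<in>Blobs F. null (P \<inter> K A B))"

lemma swap_wclosed: "grid.wclosed (\<lambda>i j. edge j i) n m P = wclosed P"
proof -
  interpret g: k33 "\<lambda>i j. edge j i" n m M by (rule swap)
  show ?thesis unfolding g.wclosed_def wclosed_def swap_XX swap_E ..
qed

lemma swap_Blobs: "grid.Blobs (\<lambda>i j. edge j i) n m P = prod.swap ` Blobs P"
proof -
  interpret g: k33 "\<lambda>i j. edge j i" n m M by (rule swap)
  have 1: "(B, A) \<in> g.Blobs P" if "(A, B) \<in> Blobs P" for A B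
    using BlobsD[OF that] Blobs_maximal[OF that] by (intro g.BlobsI) (auto simp: swap_K)
  have 2: "(A, B) \<in> Blobs P" if "(B, A) \<in> g.Blobs P" for A B
    using g.BlobsD[OF that] g.Blobs_maximal[OF that] by (intro BlobsI) (auto simp: swap_K)
  show ?thesis
  proof (intro equalityI subsetI)
    fix p assume "p \<in> g.Blobs P"
    then show "p \<in> prod.swap ` Blobs P" using 2 by (cases p) force
  next
    fix p assume "p \<in> prod.swap ` Blobs P"
    then show "p \<in> g.Blobs P" using 1 by auto
  qed
qed

lemma swap_wt: "grid.wt (\<lambda>i j. edge j i) n m P = wt P"
proof -
  interpret g: k33 "\<lambda>i j. edge j i" n m M by (rule swap)
  show ?thesis unfolding g.wt_def wt_def swap_Blobs
    by (subst sum.reindex) (auto simp: case_prod_beta mult.commute)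
qed

lemma swap_snull: "k33.snull (\<lambda>i j. edge j i) n m M F P = snull F P"
proof -
  interpret g: k33 "\<lambda>i j. edge j i" n m M by (rule swap)
  show ?thesis unfolding g.snull_def snull_def swap_Blobs
    by (subst sum.reindex) (auto simp: case_prod_beta swap_K)
qed

lemma swap_Dress: "k33.Dress (\<lambda>i j. edge j i) n m M F = Dress F"
proof -
  interpret g: k33 "\<lambda>i j. edge j i" n m M by (rule swap)
  show ?thesis unfolding g.Dress_def Dress_def swap_wt ..
qed

lemma flat_wclosed:
  assumes "isflat F"
  shows "wclosed F"
  unfolding wclosed_def
proof (intro conjI ballI allI impI)
  show "F \<subseteq> E" using assms flat_sub by blast
  fix X e assume X: "X \<in> XX" "X - {e} \<subseteq> F"
  show "X \<subseteq> F"
  proof (cases "e \<in> X")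
    case True
    then have "e \<in> cls F" using circuit_in_cl[OF circ[OF X(1)] True X(2)] by blast
    then show ?thesis using assms X by (auto simp: flat_def)
  qed (use X in auto)
qed

lemma null_Blob: "(A, B) \<in> Blobs P \<Longrightarrow> null (K A B) = (card A - 2) * (card B - 2)"
  using BlobsD[of A B P] by (intro null_K) auto

lemma snull_self: "snull F F = wt F"
  unfolding snull_def wt_def
proof (rule sum.cong)
  fix p assume "p \<in> Blobs F"
  then obtain A B where p: "p = (A, B)" "(A, B) \<in> Blobs F" by (cases p) auto
  then have "F \<inter> K A B = K A B" using BlobsD(5) by blast
  then show "(case p of (A, B) \<Rightarrow> null (F \<inter> K A B)) = (case p of (A, B) \<Rightarrow> (card A - 2) * (card B - 2))"
    using p null_Blob by simp
qed simp

lemma snull_eq_wt: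
  assumes "wclosed F" "P \<subseteq> F" "\<And>A B. (A, B) \<in> Blobs F \<Longrightarrow> Dress (P \<inter> K A B)"
  shows "snull F P = wt P"
  unfolding snull_def wt_decomp[OF assms(1,2)]
  using assms(3) by (intro sum.cong) (auto simp: Dress_def)

lemma snull_mono: "P \<subseteq> Q \<Longrightarrow> finite Q \<Longrightarrow> snull F P \<le> snull F Q"
  unfolding snull_def by (intro sum_mono) (auto intro!: null_mono)

lemma snull_supermod:
  assumes "finite P" "finite Q"
  shows "snull F P + snull F Q \<le> snull F (P \<union> Q) + snull F (P \<inter> Q)"
proof -
  have "null (P \<inter> K A B) + null (Q \<inter> K A B) \<le> null ((P \<union> Q) \<inter> K A B) + null ((P \<inter> Q) \<inter> K A B)" for A B
  proof -
    have "(P \<inter> K A B) \<union> (Q \<inter> K A B) = (P \<union> Q) \<inter> K A B" "(P \<inter> K A B) \<inter> (Q \<inter> K A B) = (P \<inter> Q) \<inter> K A B" by auto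
    then show ?thesis using null_supermod[of "P \<inter> K A B" "Q \<inter> K A B"] assms by simp
  qed
  then show ?thesis unfolding snull_def sum.distrib[symmetric] by (intro sum_mono) auto
qed

end

section \<open>Stars of blobs and the vertex count\<close>

lemma (in matroid) matroid_image:
  assumes inj: "inj_on \<phi> E" and surj: "\<phi> ` E = E"
  shows "matroid_on E ((`) \<phi> ` M)"
  unfolding matroid_on_def
proof (intro conjI allI impI)
  show "(`) \<phi> ` M \<subseteq> Pow E" using indep_sub surj by blast
  show "{} \<in> (`) \<phi> ` M" using empty_indep by force
  fix I J
  {
    assume "J \<in> (`) \<phi> ` M \<and> I \<subseteq> J"
    then obtain J' where J': "J' \<in> M" "J = \<phi> ` J'" "I \<subseteq> \<phi> ` J'" by blast
    then obtain I' where I': "I' \<subseteq> J'" "I = \<phi> ` I'" by (meson subset_imageE)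
    then have "I' \<in> M" using J' indep_mono[of J' I'] by simp
    then show "I \<in> (`) \<phi> ` M" using I' by simp
  next
    assume a: "I \<in> (`) \<phi> ` M \<and> J \<in> (`) \<phi> ` M \<and> card I < card J"
    then obtain I' J' where IJ: "I' \<in> M" "J' \<in> M" "I = \<phi> ` I'" "J = \<phi> ` J'" by blast
    have sub: "I' \<subseteq> E" "J' \<subseteq> E" using IJ indep_sub by auto
    have "card I = card I'" "card J = card J'"
      unfolding IJ using sub by (auto intro!: card_image inj_on_subset[OF inj])
    then obtain e where e: "e \<in> J' - I'" "insert e I' \<in> M" using augment[of I' J'] IJ a by auto
    have "\<phi> e \<notin> \<phi> ` I'" using inj_on_image_mem_iff[OF inj, of e I'] e sub by auto
    then have "\<phi> e \<in> J - I" using e IJ by simp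
    moreover have "insert (\<phi> e) I = \<phi> ` insert e I'" using IJ by simp
    then have "insert (\<phi> e) I \<in> (`) \<phi> ` M" using e(2) by (rule image_eqI)
    ultimately show "\<exists>e\<in>J - I. insert e I \<in> (`) \<phi> ` M" by blast
  }
qed (rule finE)

text \<open>Putting \<open>a = 3 + x\<close> and \<open>b = 3 + y\<close>, the right side exceeds
  the left by \<open>2 * (x + y)\<close>. Equality holds exactly for K33.\<close>

lemma three_pairs_arith:
  fixes a b :: nat
  assumes "3 \<le> a" "3 \<le> b"
  shows "a * b + 3 * ((a - 2) * (b - 2)) \<le> 2 * (a * (b - 2)) + 2 * (b * (a - 2))"
proof -
  obtain x y where "a = 3 + x" "b = 3 + y" using assms le_Suc_ex by metis
  then show ?thesis by (simp add: algebra_simps)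
qed

text \<open>The first inequality plus twice the second and third plus three times the fourth gives
  \<open>ab + 12 \<le> t\<close>.\<close>

lemma vertex_count_arith:
  fixes ab w L R x y t :: nat
  assumes "ab + 3 * w \<le> 2 * L + 2 * R" "L + 3 * x \<le> t" "R + 3 * y \<le> t" "t + 4 \<le> w + 2 * (x + y)" "t \<le> ab"
  shows False
  using assms by presburger

text \<open>Summing the local bounds over each side counts every edge of the union once and every
  blob once per vertex. Together with the rank bound \<open>total\<close> this is contradictory, so
  in the application some vertex of a blob must violate its local bound.\<close>

lemma vertex_count:
  fixes Bl :: "(nat set \<times> nat set) set"
  assumes fin: "finite Bl" and Bl: "\<And>A B. (A, B) \<in> Bl \<Longrightarrow> finite A \<and> finite B \<and> 3 \<le> card A \<and> 3 \<le> card B"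
    and T: "T = (\<Union>(A, B)\<in>Bl. A \<times> B)" and VL: "VL = (\<Union>(A, B)\<in>Bl. A)" and VR: "VR = (\<Union>(A, B)\<in>Bl. B)"
    and left: "\<And>v. v \<in> VL \<Longrightarrow> (\<Sum>p\<in>{p \<in> Bl. v \<in> fst p}. card (snd p) - 2) + 3 \<le> card (\<Union>p\<in>{p \<in> Bl. v \<in> fst p}. snd p)"
    and right: "\<And>v. v \<in> VR \<Longrightarrow> (\<Sum>p\<in>{p \<in> Bl. v \<in> snd p}. card (fst p) - 2) + 3 \<le> card (\<Union>p\<in>{p \<in> Bl. v \<in> snd p}. fst p)"
    and total: "card T + 4 \<le> (\<Sum>(A, B)\<in>Bl. (card A - 2) * (card B - 2)) + 2 * (card VL + card VR)"
  shows False
proof -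
  have finL: "finite VL" and finR: "finite VR" using fin Bl VL VR by auto
  have TL: "T = (SIGMA v:VL. \<Union>p\<in>{p \<in> Bl. v \<in> fst p}. snd p)"
    unfolding T VL by force
  have TR: "T = prod.swap ` (SIGMA v:VR. \<Union>p\<in>{p \<in> Bl. v \<in> snd p}. fst p)"
    unfolding T VR by force
  have fU: "finite (\<Union>p\<in>{p \<in> Bl. v \<in> fst p}. snd p)" "finite (\<Union>p\<in>{p \<in> Bl. v \<in> snd p}. fst p)" for v
    using fin Bl by auto
  have cL: "card T = (\<Sum>v\<in>VL. card (\<Union>p\<in>{p \<in> Bl. v \<in> fst p}. snd p))"
    unfolding TL using finL fU by (intro card_SigmaI) auto
  have "card T = card (SIGMA v:VR. \<Union>p\<in>{p \<in> Bl. v \<in> snd p}. fst p)"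
    unfolding TR by (rule card_image) (simp add: inj_on_def)
  also have "\<dots> = (\<Sum>v\<in>VR. card (\<Union>p\<in>{p \<in> Bl. v \<in> snd p}. fst p))"
    using finR fU by (intro card_SigmaI) auto
  finally have cR: "card T = (\<Sum>v\<in>VR. card (\<Union>p\<in>{p \<in> Bl. v \<in> snd p}. fst p))" .
  have "(\<Sum>v\<in>VL. \<Sum>p\<in>{p \<in> Bl. v \<in> fst p}. card (snd p) - 2) = (\<Sum>p\<in>Bl. \<Sum>v\<in>{v \<in> VL. v \<in> fst p}. card (snd p) - 2)"
    using finL fin by (rule sum.swap_restrict)
  also have "\<dots> = (\<Sum>p\<in>Bl. card (fst p) * (card (snd p) - 2))"
  proof (rule sum.cong)
    fix p assume "p \<in> Bl"
    then have "{v \<in> VL. v \<in> fst p} = fst p" unfolding VL by (cases p) auto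
    then show "(\<Sum>v\<in>{v \<in> VL. v \<in> fst p}. card (snd p) - 2) = card (fst p) * (card (snd p) - 2)" by simp
  qed simp
  finally have sL: "(\<Sum>v\<in>VL. \<Sum>p\<in>{p \<in> Bl. v \<in> fst p}. card (snd p) - 2) = (\<Sum>p\<in>Bl. card (fst p) * (card (snd p) - 2))" .
  have "(\<Sum>v\<in>VR. \<Sum>p\<in>{p \<in> Bl. v \<in> snd p}. card (fst p) - 2) = (\<Sum>p\<in>Bl. \<Sum>v\<in>{v \<in> VR. v \<in> snd p}. card (fst p) - 2)"
    using finR fin by (rule sum.swap_restrict)
  also have "\<dots> = (\<Sum>p\<in>Bl. card (snd p) * (card (fst p) - 2))"
  proof (rule sum.cong)
    fix p assume "p \<in> Bl"
    then have "{v \<in> VR. v \<in> snd p} = snd p" unfolding VR by (cases p) auto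
    then show "(\<Sum>v\<in>{v \<in> VR. v \<in> snd p}. card (fst p) - 2) = card (snd p) * (card (fst p) - 2)" by simp
  qed simp
  finally have sR: "(\<Sum>v\<in>VR. \<Sum>p\<in>{p \<in> Bl. v \<in> snd p}. card (fst p) - 2) = (\<Sum>p\<in>Bl. card (snd p) * (card (fst p) - 2))" .
  let ?L = "\<Sum>p\<in>Bl. card (fst p) * (card (snd p) - 2)"
  let ?R = "\<Sum>p\<in>Bl. card (snd p) * (card (fst p) - 2)"
  let ?w = "\<Sum>p\<in>Bl. (card (fst p) - 2) * (card (snd p) - 2)"
  let ?ab = "\<Sum>p\<in>Bl. card (fst p) * card (snd p)"
  have "(\<Sum>v\<in>VL. (\<Sum>p\<in>{p \<in> Bl. v \<in> fst p}. card (snd p) - 2) + 3) \<le> card T"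
    unfolding cL using left by (rule sum_mono)
  then have L: "?L + 3 * card VL \<le> card T" unfolding sum.distrib sL by simp
  have "(\<Sum>v\<in>VR. (\<Sum>p\<in>{p \<in> Bl. v \<in> snd p}. card (fst p) - 2) + 3) \<le> card T"
    unfolding cR using right by (rule sum_mono)
  then have R: "?R + 3 * card VR \<le> card T" unfolding sum.distrib sR by simp
  have t: "card T + 4 \<le> ?w + 2 * (card VL + card VR)" using total by (simp add: case_prod_beta)
  have "card T \<le> (\<Sum>p\<in>Bl. card (fst p \<times> snd p))"
    unfolding T case_prod_beta using fin by (rule card_UN_le)
  then have ab: "card T \<le> ?ab" by (simp add: card_cartesian_product)
  have "?ab + 3 * ?w = (\<Sum>p\<in>Bl. card (fst p) * card (snd p) + 3 * ((card (fst p) - 2) * (card (snd p) - 2)))"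
    by (simp add: sum.distrib sum_distrib_left)
  also have "\<dots> \<le> (\<Sum>p\<in>Bl. 2 * (card (fst p) * (card (snd p) - 2)) + 2 * (card (snd p) * (card (fst p) - 2)))"
  proof (rule sum_mono)
    fix p assume "p \<in> Bl"
    then show "card (fst p) * card (snd p) + 3 * ((card (fst p) - 2) * (card (snd p) - 2))
      \<le> 2 * (card (fst p) * (card (snd p) - 2)) + 2 * (card (snd p) * (card (fst p) - 2))"
      using Bl[of "fst p" "snd p"] by (intro three_pairs_arith) auto
  qed
  also have "\<dots> = 2 * ?L + 2 * ?R" by (simp add: sum.distrib sum_distrib_left)
  finally have "?ab + 3 * ?w \<le> 2 * ?L + 2 * ?R" .
  then show False using L R t ab by (rule vertex_count_arith)
qed

section \<open>Symmetry of the greatest matroid and the bound at a vertex\<close>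

context k33
begin

text \<open>Transposing two left vertices permutes the copies of K33, so the image of
  \<open>M\<close> is again a K33-matroid and lies below \<open>M\<close>. The transposition is an
  involution, hence it preserves ranks and maps the closure of an invariant set to itself.\<close>

lemma twin_cl:
  assumes x: "x < m" "x' < m" and A: "A \<subseteq> E"
    and inv: "\<And>i j. edge i j \<in> A \<Longrightarrow> edge (transpose x x' i) j \<in> A"
    and e: "edge i j \<in> cls A"
  shows "edge (transpose x x' i) j \<in> cls A"
proof -
  let ?t = "transpose x x'"
  define \<phi> where "\<phi> e = (let (i, j) = inv (case_prod edge) e in edge (?t i) j)" for e
  have inj: "inj (case_prod edge)" by (auto simp: inj_def)
  have \<phi>: "\<phi> (edge i j) = edge (?t i) j" for i j
    using inv_f_f[OF inj, of "(i, j)"] by (simp add: \<phi>_def)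
  have tm: "?t i < m" if "i < m" for i using x that by (auto simp: transpose_def)
  have \<phi>E: "\<phi> e \<in> E" "\<phi> (\<phi> e) = e" if "e \<in> E" for e
    using E_cases[OF that] by (auto simp: \<phi> tm)
  have injE: "inj_on \<phi> E" by (rule inj_on_inverseI[of _ \<phi>]) (simp add: \<phi>E)
  have surj: "\<phi> ` E = E"
  proof (intro equalityI subsetI)
    fix e assume "e \<in> E"
    then show "e \<in> \<phi> ` E" using \<phi>E by (intro image_eqI[of _ _ "\<phi> e"]) simp_all
  qed (use \<phi>E in blast)
  have \<phi>\<phi>: "\<phi> ` \<phi> ` S = S" if "S \<subseteq> E" for S
    using that \<phi>E by (force simp: image_iff)
  have \<phi>X: "\<phi> ` X \<in> XX" if Xin: "X \<in> XX" for X
  proof -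
    obtain A B where X: "X = K A B" "A \<subseteq> {..<m}" "B \<subseteq> {..<n}" "card A = 3" "card B = 3"
      using Xin unfolding XX_def by blast
    have "\<phi> ` X = K (?t ` A) B"
    proof (intro equalityI subsetI)
      fix e assume "e \<in> \<phi> ` X"
      then show "e \<in> K (?t ` A) B" using X(1) by (auto simp: \<phi> dest!: K_cases)
    next
      fix e assume "e \<in> K (?t ` A) B"
      then obtain i j where "e = edge (?t i) j" "i \<in> A" "j \<in> B" using K_cases by blast
      then show "e \<in> \<phi> ` X" using X(1) \<phi> by (intro image_eqI[of _ _ "edge i j"]) auto
    qed
    moreover have "card (?t ` A) = 3" using X(4) card_image[OF inj_on_subset[OF inj_transpose subset_UNIV], of x x' A] by simp
    moreover have "?t ` A \<subseteq> {..<m}" using X(2) tm by auto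
    ultimately show ?thesis using X(3,5) XX_I by simp
  qed
  have "(`) \<phi> ` M \<subseteq> M"
  proof (rule greatest)
    show mi: "matroid_on E ((`) \<phi> ` M)" by (rule matroid_image[OF injE surj])
    fix X assume X: "X \<in> XX"
    have XE: "X \<subseteq> E" using X XX_sub_E by blast
    have c: "circuit E M (\<phi> ` X)" using circ \<phi>X X by blast
    show "circuit E ((`) \<phi> ` M) X"
    proof (rule circuitI[OF mi XE])
      show "X \<notin> (`) \<phi> ` M"
      proof
        assume "X \<in> (`) \<phi> ` M"
        then obtain I where "I \<in> M" "X = \<phi> ` I" by blast
        then have "\<phi> ` X \<in> M" using \<phi>\<phi> indep_sub by simp
        then show False using c by (simp add: circuit_def)
      qed
      fix e assume e: "e \<in> X"
      have "\<phi> ` X - {\<phi> e} \<subset> \<phi> ` X" using imageI[OF e, of \<phi>] by (simp add: psubset_eq set_eq_iff) blast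
      then have "\<phi> ` X - {\<phi> e} \<in> M" using c unfolding circuit_def by simp
      moreover have sub: "X - {e} \<subseteq> E" "{e} \<subseteq> E" using XE e by blast+
      then have "\<phi> ` X - {\<phi> e} = \<phi> ` (X - {e})"
        using inj_on_image_set_diff[OF injE sub] by simp
      moreover have "X - {e} = \<phi> ` \<phi> ` (X - {e})" using \<phi>\<phi>[OF sub(1)] by simp
      ultimately have "\<phi> ` (X - {e}) \<in> M" "X - {e} = \<phi> ` (\<phi> ` (X - {e}))" by simp_all
      then show "X - {e} \<in> (`) \<phi> ` M" by (intro image_eqI[of _ _ "\<phi> ` (X - {e})"])
    qed
  qed
  then have \<phi>M: "\<phi> ` I \<in> M" if "I \<in> M" for I using imageI[OF that, of "(`) \<phi>"] by (rule subsetD)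
  have le: "r S \<le> r (\<phi> ` S)" if "S \<subseteq> E" for S
  proof -
    obtain I where I: "I \<in> M" "I \<subseteq> S" "card I = r S" using ex_basis[of S] by blast
    have "card (\<phi> ` I) = card I" using inj_on_subset[OF injE, of I] indep_sub[OF I(1)] by (intro card_image)
    then show ?thesis using card_le_rk[OF \<phi>M[OF I(1)] image_mono[OF I(2)]] I(3) by simp
  qed
  have eq: "r (\<phi> ` S) = r S" if "S \<subseteq> E" for S
  proof -
    have "\<phi> ` S \<subseteq> E" using that \<phi>E by blast
    then have "r (\<phi> ` S) \<le> r S" using le[of "\<phi> ` S"] \<phi>\<phi>[OF that] by simp
    then show ?thesis using le[OF that] by simp
  qed
  have "\<phi> ` A \<subseteq> A"
  proof
    fix e assume "e \<in> \<phi> ` A"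
    then obtain f where f: "f \<in> A" "e = \<phi> f" by blast
    then obtain i j where "f = edge i j" using A E_cases by blast
    then show "e \<in> A" using f inv[of i j] by (simp add: \<phi>)
  qed
  then have "\<phi> ` \<phi> ` A \<subseteq> \<phi> ` A" by (rule image_mono)
  then have \<phi>A: "\<phi> ` A = A" using \<phi>\<phi>[OF A] \<open>\<phi> ` A \<subseteq> A\<close> by simp
  have eE: "edge i j \<in> E" and re: "r (insert (edge i j) A) = r A" using e by (simp_all add: cl_def)
  have "r (\<phi> ` insert (edge i j) A) = r A" using eq[of "insert (edge i j) A"] eE A re by simp
  then have "r (insert (edge (?t i) j) A) = r A" by (simp add: \<phi> \<phi>A)
  moreover have "edge (?t i) j \<in> E" using \<phi>E(1)[OF eE] by (simp add: \<phi>)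
  ultimately show ?thesis by (simp add: cl_def)
qed

text \<open>Distinct members meet only in edges at \<open>v\<close>, and a star is independent.
  Supermodularity of the nullity then becomes superadditivity.\<close>

lemma null_sum_star:
  assumes v: "v < m" and P: "P \<subseteq> E" and "finite \<F>"
    and "\<And>C D. (C, D) \<in> \<F> \<Longrightarrow> C \<subseteq> {..<m} \<and> D \<subseteq> {..<n}"
    and "\<And>p q. p \<in> \<F> \<Longrightarrow> q \<in> \<F> \<Longrightarrow> p \<noteq> q \<Longrightarrow> fst p \<inter> fst q \<subseteq> {v}"
  shows "(\<Sum>(C, D)\<in>\<F>. null (P \<inter> K C D)) \<le> null P"
proof -
  have "(\<Sum>(C, D)\<in>\<F>. null (P \<inter> K C D)) \<le> null (P \<inter> (\<Union>(C, D)\<in>\<F>. K C D))"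
    using assms(3-5)
  proof (induction \<F>)
    case (insert p \<F>)
    obtain C D where p: "p = (C, D)" by (cases p)
    let ?U = "P \<inter> (\<Union>(C, D)\<in>\<F>. K C D)"
    have IH: "(\<Sum>(C, D)\<in>\<F>. null (P \<inter> K C D)) \<le> null ?U"
      by (rule insert.IH) (use insert.prems in blast)+
    have fP: "finite (P \<inter> K C D)" "finite ?U" using fin_sub[OF P] by auto
    have "(P \<inter> K C D) \<inter> ?U \<subseteq> K {v} {..<n}"
    proof
      fix e assume e: "e \<in> (P \<inter> K C D) \<inter> ?U"
      then obtain C' D' where q: "(C', D') \<in> \<F>" "e \<in> K C' D'" by auto
      obtain i j where ij: "e = edge i j" "i \<in> C" "j \<in> D" using e K_cases by blast
      have "p \<noteq> (C', D')" using q insert.hyps by blast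
      then have "C \<inter> C' \<subseteq> {v}" using insert.prems(2)[of p "(C', D')"] q p by simp
      then have "i = v" using ij q by auto
      then show "e \<in> K {v} {..<n}" using ij insert.prems(1)[of C D] p by auto
    qed
    then have "(P \<inter> K C D) \<inter> ?U \<in> M" using star_indep[OF v, of "{..<n}"] indep_mono by blast
    then have "null ((P \<inter> K C D) \<inter> ?U) = 0" by (rule null_indep)
    then have "null (P \<inter> K C D) + null ?U \<le> null ((P \<inter> K C D) \<union> ?U)"
      using null_supermod[OF fP] by simp
    moreover have "(P \<inter> K C D) \<union> ?U = P \<inter> (\<Union>(C, D)\<in>insert p \<F>. K C D)" using p by auto
    ultimately show ?case using IH insert.hyps p by simp
  qed simp
  also have "\<dots> \<le> null P" using fin_sub[OF P] by (intro null_mono) auto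
  finally show ?thesis .
qed

text \<open>The vertices \<open>x p\<close> and \<open>x' p\<close> of a star system are twins in the union of the graphs
  \<open>K {v, x p, x' p} (snd p)\<close>; the symmetry of the greatest matroid therefore
  confines the blobs of its closure.\<close>

definition star_system :: "'e set \<Rightarrow> nat \<Rightarrow> (nat set \<times> nat set \<Rightarrow> nat) \<Rightarrow> (nat set \<times> nat set \<Rightarrow> nat) \<Rightarrow> bool" where
  "star_system P v x x' \<longleftrightarrow> (\<forall>p\<in>Blobs P. v \<in> fst p \<longrightarrow>
     x p \<in> fst p \<and> x' p \<in> fst p \<and> x p \<noteq> v \<and> x' p \<noteq> v \<and> x p \<noteq> x' p)"

definition star_set :: "'e set \<Rightarrow> nat \<Rightarrow> (nat set \<times> nat set \<Rightarrow> nat) \<Rightarrow> (nat set \<times> nat set \<Rightarrow> nat) \<Rightarrow> 'e set" where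
  "star_set P v x x' = (\<Union>p\<in>{p \<in> Blobs P. v \<in> fst p}. K {v, x p, x' p} (snd p))"

lemma star_system_ex: "\<exists>x x'. star_system P v x x'"
proof -
  have "\<exists>a b. v \<in> fst p \<longrightarrow> a \<in> fst p \<and> b \<in> fst p \<and> a \<noteq> v \<and> b \<noteq> v \<and> a \<noteq> b" if "p \<in> Blobs P" for p
  proof (cases "v \<in> fst p")
    case True
    have "3 \<le> card (fst p)" "finite (fst p)" using BlobsD[of "fst p" "snd p" P] that by auto
    then have "2 \<le> card (fst p - {v})" using True by simp
    then obtain a b where "a \<in> fst p - {v}" "b \<in> fst p - {v}" "a \<noteq> b" using ex_two by blast
    then show ?thesis by blast
  qed blast
  then show ?thesis unfolding star_system_def by metis
qed

lemma star_set_sub: "star_system P v x x' \<Longrightarrow> star_set P v x x' \<subseteq> P"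
proof
  fix e assume s: "star_system P v x x'" and "e \<in> star_set P v x x'"
  then obtain p where p: "p \<in> Blobs P" "v \<in> fst p" "e \<in> K {v, x p, x' p} (snd p)"
    unfolding star_set_def by blast
  then have "{v, x p, x' p} \<subseteq> fst p" using s unfolding star_system_def by auto
  then have "e \<in> K (fst p) (snd p)" using p(3) K_mono by blast
  then show "e \<in> P" using BlobsD(5)[of "fst p" "snd p" P] p(1) by auto
qed

lemma Blobs_left_unique:
  assumes "wclosed P" "p \<in> Blobs P" "q \<in> Blobs P" "u \<in> fst p" "u \<in> fst q" "u' \<in> fst p" "u' \<in> fst q" "u \<noteq> u'"
  shows "p = q"
proof -
  have pq: "(fst p, snd p) \<in> Blobs P" "(fst q, snd q) \<in> Blobs P" using assms by auto
  have "2 \<le> card (fst p \<inter> fst q)" using card_Int_ge[OF BlobsD(6)[OF pq(1)] assms(4,6,5,7,8)] .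
  then show ?thesis using Blobs_eq[OF assms(1) pq] by (simp add: prod_eq_iff)
qed

text \<open>If just one twin lies in \<open>C\<close>, the transposed copy of \<open>K C D\<close>
  is also in the closure and agrees with \<open>C\<close> on all other left vertices. At least two
  of these exist, so both copies merge inside \<open>Q\<close>.\<close>

lemma twin_absorb:
  assumes P: "wclosed P" and s: "star_system P v x x'" and Q: "wclosed Q" "cls (star_set P v x x') \<subseteq> Q"
    and C: "C \<subseteq> {..<m}" "D \<subseteq> {..<n}" "3 \<le> card C" "2 \<le> card D" "K C D \<subseteq> cls (star_set P v x x')"
    and p: "p \<in> Blobs P" "v \<in> fst p" and z: "x p \<in> C \<or> x' p \<in> C"
  shows "K (C \<union> {x p, x' p}) D \<subseteq> Q"
proof (cases "x p \<in> C \<and> x' p \<in> C")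
  case True
  then have "C \<union> {x p, x' p} = C" by auto
  then show ?thesis using C Q by auto
next
  case False
  let ?t = "transpose (x p) (x' p)"
  let ?Y = "star_set P v x x'"
  have pp: "(fst p, snd p) \<in> Blobs P" using p by simp
  have xp: "x p \<in> fst p" "x' p \<in> fst p" "x p \<noteq> v" "x' p \<noteq> v" "x p \<noteq> x' p"
    using s p unfolding star_system_def by auto
  have xm: "x p < m" "x' p < m" using xp BlobsD(1)[OF pp] by auto
  have YE: "?Y \<subseteq> E" using star_set_sub[OF s] P unfolding wclosed_def by blast
  \<comment> \<open>A twin of \<open>p\<close> cannot occur in another blob through
    \<open>v\<close>, since the two blobs would then share two left vertices.\<close>
  have inv: "edge (?t i) j \<in> ?Y" if "edge i j \<in> ?Y" for i j
  proof -
    obtain q where q: "q \<in> Blobs P" "v \<in> fst q" "i \<in> {v, x q, x' q}" "j \<in> snd q"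
      using \<open>edge i j \<in> ?Y\<close> unfolding star_set_def by auto
    have xq: "x q \<in> fst q" "x' q \<in> fst q" "x q \<noteq> v" "x' q \<noteq> v"
      using s q unfolding star_system_def by auto
    have "?t i \<in> {v, x q, x' q}"
    proof (cases "i = x p \<or> i = x' p")
      case True
      then have "i \<in> fst p" "i \<in> fst q" "i \<noteq> v" using xp xq q(3) by auto
      then have "q = p" using Blobs_left_unique[OF P q(1) p(1) q(2) p(2)] by blast
      then show ?thesis using True by (auto simp: transpose_def)
    next
      case False
      then show ?thesis using q(3) by (simp add: transpose_def)
    qed
    then have "edge (?t i) j \<in> K {v, x q, x' q} (snd q)" using q(4) by simp
    then show ?thesis using q(1,2) unfolding star_set_def by blast
  qed
  have tC: "K (?t ` C) D \<subseteq> cls ?Y"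
  proof (rule K_subI)
    fix i j assume "i \<in> ?t ` C" "j \<in> D"
    then obtain i' where "i = ?t i'" "i' \<in> C" by blast
    moreover have "edge i' j \<in> cls ?Y" using \<open>i' \<in> C\<close> \<open>j \<in> D\<close> C(5) by (meson in_K subsetD)
    ultimately show "edge i j \<in> cls ?Y" using twin_cl[OF xm YE inv] by blast
  qed
  have fC: "finite C" using C finite_left by blast
  have "C - {x p, x' p} \<subseteq> C \<inter> ?t ` C"
  proof
    fix i assume i: "i \<in> C - {x p, x' p}"
    then have "?t i = i" by (simp add: transpose_def)
    then show "i \<in> C \<inter> ?t ` C" using i by (metis DiffD1 IntI imageI)
  qed
  then have "card (C - {x p, x' p}) \<le> card (C \<inter> ?t ` C)" using fC by (intro card_mono) auto
  moreover have "card (C - {x p, x' p}) + 1 = card C"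
  proof -
    obtain z where "C - {x p, x' p} = C - {z}" "z \<in> C" using z False by blast
    then show ?thesis using fC C(3) by simp
  qed
  ultimately have c2: "2 \<le> card (C \<inter> ?t ` C)" using C(3) by simp
  have "?t ` C \<subseteq> {..<m}" using C(1) xm by (auto simp: transpose_def)
  then have "K (C \<union> ?t ` C) (D \<union> D) \<subseteq> Q"
    using merge[OF Q(1) C(1,2) _ _ C(2) _ c2] C(4,5) tC Q(2) by blast
  moreover have "C \<union> {x p, x' p} \<subseteq> C \<union> ?t ` C"
  proof -
    have "?t (x p) = x' p" "?t (x' p) = x p" by simp_all
    then have "x' p \<in> ?t ` C \<or> x p \<in> ?t ` C" using z by (metis imageI)
    moreover have "x p \<in> C \<longrightarrow> x' p \<in> ?t ` C" "x' p \<in> C \<longrightarrow> x p \<in> ?t ` C"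
      using \<open>?t (x p) = x' p\<close> \<open>?t (x' p) = x p\<close> by (metis imageI)+
    ultimately show ?thesis using z by blast
  qed
  ultimately show ?thesis using K_mono[of "C \<union> {x p, x' p}" "C \<union> ?t ` C" D "D \<union> D"] by blast
qed

text \<open>The complete bipartite graph on \<open>v\<close>, all chosen twins and the right sides
  of the blobs is a flat containing the star set, so it confines the closure as well.\<close>

lemma star_left:
  assumes P: "wclosed P" and s: "star_system P v x x'" and K: "K C D \<subseteq> cls (star_set P v x x')"
    and C: "D \<noteq> {}" "2 \<le> card C" and v: "v < m"
  shows "C \<subseteq> insert v (\<Union>p\<in>{p \<in> Blobs P. v \<in> fst p}. {x p, x' p})"
    and "D \<subseteq> (\<Union>p\<in>{p \<in> Blobs P. v \<in> fst p}. snd p)"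
    and "\<exists>p\<in>Blobs P. v \<in> fst p \<and> (x p \<in> C \<or> x' p \<in> C)"
proof -
  let ?J = "{p \<in> Blobs P. v \<in> fst p}"
  let ?L = "insert v (\<Union>p\<in>?J. {x p, x' p})"
  let ?N = "\<Union>p\<in>?J. snd p"
  have "?L \<subseteq> {..<m}"
  proof
    fix i assume "i \<in> ?L"
    then show "i \<in> {..<m}"
    proof
      assume "i \<in> (\<Union>p\<in>?J. {x p, x' p})"
      then obtain p where p: "p \<in> Blobs P" "v \<in> fst p" "i \<in> {x p, x' p}" by blast
      then have "i \<in> fst p" using s unfolding star_system_def by auto
      then show ?thesis using BlobsD(1)[of "fst p" "snd p" P] p by auto
    qed (use v in simp)
  qed
  moreover have "?N \<subseteq> {..<n}"
  proof
    fix i assume "i \<in> ?N"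
    then obtain p where "p \<in> Blobs P" "i \<in> snd p" by blast
    then show "i \<in> {..<n}" using BlobsD(2)[of "fst p" "snd p" P] by auto
  qed
  ultimately have "isflat (K ?L ?N)" by (rule flat_K)
  moreover have "star_set P v x x' \<subseteq> K ?L ?N"
    unfolding star_set_def by (intro UN_least K_mono) blast+
  ultimately have "K C D \<subseteq> K ?L ?N" using cl_sub_flat[of "K ?L ?N"] K by (meson order_trans)
  moreover have "C \<noteq> {}" using C by auto
  ultimately show sub: "C \<subseteq> ?L" and "D \<subseteq> ?N" using K_sub_D[of C D ?L ?N] C(1) by simp_all
  have "\<not> C \<subseteq> {v}"
  proof
    assume "C \<subseteq> {v}"
    then have "card C \<le> card {v}" by (intro card_mono) auto
    then show False using C by simp
  qed
  then obtain z where "z \<in> C" "z \<noteq> v" by blast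
  then show "\<exists>p\<in>Blobs P. v \<in> fst p \<and> (x p \<in> C \<or> x' p \<in> C)" using sub by blast
qed

text \<open>Let \<open>j\<close> be the size of \<open>J\<close> and \<open>S\<close> the sum on the
  left. The star set has \<open>card N + 2 * S + 4 * j\<close> edges, and its closure has nullity at
  most \<open>S\<close>. It lies in \<open>K L N\<close> with \<open>card L = 1 + 2 * j\<close>
  without spanning it, so its rank is at most \<open>2 * (1 + 2 * j + card N) - 5\<close>. Comparing
  edges with rank plus nullity leaves \<open>S + 3 \<le> card N\<close>.\<close>

lemma local_count:
  fixes x x' :: "nat set \<times> nat set \<Rightarrow> nat"
  assumes P: "wclosed P" and s: "star_system P v x x'"
    and J: "J = {p \<in> Blobs P. v \<in> fst p}" "2 \<le> card J"
    and sub: "cls (star_set P v x x') \<subseteq> P" and D: "Dress (cls (star_set P v x x'))"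
  shows "(\<Sum>p\<in>J. card (snd p) - 2) + 3 \<le> card (\<Union>p\<in>J. snd p)"
proof -
  let ?Y = "star_set P v x x'"
  let ?G = "cls ?Y"
  let ?T = "\<lambda>p. {v, x p, x' p}"
  define L where "L = insert v (\<Union>p\<in>J. {x p, x' p})"
  define N where "N = (\<Union>p\<in>J. snd p)"
  have fJ: "finite J" using J finite_Blobs by simp
  have Y: "?Y = (\<Union>p\<in>J. K (?T p) (snd p))" unfolding star_set_def J by simp
  have xJ: "x p \<in> fst p" "x' p \<in> fst p" "x p \<noteq> v" "x' p \<noteq> v" "x p \<noteq> x' p" "v \<in> fst p" if "p \<in> J" for p
    using s that J(1) unfolding star_system_def by auto
  have bJ: "(fst p, snd p) \<in> Blobs P" "p \<in> Blobs P" if "p \<in> J" for p using that J(1) by auto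
  have same: "p = q" if "p \<in> J" "q \<in> J" "u \<in> fst p" "u \<in> fst q" "u \<noteq> v" for p q u
    using Blobs_left_unique[OF P bJ(2)[OF that(1)] bJ(2)[OF that(2)] that(3,4) xJ(6)[OF that(1)] xJ(6)[OF that(2)] that(5)] .
  have YP: "?Y \<subseteq> P" using star_set_sub[OF s] .
  have YE: "?Y \<subseteq> E" using YP P unfolding wclosed_def by blast
  have YG: "?Y \<subseteq> ?G" using sub_cl[OF YE] .
  have fG: "isflat ?G" using flat_cl[OF YE] .
  have "J \<noteq> {}" using J(2) by auto
  then obtain p0 where p0: "p0 \<in> J" by blast
  have v: "v < m" using BlobsD(1)[OF bJ(1)[OF p0]] xJ(6)[OF p0] by auto
  have Lm: "L \<subseteq> {..<m}"
  proof -
    have "x p < m" "x' p < m" if "p \<in> J" for p using BlobsD(1)[OF bJ(1)[OF that]] xJ[OF that] by auto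
    then show ?thesis unfolding L_def using v by auto
  qed
  have Nn: "N \<subseteq> {..<n}" unfolding N_def using BlobsD(2)[OF bJ(1)] by blast
  have fN: "finite N" using Nn finite_right by blast
  have tri: "card (?T p) = 3" if "p \<in> J" for p using xJ[OF that] by simp
  \<comment> \<open>A blob of the closure contains a twin of some \<open>p\<close>, hence is
    absorbed by \<open>p\<close>. The chosen vertices of other blobs are not in \<open>fst p\<close>
    except \<open>v\<close>, which leaves only the three left vertices of \<open>p\<close>.\<close>
  have blob: "\<exists>p\<in>J. C = ?T p \<and> D = snd p" if CD: "(C, D) \<in> Blobs ?G" for C D
  proof -
    note b = BlobsD[OF CD]
    have "2 \<le> card C" using b by simp
    note sl = star_left[OF P s b(5) b(9) this v]
    obtain p where p: "p \<in> J" "x p \<in> C \<or> x' p \<in> C" using sl(3) J(1) by auto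
    have pB: "p \<in> Blobs P" "v \<in> fst p" using p J(1) by auto
    have "2 \<le> card D" using b by simp
    then have k: "K (C \<union> {x p, x' p}) D \<subseteq> P"
      by (rule twin_absorb[OF P s P sub b(1,2,3) _ b(5) pB p(2)])
    have cm: "C \<union> {x p, x' p} \<subseteq> {..<m}" using b(1) xJ[OF p(1)] BlobsD(1)[OF bJ(1)[OF p(1)]] by auto
    have c2: "2 \<le> card (fst p \<inter> (C \<union> {x p, x' p}))"
      by (rule card_Int_ge[OF BlobsD(6)[OF bJ(1)[OF p(1)]], of "x p" "x' p"]) (use xJ[OF p(1)] in simp_all)
    have "C \<union> {x p, x' p} \<subseteq> fst p" "D \<subseteq> snd p"
      using absorb[OF P bJ(1)[OF p(1)] cm b(2) k \<open>2 \<le> card D\<close> c2] by simp_all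
    then have Cp: "C \<subseteq> fst p" by blast
    have "C \<subseteq> ?T p"
    proof
      fix u assume u: "u \<in> C"
      show "u \<in> ?T p"
      proof (cases "u = v")
        case False
        have "u \<in> insert v (\<Union>p\<in>J. {x p, x' p})" using subsetD[OF sl(1) u] unfolding J(1) .
        then obtain q where q: "q \<in> J" "u \<in> {x q, x' q}" using False by blast
        then have "u \<in> fst q" using xJ[OF q(1)] by auto
        then have "q = p" using same[OF q(1) p(1) _ subsetD[OF Cp u] False] by blast
        then show ?thesis using q by blast
      qed simp
    qed
    then have C: "C = ?T p" using card_seteq[of "?T p" C] tri[OF p(1)] b(3) by simp
    have "K (?T p) (snd p) \<subseteq> ?Y" unfolding Y using p(1) by (rule UN_upper)
    then have "K C (snd p) \<subseteq> ?G" using C YG by simp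
    then have "snd p = D"
      using Blobs_maximal(2)[OF CD b(1) BlobsD(2)[OF bJ(1)[OF p(1)]] subset_refl \<open>D \<subseteq> snd p\<close>] by simp
    then show ?thesis using C p by blast
  qed
  let ?f = "\<lambda>p. (card (fst p) - 2) * (card (snd p) - 2)"
  have "wt ?G = (\<Sum>p\<in>Blobs ?G. ?f p)" by (simp add: wt_def case_prod_beta)
  also have "\<dots> \<le> (\<Sum>p\<in>(\<lambda>p. (?T p, snd p)) ` J. ?f p)"
  proof (rule sum_mono2)
    show "finite ((\<lambda>p. (?T p, snd p)) ` J)" using fJ by simp
    show "Blobs ?G \<subseteq> (\<lambda>p. (?T p, snd p)) ` J"
    proof
      fix q assume q: "q \<in> Blobs ?G"
      obtain C D where CD: "q = (C, D)" by (cases q)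
      then obtain p where "p \<in> J" "C = ?T p" "D = snd p" using blob[of C D] q by auto
      then show "q \<in> (\<lambda>p. (?T p, snd p)) ` J" using CD by (intro image_eqI[of _ _ p]) simp_all
    qed
  qed simp
  also have "\<dots> \<le> (\<Sum>p\<in>J. ?f (?T p, snd p))" using sum_image_le[OF fJ, of ?f "\<lambda>p. (?T p, snd p)"] by (simp add: comp_def)
  also have "\<dots> = (\<Sum>p\<in>J. card (snd p) - 2)" using tri by (intro sum.cong) simp_all
  finally have wtG: "wt ?G \<le> (\<Sum>p\<in>J. card (snd p) - 2)" .
  have cL: "card L = 1 + 2 * card J"
  proof -
    have "card (\<Union>p\<in>J. {x p, x' p}) = (\<Sum>p\<in>J. card {x p, x' p})"
    proof (rule card_UN_disjoint[OF fJ])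
      show "\<forall>p\<in>J. \<forall>q\<in>J. p \<noteq> q \<longrightarrow> {x p, x' p} \<inter> {x q, x' q} = {}"
      proof (intro ballI impI equals0I)
        fix p q u assume a: "p \<in> J" "q \<in> J" "p \<noteq> q" "u \<in> {x p, x' p} \<inter> {x q, x' q}"
        then have "u \<in> fst p" "u \<in> fst q" "u \<noteq> v" using xJ[OF a(1)] xJ[OF a(2)] by auto
        then show False using same[OF a(1,2)] a(3) by blast
      qed
    qed simp
    also have "\<dots> = (\<Sum>p\<in>J. 2)" using xJ(5) by (intro sum.cong) simp_all
    finally have "card (\<Union>p\<in>J. {x p, x' p}) = 2 * card J" by simp
    moreover have "v \<notin> (\<Union>p\<in>J. {x p, x' p})" using xJ(3,4) by blast
    moreover have "finite (\<Union>p\<in>J. {x p, x' p})" using fJ by simp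
    ultimately show ?thesis unfolding L_def by simp
  qed
  have cY: "card ?Y = card N + 2 * (\<Sum>p\<in>J. card (snd p))"
  proof -
    have "?Y = K {v} N \<union> (\<Union>p\<in>J. K {x p, x' p} (snd p))"
      unfolding Y N_def by (auto simp: K_def)
    moreover have "K {v} N \<inter> K {x p, x' p} (snd p) = {}" if "p \<in> J" for p
      using xJ(3,4)[OF that] by (simp add: K_Int) (simp add: K_def)
    then have "K {v} N \<inter> (\<Union>p\<in>J. K {x p, x' p} (snd p)) = {}" by blast
    moreover have fs: "\<forall>p\<in>J. finite (K {x p, x' p} (snd p))"
      using finite_K BlobsD(7)[OF bJ(1)] by simp
    moreover have "card (\<Union>p\<in>J. K {x p, x' p} (snd p)) = (\<Sum>p\<in>J. card (K {x p, x' p} (snd p)))"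
    proof (rule card_UN_disjoint[OF fJ fs])
      show "\<forall>p\<in>J. \<forall>q\<in>J. p \<noteq> q \<longrightarrow> K {x p, x' p} (snd p) \<inter> K {x q, x' q} (snd q) = {}"
      proof (intro ballI impI equals0I)
        fix p q e assume a: "p \<in> J" "q \<in> J" "p \<noteq> q" "e \<in> K {x p, x' p} (snd p) \<inter> K {x q, x' q} (snd q)"
        then have "e \<in> K ({x p, x' p} \<inter> {x q, x' q}) (snd p \<inter> snd q)" by (simp only: K_Int)
        then obtain i where "i \<in> {x p, x' p} \<inter> {x q, x' q}" using K_cases by blast
        then have "i \<in> {x p, x' p}" "i \<in> {x q, x' q}" by blast+
        then have "i \<in> fst p" "i \<in> fst q" "i \<noteq> v" using xJ[OF a(1)] xJ[OF a(2)] by auto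
        then show False using same[OF a(1,2)] a(3) by blast
      qed
    qed
    moreover have "(\<Sum>p\<in>J. card (K {x p, x' p} (snd p))) = (\<Sum>p\<in>J. 2 * card (snd p))"
      using xJ(5) by (intro sum.cong) (simp_all add: card_K)
    ultimately show ?thesis
      using card_Un_disjoint[of "K {v} N" "\<Union>p\<in>J. K {x p, x' p} (snd p)"] fJ fN finite_K[of "{v}" N]
      by (simp add: card_K sum_distrib_left)
  qed
  have S: "(\<Sum>p\<in>J. card (snd p)) = (\<Sum>p\<in>J. card (snd p) - 2) + 2 * card J"
  proof -
    have "(\<Sum>p\<in>J. card (snd p)) = (\<Sum>p\<in>J. (card (snd p) - 2) + 2)"
      using BlobsD(4)[OF bJ(1)] by (intro sum.cong) fastforce+
    also have "\<dots> = (\<Sum>p\<in>J. card (snd p) - 2) + (\<Sum>p\<in>J. 2)" by (rule sum.distrib)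
    finally show ?thesis by simp
  qed
  have GK: "?G \<subseteq> K L N"
  proof (rule cl_sub_flat[OF flat_K[OF Lm Nn]])
    show "?Y \<subseteq> K L N" unfolding Y L_def N_def by (intro UN_least K_mono) blast+
  qed
  have "snd p0 \<subseteq> N" using p0 unfolding N_def by blast
  then have cN: "3 \<le> card N" using BlobsD(4)[OF bJ(1)[OF p0]] card_mono[OF fN] by (meson order_trans)
  have rKN: "r (K L N) + 4 = 2 * (card L + card N)"
    using rk_K[OF Lm _ Nn] cL cN J(2) by simp
  have KE: "K L N \<subseteq> E" using Lm Nn by (rule K_sub_E)
  \<comment> \<open>Equal rank would make the closure all of \<open>K L N\<close>, a blob with more
    than three left vertices; this gains the last unit of the bound.\<close>
  have "r ?G \<noteq> r (K L N)"
  proof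
    assume "r ?G = r (K L N)"
    then have "K L N = ?G" using flat_eq_of_rk[OF fG GK KE] by simp
    moreover have "3 \<le> card L" using cL J(2) by simp
    ultimately obtain C D where CD: "(C, D) \<in> Blobs ?G" "L \<subseteq> C"
      using Blobs_ex[OF Lm Nn _ cN, of ?G] by auto
    then obtain p where "p \<in> J" "C = ?T p" using blob by blast
    then have "card L \<le> 3" using CD(2) tri[of p] card_mono[of C L] by simp
    then show False using cL J(2) by simp
  qed
  moreover have "r ?G \<le> r (K L N)" using GK by (rule rk_mono)
  ultimately have rG: "r ?G + 5 \<le> 2 * (card L + card N)" using rKN by simp
  have fin: "finite ?G" using cl_sub fin_sub by blast
  have "card ?Y \<le> card ?G" using fin YG by (rule card_mono)
  moreover have "r ?G + wt ?G = card ?G" using rk_null[OF fin] D unfolding Dress_def by simp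
  ultimately show ?thesis using wtG rG cY S cL unfolding N_def[symmetric] by simp
qed

text \<open>If the star at \<open>v\<close> spans \<open>P\<close>, every blob of \<open>F\<close>
  with dependent trace contains twins of some blob through \<open>v\<close>, hence all of that blob
  and \<open>v\<close> itself. Such blobs meet pairwise only in \<open>v\<close> on the left, and
  \<open>null_sum_star\<close> applies.\<close>

lemma star_spanning:
  assumes F: "wclosed F" and P: "wclosed P" "P \<subseteq> F" and s: "star_system P v x x'" and v: "v < m"
    and span: "P \<subseteq> cls (star_set P v x x')" "cls (star_set P v x x') \<subseteq> F"
    and bl: "\<And>C D. (C, D) \<in> Blobs F \<Longrightarrow> 0 < null (P \<inter> K C D) \<Longrightarrow> Blobs (P \<inter> K C D) \<noteq> {}"
  shows "snull F P \<le> null P"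
proof -
  let ?F = "{p \<in> Blobs F. 0 < null (P \<inter> K (fst p) (snd p))}"
  have vC: "v \<in> C" if CD: "(C, D) \<in> Blobs F" "0 < null (P \<inter> K C D)" for C D
  proof -
    obtain A B where AB: "(A, B) \<in> Blobs (P \<inter> K C D)" using bl[OF CD] by auto
    note b = BlobsD[OF AB] and c = BlobsD[OF CD(1)]
    have kc: "K A B \<subseteq> cls (star_set P v x x')" using b(5) span(1) by blast
    have AC: "A \<subseteq> C" using K_sub_D(1)[of A B C D] b by blast
    have A2: "2 \<le> card A" and B2: "2 \<le> card B" using b by auto
    obtain p where p: "p \<in> Blobs P" "v \<in> fst p" "x p \<in> A \<or> x' p \<in> A"
      using star_left(3)[OF P(1) s kc b(9) A2 v] by blast
    have pp: "(fst p, snd p) \<in> Blobs P" using p by simp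
    note bp = BlobsD[OF pp]
    have xp: "x p \<in> fst p" "x' p \<in> fst p" "x p \<noteq> v" "x' p \<noteq> v" "x p \<noteq> x' p"
      using s p unfolding star_system_def by auto
    have k: "K (A \<union> {x p, x' p}) B \<subseteq> F"
      using twin_absorb[OF P(1) s F span(2) b(1,2,3) B2 kc p] .
    have "A \<subseteq> C \<inter> (A \<union> {x p, x' p})" using AC by blast
    then have "card A \<le> card (C \<inter> (A \<union> {x p, x' p}))" using c(6) by (intro card_mono) auto
    then have "2 \<le> card (C \<inter> (A \<union> {x p, x' p}))" using A2 by simp
    moreover have "A \<union> {x p, x' p} \<subseteq> {..<m}" using b(1) xp bp(1) by auto
    ultimately have xC: "x p \<in> C" "x' p \<in> C" using absorb(1)[OF F CD(1) _ b(2) k B2] by auto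
    have "K (fst p) (snd p) \<subseteq> F" using bp(5) P(2) by blast
    moreover have "2 \<le> card (C \<inter> fst p)" using card_Int_ge[OF c(6) xC xp(1,2,5)] .
    ultimately have "fst p \<subseteq> C" using absorb(1)[OF F CD(1) bp(1,2)] bp(4) by simp
    then show "v \<in> C" using p(2) by blast
  qed
  have "snull F P = (\<Sum>p\<in>Blobs F. null (P \<inter> K (fst p) (snd p)))"
    by (simp add: snull_def case_prod_beta)
  also have "\<dots> = (\<Sum>p\<in>?F. null (P \<inter> K (fst p) (snd p)))"
    using finite_Blobs by (intro sum.mono_neutral_right) auto
  also have "\<dots> = (\<Sum>(C, D)\<in>?F. null (P \<inter> K C D))" by (simp add: case_prod_beta)
  also have "\<dots> \<le> null P"
  proof (rule null_sum_star[OF v])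
    show "P \<subseteq> E" using P unfolding wclosed_def by blast
    show "finite ?F" using finite_Blobs by simp
    show "C \<subseteq> {..<m} \<and> D \<subseteq> {..<n}" if "(C, D) \<in> ?F" for C D
      using that BlobsD(1,2)[of C D F] by simp
    fix p q assume pq: "p \<in> ?F" "q \<in> ?F" "p \<noteq> q"
    have "v \<in> fst p" "v \<in> fst q" using vC[of "fst p" "snd p"] vC[of "fst q" "snd q"] pq by auto
    then have "u = v" if "u \<in> fst p \<inter> fst q" for u
      using Blobs_left_unique[OF F, of p q u v] pq that by auto
    then show "fst p \<inter> fst q \<subseteq> {v}" by blast
  qed
  finally show ?thesis .
qed

text \<open>Otherwise every vertex of a blob lies in at least two, and both local bounds hold
  throughout. The union of the blobs has rank at most \<open>2 * (card VL + card VR) - 4\<close> and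
  nullity at most \<open>wt P\<close>, which is the remaining input of
  \<open>vertex_count\<close>.\<close>

lemma private_vertex:
  assumes P: "P \<subseteq> E" "Blobs P \<noteq> {}" and null: "null P \<le> wt P"
    and left: "\<And>v. 2 \<le> card {p \<in> Blobs P. v \<in> fst p} \<Longrightarrow>
      (\<Sum>p\<in>{p \<in> Blobs P. v \<in> fst p}. card (snd p) - 2) + 3 \<le> card (\<Union>p\<in>{p \<in> Blobs P. v \<in> fst p}. snd p)"
    and right: "\<And>v. 2 \<le> card {p \<in> Blobs P. v \<in> snd p} \<Longrightarrow>
      (\<Sum>p\<in>{p \<in> Blobs P. v \<in> snd p}. card (fst p) - 2) + 3 \<le> card (\<Union>p\<in>{p \<in> Blobs P. v \<in> snd p}. fst p)"
  shows "(\<exists>v. card {p \<in> Blobs P. v \<in> fst p} = 1) \<or> (\<exists>v. card {p \<in> Blobs P. v \<in> snd p} = 1)"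
proof (rule ccontr)
  assume no: "\<not> ?thesis"
  define VL where "VL = (\<Union>(A, B)\<in>Blobs P. A)"
  define VR where "VR = (\<Union>(A, B)\<in>Blobs P. B)"
  define T where "T = (\<Union>(A, B)\<in>Blobs P. A \<times> B)"
  define Q where "Q = (\<Union>(A, B)\<in>Blobs P. K A B)"
  have two: "2 \<le> card {p \<in> Blobs P. v \<in> h p}"
    if "v \<in> h p" "p \<in> Blobs P" "card {p \<in> Blobs P. v \<in> h p} \<noteq> 1" for v p and h :: "nat set \<times> nat set \<Rightarrow> nat set"
  proof -
    have "finite {p \<in> Blobs P. v \<in> h p}" using finite_Blobs by simp
    moreover have "p \<in> {p \<in> Blobs P. v \<in> h p}" using that by simp
    ultimately have "0 < card {p \<in> Blobs P. v \<in> h p}" unfolding card_gt_0_iff by blast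
    then show ?thesis using that(3) by simp
  qed
  have QP: "Q \<subseteq> P" unfolding Q_def using BlobsD(5) by auto
  have fP: "finite P" using P fin_sub by blast
  have VLm: "VL \<subseteq> {..<m}" unfolding VL_def using BlobsD(1) by fastforce
  have VRn: "VR \<subseteq> {..<n}" unfolding VR_def using BlobsD(2) by fastforce
  obtain A0 B0 where AB0: "(A0, B0) \<in> Blobs P" using P(2) by auto
  have "A0 \<subseteq> VL" "B0 \<subseteq> VR" using AB0 unfolding VL_def VR_def by blast+
  then have "card A0 \<le> card VL" "card B0 \<le> card VR"
    using VLm VRn finite_left finite_right by (auto intro!: card_mono)
  then have c3: "2 \<le> card VL" "2 \<le> card VR" using BlobsD(3,4)[OF AB0] by auto
  have "Q = case_prod edge ` T" unfolding Q_def T_def K_image by blast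
  moreover have "inj_on (case_prod edge) T" by (auto simp: inj_on_def)
  ultimately have cQ: "card Q = card T" by (simp add: card_image)
  have "K A B \<subseteq> K VL VR" if "(A, B) \<in> Blobs P" for A B
    using that unfolding VL_def VR_def by (intro K_mono) blast+
  then have "Q \<subseteq> K VL VR" unfolding Q_def by blast
  then have rQ: "r Q + 4 \<le> 2 * (card VL + card VR)"
    using rk_K[OF VLm c3(1) VRn c3(2)] rk_mono[of Q "K VL VR"] by simp
  have fQ: "finite Q" using QP fP finite_subset by blast
  have "null Q \<le> wt P" using null_mono[OF fP QP] null by simp
  then have tot: "card T + 4 \<le> wt P + 2 * (card VL + card VR)"
    using rk_null[OF fQ] rQ cQ by simp
  show False
  proof (rule vertex_count[OF finite_Blobs _ T_def VL_def VR_def])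
    show "finite A \<and> finite B \<and> 3 \<le> card A \<and> 3 \<le> card B" if "(A, B) \<in> Blobs P" for A B
      using BlobsD[OF that] by simp
    show "card T + 4 \<le> (\<Sum>(A, B)\<in>Blobs P. (card A - 2) * (card B - 2)) + 2 * (card VL + card VR)"
      using tot unfolding wt_def .
    fix v
    {
      assume "v \<in> VL"
      then obtain p where "p \<in> Blobs P" "v \<in> fst p" unfolding VL_def by force
      then show "(\<Sum>p\<in>{p \<in> Blobs P. v \<in> fst p}. card (snd p) - 2) + 3 \<le> card (\<Union>p\<in>{p \<in> Blobs P. v \<in> fst p}. snd p)"
        using left two[of v fst p] no by blast
    next
      assume "v \<in> VR"
      then obtain p where "p \<in> Blobs P" "v \<in> snd p" unfolding VR_def by force
      then show "(\<Sum>p\<in>{p \<in> Blobs P. v \<in> snd p}. card (fst p) - 2) + 3 \<le> card (\<Union>p\<in>{p \<in> Blobs P. v \<in> snd p}. fst p)"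
        using right two[of v snd p] no by blast
    }
  qed
qed

text \<open>\<open>V\<close> is the graph without \<open>v\<close>. The edges from \<open>v\<close>
  into its only blob add at most two to the rank and every other edge at \<open>v\<close> at most
  one, so the nullity drops by at least \<open>card B - 2\<close>, while the weight drops by at most
  that. Hence the defect \<open>wt - null\<close> does not decrease and \<open>card - wt\<close>
  falls by at least two. \<open>T\<close> records as many copies of K33 as weight is lost.\<close>

lemma peel_left:
  assumes P: "wclosed P" and one: "card {p \<in> Blobs P. v \<in> fst p} = 1"
  shows "\<exists>V T. isflat V \<and> wt P + null (P \<inter> V) \<le> wt (P \<inter> V) + null P \<and> card (P \<inter> V) + wt P + 2 \<le> card P + wt (P \<inter> V)
    \<and> set T \<subseteq> XX \<and> \<Union>(set T) \<subseteq> P \<and> (\<forall>i<length T. \<not> T ! i \<subseteq> V \<union> (\<Union>j<i. T ! j)) \<and> wt P \<le> wt (P \<inter> V) + length T"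
proof -
  obtain p0 where p0: "{p \<in> Blobs P. v \<in> fst p} = {p0}" using one card_1_singletonE by blast
  obtain A B where ab: "p0 = (A, B)" by (cases p0)
  have "p0 \<in> {p \<in> Blobs P. v \<in> fst p}" using p0 by simp
  then have AB: "(A, B) \<in> Blobs P" "v \<in> A" using ab by simp_all
  have only: "C = A \<and> D = B" if "(C, D) \<in> Blobs P" "v \<in> C" for C D
  proof -
    have "(C, D) \<in> {p \<in> Blobs P. v \<in> fst p}" using that by simp
    then show ?thesis using p0 ab by simp
  qed
  note b = BlobsD[OF AB(1)]
  have PE: "P \<subseteq> E" using P unfolding wclosed_def by blast
  have v: "v < m" using b(1) AB(2) by auto
  let ?V = "K ({..<m} - {v}) {..<n}"
  let ?S = "P \<inter> K {v} {..<n}"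
  have PV: "P \<inter> ?V = P - K {v} {..<n}" using PE by (auto simp: K_def E_def)
  have fP: "finite P" using PE fin_sub by blast
  have w: "wt P \<le> wt (P \<inter> ?V) + (card B - 2)"
    unfolding PV by (rule wt_remove_vertex[OF P AB only])
  have cP: "card P = card (P \<inter> ?V) + card ?S"
  proof -
    have "P = (P \<inter> ?V) \<union> ?S" using PV by blast
    moreover have "(P \<inter> ?V) \<inter> ?S = {}" using PV by blast
    ultimately show ?thesis using card_Un_disjoint[of "P \<inter> ?V" ?S] fP by simp
  qed
  have KS: "K {v} B \<subseteq> ?S"
  proof (rule Int_greatest)
    show "K {v} B \<subseteq> P" using b(5) K_mono[of "{v}" A B B] AB(2) by blast
    show "K {v} B \<subseteq> K {v} {..<n}" using b(2) by (intro K_mono) auto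
  qed
  have dB: "card ?S = card B + card (?S - K {v} B)"
    using card_Diff_subset[OF finite_subset[OF KS] KS] card_mono[OF _ KS] fP by (simp add: card_K)
  have kA: "K (A - {v}) B \<subseteq> P \<inter> ?V" using b(5) b(1,2) by (auto simp: K_def)
  have "2 \<le> card (A - {v})" using b(3) AB(2) by simp
  then have r1: "r (P \<inter> ?V \<union> K {v} B) \<le> r (P \<inter> ?V) + 2"
    using rk_Un_star_le[of "A - {v}" B "P \<inter> ?V" v] b(1,2) kA PE v by blast
  have "P \<subseteq> (P \<inter> ?V \<union> K {v} B) \<union> (?S - K {v} B)" using PV by blast
  then have "r P \<le> r ((P \<inter> ?V \<union> K {v} B) \<union> (?S - K {v} B))" by (rule rk_mono)
  also have "\<dots> \<le> r (P \<inter> ?V \<union> K {v} B) + card (?S - K {v} B)" using fP by (intro rk_Un_le) auto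
  finally have rP: "r P \<le> r (P \<inter> ?V) + 2 + card (?S - K {v} B)" using r1 by simp
  have n1: "r P + null P = card P" "r (P \<inter> ?V) + null (P \<inter> ?V) = card (P \<inter> ?V)"
    using rk_null fP by auto
  have c1: "wt P + null (P \<inter> ?V) \<le> wt (P \<inter> ?V) + null P"
    using w cP dB rP n1 b(4) by simp
  have c2: "card (P \<inter> ?V) + wt P + 2 \<le> card P + wt (P \<inter> ?V)" using w cP dB b(4) by simp
  have fl: "isflat ?V" by (rule flat_K) auto
  obtain a a' where a: "a \<in> A - {v}" "a' \<in> A - {v}" "a \<noteq> a'" using ex_two[OF \<open>2 \<le> card (A - {v})\<close>] by blast
  have "2 \<le> card B" using b(4) by simp
  then obtain y1 y2 where y: "y1 \<in> B" "y2 \<in> B" "y1 \<noteq> y2" using ex_two by blast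
  obtain ys where ys: "set ys = B - {y1, y2}" "distinct ys" using finite_distinct_list[of "B - {y1, y2}"] b(7) by auto
  have lys: "length ys = card B - 2"
    using distinct_card[OF ys(2)] ys(1) y b(7) by (simp add: card_Diff_subset)
  \<comment> \<open>Each remaining column \<open>z\<close> of the blob yields one copy through
    \<open>v\<close>, whose edge from \<open>v\<close> to \<open>z\<close> lies neither in
    \<open>V\<close> nor in the copies for other columns.\<close>
  define X where "X z = K {v, a, a'} {y1, y2, z}" for z
  have XB: "X z \<in> XX" "X z \<subseteq> P" if "z \<in> set ys" for z
  proof -
    have z: "z \<in> B" "z \<noteq> y1" "z \<noteq> y2" using that ys by auto
    show "X z \<in> XX" unfolding X_def
    proof (rule XX_I)
      show "{v, a, a'} \<subseteq> {..<m}" "{y1, y2, z} \<subseteq> {..<n}" using a b(1,2) y z v by auto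
      show "card {v, a, a'} = 3" "card {y1, y2, z} = 3" using a y z by auto
    qed
    have "X z \<subseteq> K A B" unfolding X_def using a y z AB(2) by (intro K_mono) auto
    then show "X z \<subseteq> P" using b(5) by blast
  qed
  have new: "\<not> map X ys ! i \<subseteq> ?V \<union> (\<Union>j<i. map X ys ! j)" if i: "i < length (map X ys)" for i
  proof
    assume sub: "map X ys ! i \<subseteq> ?V \<union> (\<Union>j<i. map X ys ! j)"
    have i': "i < length ys" using i by simp
    have "edge v (ys ! i) \<in> map X ys ! i" using i' by (simp add: X_def)
    then have "edge v (ys ! i) \<in> ?V \<union> (\<Union>j<i. map X ys ! j)" using sub by blast
    moreover have "edge v (ys ! i) \<notin> ?V" by simp
    ultimately obtain j where j: "j < i" "edge v (ys ! i) \<in> map X ys ! j" by blast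
    then have "ys ! i \<in> {y1, y2, ys ! j}" using i' by (simp add: X_def)
    moreover have "ys ! i \<noteq> ys ! j" using ys(2) j i' by (simp add: nth_eq_iff_index_eq)
    moreover have "ys ! i \<in> B - {y1, y2}" using ys(1) nth_mem[OF i'] by simp
    ultimately show False by blast
  qed
  show ?thesis
  proof (intro exI[of _ ?V] exI[of _ "map X ys"] conjI)
    show "set (map X ys) \<subseteq> XX" using XB by auto
    show "\<Union>(set (map X ys)) \<subseteq> P" using XB by auto
    show "\<forall>i<length (map X ys). \<not> map X ys ! i \<subseteq> ?V \<union> (\<Union>j<i. map X ys ! j)" using new by blast
    show "wt P \<le> wt (P \<inter> ?V) + length (map X ys)" using w lys by simp
  qed (use c1 c2 fl in auto)
qed

lemma swap_filter: "{p \<in> prod.swap ` S. v \<in> fst p} = prod.swap ` {p \<in> S. v \<in> snd p}"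
  by auto

lemma peel:
  assumes P: "wclosed P" and one: "card {p \<in> Blobs P. v \<in> fst p} = 1 \<or> card {p \<in> Blobs P. v \<in> snd p} = 1"
  shows "\<exists>V T. isflat V \<and> wt P + null (P \<inter> V) \<le> wt (P \<inter> V) + null P \<and> card (P \<inter> V) + wt P + 2 \<le> card P + wt (P \<inter> V)
    \<and> set T \<subseteq> XX \<and> \<Union>(set T) \<subseteq> P \<and> (\<forall>i<length T. \<not> T ! i \<subseteq> V \<union> (\<Union>j<i. T ! j)) \<and> wt P \<le> wt (P \<inter> V) + length T"
  using one
proof
  assume "card {p \<in> Blobs P. v \<in> fst p} = 1"
  then show ?thesis by (rule peel_left[OF P])
next
  assume a: "card {p \<in> Blobs P. v \<in> snd p} = 1"
  interpret g: k33 "\<lambda>i j. edge j i" n m M by (rule swap)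
  have "card {p \<in> g.Blobs P. v \<in> fst p} = 1"
    unfolding swap_Blobs swap_filter using a by (simp add: card_image)
  then show ?thesis using g.peel_left[of P v] P by (simp add: swap_wclosed swap_wt swap_XX swap_E)
qed

section \<open>The nullity formula for flats\<close>

lemma wt_pos: "0 < wt P \<Longrightarrow> Blobs P \<noteq> {}"
  unfolding wt_def by auto

text \<open>If the star at \<open>v\<close> had full rank in \<open>P\<close>,
  \<open>star_spanning\<close> would rule out the violation. Otherwise its closure has smaller rank,
  so it lies in \<open>P\<close>, satisfies the formula, and \<open>local_count\<close>
  applies.\<close>

lemma violation_local:
  assumes F: "isflat F" and P: "wclosed P" "P \<subseteq> F"
    and c1: "\<And>Y. Y \<subseteq> P \<Longrightarrow> r Y < r P \<Longrightarrow> cls Y \<subseteq> P"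
    and IH: "\<And>G. isflat G \<Longrightarrow> r G < r P \<Longrightarrow> Dress G"
    and cD: "\<And>C D. (C, D) \<in> Blobs F \<Longrightarrow> Dress (P \<inter> K C D)"
    and viol: "null P < snull F P"
    and two: "2 \<le> card {p \<in> Blobs P. v \<in> fst p}"
  shows "(\<Sum>p\<in>{p \<in> Blobs P. v \<in> fst p}. card (snd p) - 2) + 3 \<le> card (\<Union>p\<in>{p \<in> Blobs P. v \<in> fst p}. snd p)"
proof -
  obtain x x' where s: "star_system P v x x'" using star_system_ex by blast
  let ?Y = "star_set P v x x'"
  have YP: "?Y \<subseteq> P" by (rule star_set_sub[OF s])
  have PE: "P \<subseteq> E" using P(1) unfolding wclosed_def by blast
  have YE: "?Y \<subseteq> E" using YP PE by blast
  have "{p \<in> Blobs P. v \<in> fst p} \<noteq> {}" using two by (metis card.empty not_numeral_le_zero)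
  then obtain p where "p \<in> Blobs P" "v \<in> fst p" by blast
  then have v: "v < m" using BlobsD(1)[of "fst p" "snd p" P] by auto
  have "r ?Y < r P"
  proof (rule ccontr)
    assume "\<not> r ?Y < r P"
    then have span: "P \<subseteq> cls ?Y" using sub_cl_of_rk_eq[OF YP PE] by simp
    have "snull F P \<le> null P"
    proof (rule star_spanning[OF flat_wclosed[OF F] P s v span])
      show "cls ?Y \<subseteq> F" using cl_sub_flat[OF F] YP P(2) by blast
      fix C D assume "(C, D) \<in> Blobs F" "0 < null (P \<inter> K C D)"
      then show "Blobs (P \<inter> K C D) \<noteq> {}" using cD[of C D] wt_pos unfolding Dress_def by simp
    qed
    then show False using viol by simp
  qed
  then show ?thesis
    using local_count[OF P(1) s refl two c1[OF YP]] IH[OF flat_cl[OF YE]] rk_cl[OF YE] by simp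
qed

lemma violation_local_right:
  assumes F: "isflat F" and P: "wclosed P" "P \<subseteq> F"
    and c1: "\<And>Y. Y \<subseteq> P \<Longrightarrow> r Y < r P \<Longrightarrow> cls Y \<subseteq> P"
    and IH: "\<And>G. isflat G \<Longrightarrow> r G < r P \<Longrightarrow> Dress G"
    and cD: "\<And>C D. (C, D) \<in> Blobs F \<Longrightarrow> Dress (P \<inter> K C D)"
    and viol: "null P < snull F P"
    and two: "2 \<le> card {p \<in> Blobs P. v \<in> snd p}"
  shows "(\<Sum>p\<in>{p \<in> Blobs P. v \<in> snd p}. card (fst p) - 2) + 3 \<le> card (\<Union>p\<in>{p \<in> Blobs P. v \<in> snd p}. fst p)"
proof -
  interpret g: k33 "\<lambda>i j. edge j i" n m M by (rule swap)
  have cD': "Dress (P \<inter> K D C)" if "(C, D) \<in> prod.swap ` Blobs F" for C D using cD[of D C] that by auto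
  have "(\<Sum>p\<in>{p \<in> g.Blobs P. v \<in> fst p}. card (snd p) - 2) + 3 \<le> card (\<Union>p\<in>{p \<in> g.Blobs P. v \<in> fst p}. snd p)"
  proof (rule g.violation_local[of F])
    show "2 \<le> card {p \<in> g.Blobs P. v \<in> fst p}"
      unfolding swap_Blobs swap_filter using two by (simp add: card_image)
  qed (use F P c1 IH cD' viol in \<open>simp_all add: swap_wclosed swap_E swap_Dress swap_snull swap_Blobs swap_K\<close>)
  then show ?thesis unfolding swap_Blobs swap_filter by (simp add: sum.reindex image_image)
qed

lemma dependent_rk:
  assumes A: "A \<subseteq> E" "A \<notin> M"
  shows "8 \<le> r A"
proof (rule ccontr)
  assume "\<not> 8 \<le> r A"
  then have rA: "r A < 8" by simp
  obtain I where I: "I \<in> M" "I \<subseteq> A" "card I = r A" using ex_basis[of A] by blast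
  have "\<not> A \<subseteq> I"
  proof
    assume "A \<subseteq> I"
    then have "A = I" using I(2) by simp
    then show False using I(1) A(2) by simp
  qed
  then obtain e where e: "e \<in> A" "e \<notin> I" by blast
  have c: "card (insert e I) = Suc (r A)" using e I fin_indep[OF I(1)] by simp
  have "insert e I \<in> M" using small_indep[of "insert e I"] c rA e I A(1) by auto
  then show False using card_le_rk[of "insert e I" A] c e I by auto
qed

lemma snull_flat:
  assumes F: "isflat F" and IH: "\<And>G. isflat G \<Longrightarrow> r G < k \<Longrightarrow> Dress G"
    and Q: "isflat Q" "Q \<subseteq> F" "r Q < k"
  shows "snull F Q = wt Q"
proof (rule snull_eq_wt[OF flat_wclosed[OF F] Q(2)])
  fix A B assume "(A, B) \<in> Blobs F"
  then have "isflat (K A B)" using flat_K[OF BlobsD(1,2)] by simp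
  then have "isflat (Q \<inter> K A B)" by (rule flat_Int[OF Q(1)])
  moreover have "r (Q \<inter> K A B) \<le> r Q" by (rule rk_mono) blast
  ultimately show "Dress (Q \<inter> K A B)" using IH Q(3) by simp
qed

text \<open>Among the violating sets of least rank, one of largest defect and then of largest size is closed
  under taking closures of subsets of smaller rank; this makes its traces on the blobs of \<open>F\<close> flats.\<close>

lemma snull_le_null:
  assumes F: "isflat F" and IH: "\<And>G. isflat G \<Longrightarrow> r G < r F \<Longrightarrow> Dress G" and P0: "P0 \<subseteq> F"
  shows "snull F P0 \<le> null P0"
proof (rule ccontr)
  assume bad0: "\<not> ?thesis"
  have FE: "F \<subseteq> E" using flat_sub[OF F] .
  have fF: "finite F" using fin_sub[OF FE] .
  have wF: "wclosed F" by (rule flat_wclosed[OF F])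
  let ?bad = "\<lambda>Q. Q \<subseteq> F \<and> null Q < snull F Q"
  have "?bad P0" using P0 bad0 by simp
  then obtain P1 where P1: "?bad P1" and min1: "\<And>Q. ?bad Q \<Longrightarrow> r P1 \<le> r Q"
    using ex_has_least_nat[of ?bad P0 r] by blast
  let ?S = "{Q. Q \<subseteq> F \<and> r Q = r P1}"
  have fS: "finite ?S" using fF by simp
  obtain P2 where P2: "P2 \<in> ?S" and max2: "\<forall>Q\<in>?S. snull F Q - null Q \<le> snull F P2 - null P2"
    using ex_max_nat[OF fS, of "\<lambda>Q. snull F Q - null Q"] P1 by blast
  let ?S' = "{Q \<in> ?S. snull F Q - null Q = snull F P2 - null P2}"
  have fS': "finite ?S'" by (rule finite_subset[OF _ fS]) blast
  have neS': "?S' \<noteq> {}" using P2 by blast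
  obtain P where P: "P \<in> ?S'" and max3: "\<forall>Q\<in>?S'. card Q \<le> card P"
    using ex_max_nat[OF fS' neS', of card] by blast
  have PF: "P \<subseteq> F" and rP: "r P = r P1" using P by auto
  have dP: "snull F P - null P = snull F P2 - null P2" using P by simp
  have "snull F P1 - null P1 \<le> snull F P2 - null P2" using max2 P1 by simp
  moreover have "null P1 < snull F P1" using P1 by blast
  ultimately have viol: "null P < snull F P" using dP by presburger
  have minr: "snull F Q \<le> null Q" if "Q \<subseteq> F" "r Q < r P" for Q
  proof (rule ccontr)
    assume "\<not> snull F Q \<le> null Q"
    then have "r P1 \<le> r Q" using min1[of Q] that by simp
    then show False using that rP by simp
  qed
  have maxd: "snull F Q - null Q \<le> snull F P - null P" if "Q \<subseteq> F" "r Q = r P" for Q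
    using max2 that rP dP by simp
  have maxc: "card Q \<le> card P" if "Q \<subseteq> F" "r Q = r P" "snull F Q - null Q = snull F P - null P" for Q
    using max3 that rP dP by simp
  have PE: "P \<subseteq> E" using PF FE by blast
  have fP: "finite P" using fin_sub[OF PE] .
  have rPF: "r P \<le> r F" using PF by (rule rk_mono)
  have IH': "Dress G" if "isflat G" "r G < r P" for G using IH[of G] that rPF by simp
  \<comment> \<open>The closure has equal \<open>snull\<close> and nullity, and its intersection
    with \<open>P\<close> is no violation by minimal rank. Supermodularity then gives the union with
    \<open>P\<close> at least the defect of \<open>P\<close> at the same rank, so maximal size
    forces it to be \<open>P\<close>.\<close>
  have c1: "cls Y \<subseteq> P" if Y: "Y \<subseteq> P" "r Y < r P" for Y
  proof -
    let ?Q = "cls Y"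
    have YE: "Y \<subseteq> E" using Y PE by blast
    have Q: "isflat ?Q" "?Q \<subseteq> F" "r ?Q = r Y"
      using flat_cl[OF YE] cl_sub_flat[OF F order_trans[OF Y(1) PF]] rk_cl[OF YE] by simp_all
    have fQ: "finite ?Q" using fin_sub[OF flat_sub[OF Q(1)]] .
    have sQ: "snull F ?Q = null ?Q"
      using snull_flat[OF F IH Q(1,2)] IH[OF Q(1)] Q(3) Y(2) rPF unfolding Dress_def by simp
    have "Y \<subseteq> P \<inter> ?Q" using Y sub_cl[OF YE] by blast
    then have rI: "r (P \<inter> ?Q) = r Y" using rk_mono[of Y "P \<inter> ?Q"] rk_mono[of "P \<inter> ?Q" ?Q] Q(3) by simp
    have sI: "snull F (P \<inter> ?Q) \<le> null (P \<inter> ?Q)" using minr[of "P \<inter> ?Q"] PF rI Y(2) by (simp add: le_infI1)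
    have rU: "r (P \<union> ?Q) = r P" using rk_sub_cl[of ?Q P] cl_mono[OF Y(1)] by simp
    have sup: "snull F P + snull F ?Q \<le> snull F (P \<union> ?Q) + snull F (P \<inter> ?Q)" using snull_supermod[OF fP fQ] .
    have card: "card P + card ?Q = card (P \<union> ?Q) + card (P \<inter> ?Q)" using card_Un_Int[OF fP fQ] .
    have n: "r P + null P = card P" "r ?Q + null ?Q = card ?Q" "r (P \<union> ?Q) + null (P \<union> ?Q) = card (P \<union> ?Q)"
      "r (P \<inter> ?Q) + null (P \<inter> ?Q) = card (P \<inter> ?Q)"
      using rk_null fP fQ by simp_all
    have ge: "snull F P + null (P \<union> ?Q) \<le> snull F (P \<union> ?Q) + null P"
      using sup card n rU rI sI sQ Q(3) by presburger
    have U: "P \<union> ?Q \<subseteq> F" using PF Q(2) by blast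
    have "snull F (P \<union> ?Q) - null (P \<union> ?Q) = snull F P - null P"
      using maxd[OF U rU] ge viol by presburger
    then have "card (P \<union> ?Q) \<le> card P" using maxc[OF U rU] by simp
    then have "P \<union> ?Q = P" using card_seteq[of "P \<union> ?Q" P] fP fQ by blast
    then show ?thesis by blast
  qed
  have star0: "null (P \<inter> K C' D') = 0" if bb: "(C, D) \<in> Blobs F" "(C', D') \<in> Blobs F" "(C, D) \<noteq> (C', D')" "P \<subseteq> K C D" for C D C' D'
  proof -
    have sub: "P \<inter> K C' D' \<subseteq> K (C \<inter> C') (D \<inter> D')" using bb(4) unfolding K_Int[symmetric] by blast
    have "\<exists>u<m. C \<inter> C' \<subseteq> {u}"
    proof (rule ccontr)
      assume no: "\<not> ?thesis"
      obtain u where u: "u \<in> C" using BlobsD(8)[OF bb(1)] by blast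
      then have "u < m" using BlobsD(1)[OF bb(1)] by blast
      then obtain u1 where u1: "u1 \<in> C \<inter> C'" using no by blast
      then have "u1 < m" using BlobsD(1)[OF bb(1)] by blast
      then obtain u2 where "u2 \<in> C \<inter> C'" "u2 \<noteq> u1" using no by blast
      then show False using Blobs_left_unique[OF wF bb(1,2), of u1 u2] u1 bb(3) by simp
    qed
    then obtain u where u: "u < m" "C \<inter> C' \<subseteq> {u}" by blast
    have "P \<inter> K C' D' \<subseteq> K {u} (D \<inter> D')" using sub K_mono[OF u(2) subset_refl] by blast
    moreover have "K {u} (D \<inter> D') \<in> M" using star_indep[OF u(1)] BlobsD(2)[OF bb(1)] by (simp add: le_infI1)
    ultimately have "P \<inter> K C' D' \<in> M" using indep_mono[of "K {u} (D \<inter> D')" "P \<inter> K C' D'"] by simp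
    then show ?thesis by (rule null_indep)
  qed
  \<comment> \<open>A trace of full rank would put \<open>P\<close> inside one blob. All other blobs
    then cut \<open>P\<close> in an independent star, so \<open>snull F P\<close> would equal
    \<open>null P\<close>.\<close>
  have c2: "r (P \<inter> K C D) < r P" if CD: "(C, D) \<in> Blobs F" for C D
  proof (rule ccontr)
    assume "\<not> ?thesis"
    then have "P \<subseteq> cls (P \<inter> K C D)" using sub_cl_of_rk_eq[of "P \<inter> K C D" P] PE by simp
    moreover have "isflat (K C D)" using flat_K[OF BlobsD(1,2)[OF CD]] .
    ultimately have PK: "P \<subseteq> K C D" using cl_sub_flat[of "K C D" "P \<inter> K C D"] by blast
    have "snull F P = (\<Sum>p\<in>Blobs F. null (P \<inter> K (fst p) (snd p)))" by (simp add: snull_def case_prod_beta)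
    also have "\<dots> = (\<Sum>p\<in>{(C, D)}. null (P \<inter> K (fst p) (snd p)))"
    proof (rule sum.mono_neutral_right[OF finite_Blobs])
      show "{(C, D)} \<subseteq> Blobs F" using CD by simp
      show "\<forall>p\<in>Blobs F - {(C, D)}. null (P \<inter> K (fst p) (snd p)) = 0"
        using star0[OF CD _ _ PK] by force
    qed
    also have "\<dots> = null P" using PK by (simp add: Int_absorb2)
    finally show False using viol by simp
  qed
  have fl: "isflat (P \<inter> K C D)" if CD: "(C, D) \<in> Blobs F" for C D
  proof -
    have "isflat (K C D)" using flat_K[OF BlobsD(1,2)[OF CD]] .
    then have "cls (P \<inter> K C D) \<subseteq> K C D" by (rule cl_sub_flat) blast
    moreover have "cls (P \<inter> K C D) \<subseteq> P" using c1[OF Int_lower1 c2[OF CD]] .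
    ultimately show ?thesis using PE unfolding flat_def by blast
  qed
  have cD: "Dress (P \<inter> K C D)" if CD: "(C, D) \<in> Blobs F" for C D using IH'[OF fl[OF CD] c2[OF CD]] .
  have sw: "snull F P = wt P" using snull_eq_wt[OF wF PF cD] .
  \<comment> \<open>A dependent trace has rank at least eight and, by \<open>c2\<close>, less than
    \<open>P\<close>. A K33 minus an edge then has smaller rank than \<open>P\<close>, so
    \<open>c1\<close> gives the saturation of \<open>P\<close>.\<close>
  have r9: "8 < r P"
  proof -
    have "\<exists>p\<in>Blobs F. null (P \<inter> K (fst p) (snd p)) \<noteq> 0"
    proof (rule ccontr)
      assume "\<not> ?thesis"
      then have "snull F P = 0" by (simp add: snull_def case_prod_beta)
      then show False using viol by simp
    qed
    then obtain C D where CD: "(C, D) \<in> Blobs F" "null (P \<inter> K C D) \<noteq> 0" by auto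
    then have "P \<inter> K C D \<notin> M" using null_indep[of "P \<inter> K C D"] by auto
    then have "8 \<le> r (P \<inter> K C D)" using dependent_rk[of "P \<inter> K C D"] PE by blast
    then show ?thesis using c2[OF CD(1)] by simp
  qed
  have wP: "wclosed P"
    unfolding wclosed_def
  proof (intro conjI ballI allI impI)
    fix X e assume X: "X \<in> XX" "X - {e} \<subseteq> P"
    show "X \<subseteq> P"
    proof (cases "e \<in> X")
      case True
      have "r (X - {e}) \<le> card (X - {e})" using finite_X[OF X(1)] by (intro rk_le_card) simp
      then have "r (X - {e}) < r P" using card_XX[OF X(1)] True r9 by simp
      then have "cls (X - {e}) \<subseteq> P" using c1[OF X(2)] by blast
      moreover have "e \<in> cls (X - {e})" using circuit_in_cl[OF circ[OF X(1)] True subset_refl] .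
      ultimately show ?thesis using X(2) by blast
    qed (use X in auto)
  qed (rule PE)
  have "Blobs P \<noteq> {}" using wt_pos viol sw by simp
  moreover have "null P \<le> wt P" using viol sw by simp
  ultimately have "(\<exists>v. card {p \<in> Blobs P. v \<in> fst p} = 1) \<or> (\<exists>v. card {p \<in> Blobs P. v \<in> snd p} = 1)"
  proof (rule private_vertex[OF PE])
    fix v
    show "(\<Sum>p\<in>{p \<in> Blobs P. v \<in> fst p}. card (snd p) - 2) + 3 \<le> card (\<Union>p\<in>{p \<in> Blobs P. v \<in> fst p}. snd p)"
      if "2 \<le> card {p \<in> Blobs P. v \<in> fst p}"
      by (rule violation_local[OF F wP PF c1 IH' cD viol that])
    show "(\<Sum>p\<in>{p \<in> Blobs P. v \<in> snd p}. card (fst p) - 2) + 3 \<le> card (\<Union>p\<in>{p \<in> Blobs P. v \<in> snd p}. fst p)"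
      if "2 \<le> card {p \<in> Blobs P. v \<in> snd p}"
      by (rule violation_local_right[OF F wP PF c1 IH' cD viol that])
  qed
  then obtain v where v: "card {p \<in> Blobs P. v \<in> fst p} = 1 \<or> card {p \<in> Blobs P. v \<in> snd p} = 1" by blast
  obtain V where V: "isflat V" "wt P + null (P \<inter> V) \<le> wt (P \<inter> V) + null P"
    "card (P \<inter> V) + wt P + 2 \<le> card P + wt (P \<inter> V)"
    using peel[OF wP v] by (elim exE conjE) (erule (2) that)
  let ?P = "P \<inter> V"
  have "snull F ?P = wt ?P"
  proof (rule snull_eq_wt[OF wF])
    show "?P \<subseteq> F" using PF by blast
    fix C D assume CD: "(C, D) \<in> Blobs F"
    have eq: "?P \<inter> K C D = (P \<inter> K C D) \<inter> V" by blast
    have "isflat (?P \<inter> K C D)" unfolding eq using flat_Int[OF fl[OF CD] V(1)] .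
    moreover have "r (?P \<inter> K C D) \<le> r (P \<inter> K C D)" by (rule rk_mono) blast
    ultimately show "Dress (?P \<inter> K C D)" using IH' c2[OF CD] by simp
  qed
  then have bad: "null ?P < snull F ?P" using V(2) viol sw by simp
  have le: "r ?P \<le> r P" by (rule rk_mono) blast
  have sub: "?P \<subseteq> F" using PF by blast
  \<comment> \<open>The peeled set still violates, so minimality fixes its rank. At equal rank the
    drop of \<open>card - wt\<close> by two becomes a defect larger by two, against the choice of
    \<open>P\<close>.\<close>
  have "r ?P = r P" using minr[OF sub] bad le by (meson le_neq_implies_less leD)
  then have "snull F ?P - null ?P \<le> snull F P - null P" using maxd[OF sub] by blast
  then have d: "wt ?P - null ?P \<le> wt P - null P" using sw \<open>snull F ?P = wt ?P\<close> by simp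
  have "r ?P + null ?P = card ?P" "r P + null P = card P" using rk_null fP by simp_all
  then have "null ?P + wt P + 2 \<le> null P + wt ?P" using V(3) \<open>r ?P = r P\<close> by simp
  moreover have "null P < wt P" using viol sw by simp
  ultimately show False using d by simp
qed

end

section \<open>Induction over flats and proper sequences of full length\<close>

context k33
begin

text \<open>If a flat \<open>F\<close> of rank \<open>k\<close> violated the formula, freeing it would give a matroid of rank
  \<open>k + 1\<close> above the truncation of \<open>M\<close> to rank \<open>k\<close> in which \<open>F\<close> has rank \<open>k + 1\<close>
  (a proper erection).\<close>

lemma Dress_step:
  assumes F: "isflat F" and IH: "\<And>G. isflat G \<Longrightarrow> r G < r F \<Longrightarrow> Dress G"
  shows "Dress F"
proof (rule ccontr)
  assume nD: "\<not> Dress F"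
  define k where "k = r F"
  have FE: "F \<subseteq> E" using flat_sub[OF F] .
  have fF: "finite F" using fin_sub[OF FE] .
  have star: "snull F P \<le> null P" if "P \<subseteq> F" for P using snull_le_null[OF F IH that] .
  have lt: "wt F < null F" using star[OF subset_refl] nD unfolding snull_self Dress_def by simp
  have "F \<notin> M" using null_indep[of F] lt by auto
  then have k8: "8 \<le> k" using dependent_rk[OF FE] unfolding k_def by blast
  \<comment> \<open>\<open>q A\<close> says that \<open>A\<close> extends within \<open>F\<close> to
    a set with \<rho> at most \<open>k\<close>; passing to supersets makes the condition
    hereditary.\<close>
  define q where "q A \<longleftrightarrow> (\<exists>U. A \<subseteq> U \<and> U \<subseteq> F \<and> card U \<le> k + snull F U)" for A
  \<comment> \<open>Ranks below \<open>k\<close> are kept and ranks above \<open>k\<close> are cut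
    to \<open>k + 1\<close>. Among sets of rank \<open>k\<close>, only those inside \<open>F\<close>
    that fail \<open>q\<close> are raised.\<close>
  define f where "f A = (if r A < k then r A else if r A = k \<and> (A \<subseteq> F \<longrightarrow> q A) then k else Suc k)" for A
  have f_lt: "f A = r A" if "r A < k" for A using that by (simp add: f_def)
  have f_ge: "k \<le> f A" if "k \<le> r A" for A using that by (simp add: f_def)
  have f_le: "f A \<le> Suc k" for A by (simp add: f_def)
  have f_eq: "f A = k \<longleftrightarrow> r A = k \<and> (A \<subseteq> F \<longrightarrow> q A)" for A by (simp add: f_def)
  have q_mono: "q A" if "q B" "A \<subseteq> B" for A B using that unfolding q_def by (meson order_trans)
  \<comment> \<open>The closure of \<open>A\<close> satisfies the formula by induction, so \<rho>
    equals its rank \<open>k - 1\<close>, and one further element brings \<rho> to at most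
    \<open>k\<close>.\<close>
  have q_new: "q (insert x A)" if A: "insert x A \<subseteq> F" "r A < k" "r (insert x A) = k" for A x
  proof -
    have AE: "A \<subseteq> E" using A FE by blast
    have fl: "isflat (cls A)" using flat_cl[OF AE] .
    have clF: "cls A \<subseteq> F" using cl_sub_flat[OF F] A(1) by simp
    have rA: "Suc (r A) = k" using A rk_insert_le[of x A] by simp
    have fc: "finite (cls A)" using fin_sub[OF cl_sub] .
    have "null (cls A) = snull F (cls A)"
      using snull_flat[OF F IH fl clF] IH[OF fl] rk_cl[OF AE] A(2) unfolding k_def Dress_def by simp
    then have "card (cls A) = r A + snull F (cls A)" using rk_null[OF fc] rk_cl[OF AE] by simp
    moreover have "snull F (cls A) \<le> snull F (insert x (cls A))" using fc by (intro snull_mono) auto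
    moreover have "card (insert x (cls A)) \<le> Suc (card (cls A))" using fc by (simp add: card_insert_if)
    ultimately have "card (insert x (cls A)) \<le> k + snull F (insert x (cls A))" using rA by simp
    moreover have "insert x A \<subseteq> insert x (cls A)" using sub_cl[OF AE] by blast
    moreover have "insert x (cls A) \<subseteq> F" using clF A by blast
    ultimately show ?thesis unfolding q_def by blast
  qed
  have up: "f A \<le> f (insert x A)" if A: "A \<subseteq> E" "x \<in> E" for A x
  proof (cases "r A < k")
    case True
    then show ?thesis using f_lt[of A] f_lt[of "insert x A"] f_ge[of "insert x A"] rk_insert_ge[of A x]
      by (cases "r (insert x A) < k") simp_all
  next
    case False
    then have ge: "k \<le> r (insert x A)" using rk_insert_ge[of A x] by simp
    show ?thesis
    proof (cases "f (insert x A) = k")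
      case True
      then have rx: "r (insert x A) = k" and qx: "insert x A \<subseteq> F \<longrightarrow> q (insert x A)" using f_eq[of "insert x A"] by simp_all
      have rA: "r A = k" using False rx rk_insert_ge[of A x] by simp
      have "q A" if AF: "A \<subseteq> F"
      proof -
        have "x \<in> cls A" using A rx rA by (simp add: cl_def)
        then have "insert x A \<subseteq> F" using cl_sub_flat[OF F AF] AF by blast
        then show ?thesis using qx q_mono[of "insert x A" A] by blast
      qed
      then have "f A = k" using f_eq[of A] rA by simp
      then show ?thesis using True by simp
    next
      case False
      then show ?thesis using f_ge[OF ge] f_le[of "insert x A"] f_le[of A] by simp
    qed
  qed
  have unit: "f (insert x A) \<le> Suc (f A)" if A: "A \<subseteq> E" "x \<in> E" for A x
  proof (cases "r A < k")
    case True
    show ?thesis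
    proof (cases "r (insert x A) < k")
      case False
      then have "r (insert x A) = k" using True rk_insert_le[of x A] by simp
      moreover from this have "f (insert x A) = k" using q_new[of x A] True f_eq[of "insert x A"] by simp
      ultimately show ?thesis using f_lt[OF True] rk_insert_le[of x A] by simp
    qed (use True f_lt rk_insert_le[of x A] in simp)
  next
    case False
    then show ?thesis using f_ge[of A] f_le[of "insert x A"] by simp
  qed
  have loc: "f (insert x (insert y A)) = f A"
    if A: "A \<subseteq> E" "x \<in> E" "y \<in> E" and fx: "f (insert x A) = f A" and fy: "f (insert y A) = f A" for A x y
  proof -
    have both: "r (insert x (insert y A)) = r A" if "r (insert x A) = r A" "r (insert y A) = r A"
    proof -
      have "{x, y} \<subseteq> cls A" using that A by (simp add: cl_def)
      then have "r (A \<union> {x, y}) = r A" by (rule rk_sub_cl)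
      then show ?thesis by (simp add: insert_commute)
    qed
    have lt_iff: "r B < k \<longleftrightarrow> f B < k" for B using f_lt[of B] f_ge[of B] by (cases "r B < k") auto
    consider "f A < k" | "f A = k" | "f A = Suc k" using f_le[of A] by linarith
    then show ?thesis
    proof cases
      case 1
      then have "r A < k" "r (insert x A) < k" "r (insert y A) < k" using lt_iff fx fy by simp_all
      then have "r (insert x A) = r A" "r (insert y A) = r A"
        using f_lt[of A] f_lt[of "insert x A"] f_lt[of "insert y A"] fx fy by simp_all
      then have "r (insert x (insert y A)) = r A" by (rule both)
      then show ?thesis using f_lt[of A] f_lt[of "insert x (insert y A)"] \<open>r A < k\<close> by simp
    next
      case 2
      then have rr: "r A = k" "r (insert x A) = k" "r (insert y A) = k" using f_eq[of A] f_eq[of "insert x A"] f_eq[of "insert y A"] fx fy by simp_all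
      have rxy: "r (insert x (insert y A)) = k" using both rr by simp
      have "q (insert x (insert y A))" if S: "insert x (insert y A) \<subseteq> F"
      proof -
        have "q (insert x A)" "q (insert y A)" using f_eq[of "insert x A"] f_eq[of "insert y A"] fx fy 2 S by auto
        then obtain U1 U2 where U1: "insert x A \<subseteq> U1" "U1 \<subseteq> F" "card U1 \<le> k + snull F U1"
          and U2: "insert y A \<subseteq> U2" "U2 \<subseteq> F" "card U2 \<le> k + snull F U2" unfolding q_def by blast
        have fU: "finite U1" "finite U2" using U1 U2 fF finite_subset by blast+
        \<comment> \<open>The intersection contains \<open>A\<close>, so it has rank
          \<open>k\<close> and thus \<rho> at least \<open>k\<close>; submodularity leaves \<rho> at
          most \<open>k\<close> for the union, which witnesses \<open>q\<close>.\<close>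
        have "A \<subseteq> U1 \<inter> U2" "U1 \<inter> U2 \<subseteq> F" using U1 U2 by blast+
        then have "r (U1 \<inter> U2) = k" using rk_mono[of A "U1 \<inter> U2"] rk_mono[of "U1 \<inter> U2" F] rr k_def by simp
        then have "k + snull F (U1 \<inter> U2) \<le> card (U1 \<inter> U2)"
          using star[of "U1 \<inter> U2"] \<open>U1 \<inter> U2 \<subseteq> F\<close> rk_null[of "U1 \<inter> U2"] fU by simp
        moreover have "snull F U1 + snull F U2 \<le> snull F (U1 \<union> U2) + snull F (U1 \<inter> U2)"
          using snull_supermod[OF fU] .
        moreover have "card U1 + card U2 = card (U1 \<union> U2) + card (U1 \<inter> U2)" using card_Un_Int[OF fU] .
        ultimately have "card (U1 \<union> U2) \<le> k + snull F (U1 \<union> U2)" using U1(3) U2(3) by presburger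
        moreover have "insert x (insert y A) \<subseteq> U1 \<union> U2" "U1 \<union> U2 \<subseteq> F" using U1 U2 by blast+
        ultimately show ?thesis unfolding q_def by blast
      qed
      then have "f (insert x (insert y A)) = k" using f_eq[of "insert x (insert y A)"] rxy by simp
      then show ?thesis using 2 by simp
    next
      case 3
      then have "Suc k \<le> f (insert x (insert y A))" using up[of "insert y A" x] A fy by simp
      then show ?thesis using f_le[of "insert x (insert y A)"] 3 by simp
    qed
  qed
  have f0: "f {} = 0" using rk_indep[OF empty_indep] k8 by (simp add: f_def)
  let ?N = "{I. I \<subseteq> E \<and> f I = card I}"
  have N1: "matroid_on E ?N" by (rule matroid_of_rank(1)[OF finite_E f0 up unit loc])
  have N2: "rk ?N A = f A" if "A \<subseteq> E" for A by (rule matroid_of_rank(2)[OF finite_E f0 up unit loc that])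
  have XN: "circuit E ?N X" if X: "X \<in> XX" for X
  proof (rule circuitI[OF N1 XX_sub_E[OF X]])
    note XE = XX_sub_E[OF X] and cX = card_XX[OF X] and fX = finite_X[OF X]
    have c: "circuit E M X" using circ[OF X] .
    have XM: "X \<notin> M" using c by (simp add: circuit_def)
    have re: "r (X - {e}) = 8" if "e \<in> X" for e
    proof -
      have "X - {e} \<subset> X" using that by blast
      then have "X - {e} \<in> M" using c by (simp add: circuit_def)
      then show ?thesis using rk_indep[of "X - {e}"] that cX fX by simp
    qed
    have "X \<noteq> {}" using cX by auto
    then obtain e0 where e0: "e0 \<in> X" by blast
    have "r X \<noteq> 9" using indep_iff[OF XE] XM cX by simp
    then have rX: "r X = 8" using rk_le_card[OF fX] cX rk_mono[of "X - {e0}" X] re[OF e0] by simp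
    \<comment> \<open>At \<open>k = 8\<close> a copy of K33 sits on the threshold. It lies in a blob
      of \<open>F\<close>, which accounts for its nullity one, so \<rho> is at most 9 - 1 =
      8.\<close>
    have qX: "q X" if "X \<subseteq> F" "k = 8"
    proof -
      obtain A B where AB: "X = K A B" "A \<subseteq> {..<m}" "B \<subseteq> {..<n}" "card A = 3" "card B = 3"
        using X unfolding XX_def by blast
      obtain C D where CD: "(C, D) \<in> Blobs F" "A \<subseteq> C" "B \<subseteq> D"
        using Blobs_ex[of A B F] AB \<open>X \<subseteq> F\<close> by auto
      have "X \<inter> K C D = X" using AB(1) K_mono[OF CD(2,3)] by blast
      moreover have "null X = 1" using rk_null[OF fX] rX cX by simp
      ultimately have "1 = null (X \<inter> K (fst (C, D)) (snd (C, D)))" by simp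
      also have "\<dots> \<le> (\<Sum>p\<in>Blobs F. null (X \<inter> K (fst p) (snd p)))"
        using finite_Blobs CD(1) by (intro member_le_sum) auto
      also have "\<dots> = snull F X" by (simp add: snull_def case_prod_beta)
      finally have "1 \<le> snull F X" .
      then have "card X \<le> k + snull F X" using cX that(2) by simp
      then show ?thesis unfolding q_def using that(1) by blast
    qed
    have fX8: "f X = 8"
    proof (cases "k = 8")
      case True
      then show ?thesis using f_eq[of X] rX qX by simp
    next
      case False
      then show ?thesis using f_lt[of X] rX k8 by simp
    qed
    then show "X \<notin> ?N" using cX by simp
    fix e assume e: "e \<in> X"
    have "f (X - {e}) = 8"
    proof (cases "k = 8")
      case True
      have "q (X - {e})" if "X - {e} \<subseteq> F"
      proof -
        have "e \<in> cls F" using circuit_in_cl[OF c e that] .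
        then have "X \<subseteq> F" using F that unfolding flat_def by blast
        then show ?thesis using qX True q_mono[of X "X - {e}"] by blast
      qed
      then show ?thesis using f_eq[of "X - {e}"] re[OF e] True by simp
    next
      case False
      then show ?thesis using f_lt[of "X - {e}"] re[OF e] k8 by simp
    qed
    then show "X - {e} \<in> ?N" using cX e fX XE by auto
  qed
  have NM: "?N \<subseteq> M" using greatest[OF N1 XN] .
  interpret N: matroid E ?N using N1 by unfold_locales
  \<comment> \<open>Only \<open>F\<close> itself could witness \<open>q F\<close>, and that would
    mean \<open>null F \<le> wt F\<close>. Hence \<open>f\<close> raises the rank of
    \<open>F\<close>, against \<open>NM\<close>.\<close>
  have "\<not> q F"
  proof
    assume "q F"
    then have "card F \<le> k + snull F F" unfolding q_def by (metis subset_antisym)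
    then show False using lt rk_null[OF fF] unfolding snull_self k_def by simp
  qed
  then have "f F = Suc k" using f_def[of F] k_def by simp
  then have "rk ?N F = Suc k" using N2[OF FE] by simp
  then obtain I where I: "I \<in> ?N" "I \<subseteq> F" "card I = Suc k" using N.ex_basis[of F] by auto
  then have "I \<in> M" using NM by blast
  then have "Suc k \<le> r F" using card_le_rk[of I F] I by simp
  then show False unfolding k_def by simp
qed

theorem Dress_flat: "isflat F \<Longrightarrow> Dress F"
proof (induction "r F" arbitrary: F rule: less_induct)
  case less
  show ?case by (rule Dress_step[OF less.prems less.hyps])
qed

lemma flat_local:
  assumes F: "isflat F" and two: "2 \<le> card {p \<in> Blobs F. v \<in> fst p}"
  shows "(\<Sum>p\<in>{p \<in> Blobs F. v \<in> fst p}. card (snd p) - 2) + 3 \<le> card (\<Union>p\<in>{p \<in> Blobs F. v \<in> fst p}. snd p)"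
proof -
  obtain x x' where s: "star_system F v x x'" using star_system_ex by blast
  have Y: "star_set F v x x' \<subseteq> F" by (rule star_set_sub[OF s])
  have "star_set F v x x' \<subseteq> E" using Y flat_sub[OF F] by blast
  then show ?thesis
    using local_count[OF flat_wclosed[OF F] s refl two cl_sub_flat[OF F Y]] Dress_flat flat_cl by blast
qed

lemma flat_local_right:
  assumes F: "isflat F" and two: "2 \<le> card {p \<in> Blobs F. v \<in> snd p}"
  shows "(\<Sum>p\<in>{p \<in> Blobs F. v \<in> snd p}. card (fst p) - 2) + 3 \<le> card (\<Union>p\<in>{p \<in> Blobs F. v \<in> snd p}. fst p)"
proof -
  interpret g: k33 "\<lambda>i j. edge j i" n m M by (rule swap)
  have "(\<Sum>p\<in>{p \<in> g.Blobs F. v \<in> fst p}. card (snd p) - 2) + 3 \<le> card (\<Union>p\<in>{p \<in> g.Blobs F. v \<in> fst p}. snd p)"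
  proof (rule g.flat_local)
    show "2 \<le> card {p \<in> g.Blobs F. v \<in> fst p}"
      unfolding swap_Blobs swap_filter using two by (simp add: card_image)
  qed (use F in \<open>simp add: swap_E\<close>)
  then show ?thesis unfolding swap_Blobs swap_filter by (simp add: sum.reindex image_image)
qed

text \<open>A vertex lying in one blob is removed, and the copies of K33 recorded by
  \<open>peel\<close> are appended to a sequence for the smaller flat. That sequence stays in
  \<open>V\<close>, so the appended copies remain proper, and they make up for the lost weight,
  which for flats is the nullity.\<close>

lemma flat_seq:
  "isflat F \<Longrightarrow> \<exists>S. set S \<subseteq> XX \<and> \<Union>(set S) \<subseteq> F \<and> (\<forall>i<length S. \<not> S ! i \<subseteq> (\<Union>j<i. S ! j)) \<and> null F \<le> length S"
proof (induction "card F" arbitrary: F rule: less_induct)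
  case less
  note F = less.prems
  have FE: "F \<subseteq> E" using flat_sub[OF F] .
  have fF: "finite F" using fin_sub[OF FE] .
  have nF: "null F = wt F" using Dress_flat[OF F] unfolding Dress_def .
  show ?case
  proof (cases "Blobs F = {}")
    case True
    then have "null F = 0" using nF by (simp add: wt_def)
    then show ?thesis by (intro exI[of _ "[]"]) simp
  next
    case False
    obtain v where v: "card {p \<in> Blobs F. v \<in> fst p} = 1 \<or> card {p \<in> Blobs F. v \<in> snd p} = 1"
      using private_vertex[OF FE False _ flat_local[OF F] flat_local_right[OF F]] nF by auto
    obtain V T where V: "isflat V" "card (F \<inter> V) + wt F + 2 \<le> card F + wt (F \<inter> V)"
      and T: "set T \<subseteq> XX" "\<Union>(set T) \<subseteq> F" "\<forall>i<length T. \<not> T ! i \<subseteq> V \<union> (\<Union>j<i. T ! j)" "wt F \<le> wt (F \<inter> V) + length T"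
      using peel[OF flat_wclosed[OF F] v] by (elim exE conjE) (erule (5) that)
    have fl: "isflat (F \<inter> V)" using flat_Int[OF F V(1)] .
    have nV: "null (F \<inter> V) = wt (F \<inter> V)" using Dress_flat[OF fl] unfolding Dress_def .
    have "null (F \<inter> V) \<le> null F" using fF by (intro null_mono) auto
    then have "card (F \<inter> V) < card F" using V(2) nF nV by simp
    then obtain S where S: "set S \<subseteq> XX" "\<Union>(set S) \<subseteq> F \<inter> V" "\<forall>i<length S. \<not> S ! i \<subseteq> (\<Union>j<i. S ! j)" "null (F \<inter> V) \<le> length S"
      using less.hyps[OF _ fl] by blast
    have "\<not> (S @ T) ! i \<subseteq> (\<Union>j<i. (S @ T) ! j)" if i: "i < length (S @ T)" for i
    proof (cases "i < length S")
      case True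
      then have "(\<Union>j<i. (S @ T) ! j) = (\<Union>j<i. S ! j)" by (intro SUP_cong) (auto simp: nth_append)
      then show ?thesis using S(3) True by (simp add: nth_append)
    next
      case False
      define i' where "i' = i - length S"
      have i': "i = length S + i'" "i' < length T" using False i by (simp_all add: i'_def)
      have "(S @ T) ! j \<subseteq> V \<union> (\<Union>j<i'. T ! j)" if "j < i" for j
      proof (cases "j < length S")
        case True
        then have "S ! j \<subseteq> V" using S(2) nth_mem[OF True] by blast
        then show ?thesis using True by (auto simp: nth_append)
      next
        case False
        then have "j - length S < i'" using that i' by simp
        then show ?thesis using False by (auto simp: nth_append)
      qed
      then have "(\<Union>j<i. (S @ T) ! j) \<subseteq> V \<union> (\<Union>j<i'. T ! j)" by blast
      moreover have "\<not> (S @ T) ! i \<subseteq> V \<union> (\<Union>j<i'. T ! j)" using T(3) i' by simp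
      ultimately show ?thesis by (meson order_trans)
    qed
    moreover have "null F \<le> length (S @ T)" using T(4) S(4) nF nV by simp
    moreover have "set (S @ T) \<subseteq> XX" "\<Union>(set (S @ T)) \<subseteq> F" using S(1,2) T(1,2) by auto
    ultimately show ?thesis by blast
  qed
qed

end

section \<open>Rank functions and val\<close>

context grid
begin

text \<open>Each new member is a circuit not contained in the union so far, so it increases the
  nullity by at least one.\<close>

lemma proper_seq_null:
  assumes N: "xmat N" and S: "proper_seq XX S"
  shows "length S \<le> nul N (\<Union>(set S))" "\<Union>(set S) \<subseteq> E"
proof -
  interpret N: matroid E N using N unfolding xmat_def by unfold_locales simp
  have SX: "S ! i \<in> XX" if "i < length S" for i using S nth_mem[OF that] unfolding proper_seq_def by blast
  have sub: "(\<Union>j<k. S ! j) \<subseteq> E" if "k \<le> length S" for k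
  proof (rule UN_least)
    fix j assume "j \<in> {..<k}"
    then show "S ! j \<subseteq> E" using SX[of j] XX_sub_E that by simp
  qed
  have "k \<le> nul N (\<Union>j<k. S ! j)" if "k \<le> length S" for k
    using that
  proof (induction k)
    case (Suc k)
    \<comment> \<open>\<open>proper_seq\<close> puts no condition on the first member; it escapes
      the empty union because it has nine edges.\<close>
    have "S ! k \<noteq> {}" using card_XX[OF SX[of k]] Suc.prems by auto
    then have "\<not> S ! k \<subseteq> (\<Union>j<k. S ! j)"
      using S Suc.prems unfolding proper_seq_def by (cases k) auto
    moreover have "circuit E N (S ! k)" using N SX[of k] Suc.prems unfolding xmat_def by simp
    ultimately have "Suc (nul N (\<Union>j<k. S ! j)) \<le> nul N ((\<Union>j<k. S ! j) \<union> S ! k)"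
      using N.null_circuit_Un[of "S ! k" "\<Union>j<k. S ! j"] sub[of k] Suc.prems by simp
    moreover have "(\<Union>j<Suc k. S ! j) = (\<Union>j<k. S ! j) \<union> S ! k" by (auto simp: lessThan_Suc)
    ultimately show ?case using Suc by simp
  qed simp
  moreover have eq: "\<Union>(set S) = (\<Union>j<length S. S ! j)" by (auto simp: set_conv_nth)
  ultimately show "length S \<le> nul N (\<Union>(set S))" by simp
  show "\<Union>(set S) \<subseteq> E" unfolding eq by (rule sub) simp
qed

lemma rk_le_val_seq:
  assumes N: "xmat N" and S: "proper_seq XX S" and A: "A \<subseteq> E"
  shows "int (rk N A) \<le> val_seq A S"
proof -
  interpret N: matroid E N using N unfolding xmat_def by unfold_locales simp
  note s = proper_seq_null[OF N S]
  have f: "finite (A \<union> \<Union>(set S))" using N.fin_sub A s(2) by blast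
  have "nul N (\<Union>(set S)) \<le> nul N (A \<union> \<Union>(set S))" using f by (intro N.null_mono) auto
  moreover have "rk N A \<le> rk N (A \<union> \<Union>(set S))" by (rule N.rk_mono) auto
  ultimately show ?thesis using N.rk_null[OF f] s(1) unfolding val_seq_def by linarith
qed

lemma proper_Nil: "proper_seq XX []" by (simp add: proper_seq_def)

text \<open>This makes the \<open>Min\<close> in \<open>val_min\<close> meaningful. The lower bound
  on the values is the rank in the uniform matroid of rank eight.\<close>

lemma finite_vals:
  assumes A: "A \<subseteq> E"
  shows "finite {val_seq A S | S. proper_seq XX S}"
proof (rule finite_subset)
  show "{val_seq A S | S. proper_seq XX S} \<subseteq> {0..int (card E)}"
  proof
    fix x assume "x \<in> {val_seq A S | S. proper_seq XX S}"
    then obtain S where S: "x = val_seq A S" "proper_seq XX S" by blast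
    have "0 \<le> x" using rk_le_val_seq[OF xmat_uniform S(2) A] S(1) by simp
    moreover have "card (A \<union> \<Union>(set S)) \<le> card E"
      using A proper_seq_null(2)[OF xmat_uniform S(2)] finite_E by (intro card_mono) auto
    ultimately show "x \<in> {0..int (card E)}" using S(1) unfolding val_seq_def by simp
  qed
qed simp

lemma val_le: "A \<subseteq> E \<Longrightarrow> proper_seq XX S \<Longrightarrow> val_min XX A \<le> val_seq A S"
  unfolding val_min_def using finite_vals by (intro Min_le) auto

lemma val_ex:
  assumes "A \<subseteq> E"
  shows "\<exists>S. proper_seq XX S \<and> val_min XX A = val_seq A S"
proof -
  have "val_min XX A \<in> {val_seq A S | S. proper_seq XX S}"
    unfolding val_min_def using finite_vals[OF assms] proper_Nil by (intro Min_in) auto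
  then show ?thesis by blast
qed

lemma rk_le_val:
  assumes "xmat N" "A \<subseteq> E"
  shows "int (rk N A) \<le> val_min XX A"
  using val_ex[OF assms(2)] rk_le_val_seq[OF assms(1) _ assms(2)] by auto

text \<open>Submodularity makes \<open>val_min\<close> a matroid rank function. The sequence
  \<open>[X]\<close> gives a copy of K33 value at most 8, and the uniform matroid keeps the value of
  its eight-element subsets at 8. The rank in any K33-matroid is at most \<open>val_min\<close>, so
  sets independent there are independent here.\<close>

lemma greatest_of_submodular:
  assumes sub: "submodular_on E (val_min XX)"
  shows "\<exists>M. xmat M \<and> (\<forall>N. xmat N \<longrightarrow> N \<subseteq> M)"
proof -
  define f where "f A = nat (val_min XX A)" for A
  have pos: "0 \<le> val_min XX A" if "A \<subseteq> E" for A using rk_le_val[OF xmat_uniform that] by simp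
  have card: "val_min XX A \<le> int (card A)" if "A \<subseteq> E" for A
    using val_le[OF that proper_Nil] by (simp add: val_seq_def)
  have seq: "val_seq A S \<le> val_seq (insert x A) S \<and> val_seq (insert x A) S \<le> val_seq A S + 1"
    if "A \<subseteq> E" "proper_seq XX S" for A x S
  proof -
    have "finite (A \<union> \<Union>(set S))"
      using that proper_seq_null(2)[OF xmat_uniform that(2)] finite_E finite_subset[of _ E] by simp
    then show ?thesis unfolding val_seq_def by (simp add: card_insert_if)
  qed
  have up: "val_min XX A \<le> val_min XX (insert x A)" if a: "A \<subseteq> E" "x \<in> E" for A x
  proof -
    obtain S where S: "proper_seq XX S" "val_min XX (insert x A) = val_seq (insert x A) S"
      using val_ex[of "insert x A"] a by auto
    show ?thesis using val_le[OF a(1) S(1)] seq[OF a(1) S(1), of x] S(2) by linarith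
  qed
  have unit: "val_min XX (insert x A) \<le> val_min XX A + 1" if a: "A \<subseteq> E" "x \<in> E" for A x
  proof -
    obtain S where S: "proper_seq XX S" "val_min XX A = val_seq A S" using val_ex[OF a(1)] by auto
    have "insert x A \<subseteq> E" using a by simp
    then show ?thesis using val_le[OF _ S(1), of "insert x A"] seq[OF a(1) S(1), of x] S(2) by linarith
  qed
  have loc: "val_min XX (insert x (insert y A)) = val_min XX A"
    if A: "A \<subseteq> E" "x \<in> E" "y \<in> E" and eq: "val_min XX (insert x A) = val_min XX A" "val_min XX (insert y A) = val_min XX A" for A x y
  proof -
    have "insert x A \<subseteq> E \<and> insert y A \<subseteq> E" using A by simp
    then have "val_min XX (insert x A \<union> insert y A) + val_min XX (insert x A \<inter> insert y A)
      \<le> val_min XX (insert x A) + val_min XX (insert y A)"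
      using sub unfolding submodular_on_def by blast
    moreover have "insert x A \<union> insert y A = insert x (insert y A)" by blast
    moreover have "val_min XX A \<le> val_min XX (insert x A \<inter> insert y A)"
    proof (cases "x = y")
      case True
      then show ?thesis using up A by simp
    next
      case False
      then have "insert x A \<inter> insert y A = A" by blast
      then show ?thesis by simp
    qed
    moreover have "val_min XX A \<le> val_min XX (insert x (insert y A))"
      using up[of "insert y A" x] eq A by simp
    ultimately show ?thesis using eq by simp
  qed
  let ?M = "{I. I \<subseteq> E \<and> f I = card I}"
  have v0: "val_min XX {} = 0" using pos[of "{}"] card[of "{}"] by simp
  have mat: "matroid_on E ?M"
  proof (rule matroid_of_rank(1)[OF finite_E])
    show "f {} = 0" using v0 by (simp add: f_def)
    show "f A \<le> f (insert x A)" if "A \<subseteq> E" "x \<in> E" for A x using up[OF that] by (simp add: f_def nat_mono)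
    show "f (insert x A) \<le> Suc (f A)" if "A \<subseteq> E" "x \<in> E" for A x using unit[OF that] pos[OF that(1)] by (simp add: f_def)
    show "f (insert x (insert y A)) = f A"
      if "A \<subseteq> E" "x \<in> E" "y \<in> E" "f (insert x A) = f A" "f (insert y A) = f A" for A x y
    proof -
      have "insert x A \<subseteq> E" "insert y A \<subseteq> E" using that by simp_all
      then have "val_min XX (insert x A) = val_min XX A" "val_min XX (insert y A) = val_min XX A"
        using that(4,5) pos[OF that(1)] pos[of "insert x A"] pos[of "insert y A"] by (simp_all add: f_def)
      then show ?thesis using loc[OF that(1-3)] by (simp add: f_def)
    qed
  qed
  have "circuit E ?M X" if X: "X \<in> XX" for X
  proof (rule circuitI[OF mat XX_sub_E[OF X]])
    note XE = XX_sub_E[OF X] and c = card_XX[OF X] and fX = finite_X[OF X]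
    have "proper_seq XX [X]" using X by (simp add: proper_seq_def)
    from val_le[OF XE this] have "val_min XX X \<le> 8" using c by (simp add: val_seq_def)
    then show "X \<notin> ?M" using c by (auto simp: f_def)
    fix e assume e: "e \<in> X"
    have sE: "X - {e} \<subseteq> E" using XE by blast
    have c8: "card (X - {e}) = 8" using c e fX by simp
    interpret U: matroid E "{I. I \<subseteq> E \<and> card I \<le> 8}" using xmat_uniform unfolding xmat_def by unfold_locales simp
    have "X - {e} \<in> {I. I \<subseteq> E \<and> card I \<le> 8}" using sE c8 by simp
    then have "8 \<le> val_min XX (X - {e})" using rk_le_val[OF xmat_uniform sE] U.rk_indep c8 by simp
    then have "val_min XX (X - {e}) = 8" using card[OF sE] c8 by simp
    then show "X - {e} \<in> ?M" using sE c8 by (simp add: f_def)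
  qed
  then have "xmat ?M" using mat by (simp add: xmat_def)
  moreover have "N \<subseteq> ?M" if N: "xmat N" for N
  proof
    fix I assume I: "I \<in> N"
    interpret N: matroid E N using N unfolding xmat_def by unfold_locales simp
    have IE: "I \<subseteq> E" using N.indep_sub[OF I] .
    then have "val_min XX I = int (card I)" using rk_le_val[OF N IE] N.rk_indep[OF I] card[OF IE] by simp
    then show "I \<in> ?M" using IE by (simp add: f_def)
  qed
  ultimately show ?thesis by blast
qed

end

text \<open>The sequence for the closure of \<open>A\<close> serves \<open>A\<close> too: it stays
  inside the closure and is at least as long as the closure's nullity.\<close>

lemma (in k33) val_eq_rk:
  assumes A: "A \<subseteq> E"
  shows "val_min XX A = int (r A)"
proof (rule order_antisym)
  have xm: "xmat M" using mat circ by (simp add: xmat_def)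
  show "int (r A) \<le> val_min XX A" by (rule rk_le_val[OF xm A])
  have fl: "isflat (cls A)" by (rule flat_cl[OF A])
  obtain S where S: "set S \<subseteq> XX" "\<Union>(set S) \<subseteq> cls A" "\<forall>i<length S. \<not> S ! i \<subseteq> (\<Union>j<i. S ! j)" "null (cls A) \<le> length S"
    using flat_seq[OF fl] by blast
  have pr: "proper_seq XX S" using S(1,3) by (simp add: proper_seq_def)
  have fin: "finite (cls A)" using fin_sub[OF cl_sub] .
  have "card (A \<union> \<Union>(set S)) \<le> card (cls A)" using S(2) sub_cl[OF A] fin by (intro card_mono) auto
  also have "\<dots> = r A + null (cls A)" using rk_null[OF fin] rk_cl[OF A] by simp
  finally have "val_seq A S \<le> int (r A)" using S(4) unfolding val_seq_def by simp
  then show "val_min XX A \<le> int (r A)" using val_le[OF A pr] by simp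
qed

theorem (in grid) greatest_iff_submodular:
  "(\<exists>M. xmat M \<and> (\<forall>N. xmat N \<longrightarrow> N \<subseteq> M)) \<longleftrightarrow> submodular_on E (val_min XX)"
proof
  assume "\<exists>M. xmat M \<and> (\<forall>N. xmat N \<longrightarrow> N \<subseteq> M)"
  then obtain M where M: "xmat M" "\<And>N. xmat N \<Longrightarrow> N \<subseteq> M" by blast
  interpret k33 edge m n M
    by unfold_locales (use M in \<open>auto simp: xmat_def\<close>)
  show "submodular_on E (val_min XX)"
    unfolding submodular_on_def
  proof (intro allI impI)
    fix A B assume AB: "A \<subseteq> E \<and> B \<subseteq> E"
    then have "A \<union> B \<subseteq> E" "A \<inter> B \<subseteq> E" by blast+
    then show "val_min XX (A \<union> B) + val_min XX (A \<inter> B) \<le> val_min XX A + val_min XX B"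
      using rk_submod[of A B] AB by (simp add: val_eq_rk)
  qed
qed (rule greatest_of_submodular)

text \<open>By finiteness every family with \<open>Q\<close> lies below a maximal one; if only one
  maximal family exists, it is above all of them.\<close>

lemma unique_maximal_iff_greatest:
  fixes Q :: "'a set \<Rightarrow> bool"
  assumes fin: "finite U" and Q: "\<And>N. Q N \<Longrightarrow> N \<subseteq> U"
  shows "(\<exists>!M. Q M \<and> (\<forall>N. Q N \<and> M \<subseteq> N \<longrightarrow> N = M)) \<longleftrightarrow> (\<exists>M. Q M \<and> (\<forall>N. Q N \<longrightarrow> N \<subseteq> M))"
proof
  assume ex1: "\<exists>!M. Q M \<and> (\<forall>N. Q N \<and> M \<subseteq> N \<longrightarrow> N = M)"
  define P where "P M \<longleftrightarrow> Q M \<and> (\<forall>N. Q N \<and> M \<subseteq> N \<longrightarrow> N = M)" for M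
  have "\<exists>!M. P M" using ex1 unfolding P_def .
  then obtain M where PM: "P M" and uniq: "\<And>M'. P M' \<Longrightarrow> M' = M" by blast
  have M: "Q M" using PM by (simp add: P_def)
  have "N \<subseteq> M" if N: "Q N" for N
  proof -
    let ?S = "{N'. Q N' \<and> N \<subseteq> N'}"
    have "finite ?S" by (rule finite_subset[of _ "Pow U"]) (use Q fin in auto)
    moreover have "?S \<noteq> {}" using N by blast
    ultimately obtain N' where N': "N' \<in> ?S" "\<forall>K\<in>?S. card K \<le> card N'" using ex_max_nat[of ?S card] by blast
    have "K = N'" if K: "Q K" "N' \<subseteq> K" for K
    proof -
      have "K \<in> ?S" using K N'(1) by auto
      then have "card K \<le> card N'" using N'(2) by blast
      moreover have "finite K" using Q[OF K(1)] fin finite_subset by blast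
      ultimately show ?thesis using card_seteq[of K N'] K(2) by simp
    qed
    then have "P N'" using N'(1) by (simp add: P_def)
    then have "N' = M" by (rule uniq)
    then show ?thesis using N'(1) by blast
  qed
  then show "\<exists>M. Q M \<and> (\<forall>N. Q N \<longrightarrow> N \<subseteq> M)" using M by blast
next
  assume "\<exists>M. Q M \<and> (\<forall>N. Q N \<longrightarrow> N \<subseteq> M)"
  then obtain M where M: "Q M" "\<And>N. Q N \<Longrightarrow> N \<subseteq> M" by blast
  show "\<exists>!M. Q M \<and> (\<forall>N. Q N \<and> M \<subseteq> N \<longrightarrow> N = M)"
  proof (rule ex1I[of _ M])
    show "Q M \<and> (\<forall>N. Q N \<and> M \<subseteq> N \<longrightarrow> N = M)" using M by (simp add: subset_antisym)
    fix M' assume "Q M' \<and> (\<forall>N. Q N \<and> M' \<subseteq> N \<longrightarrow> N = M')"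
    then show "M' = M" using M by blast
  qed
qed

section \<open>Transfer to the concrete complete bipartite graph\<close>

abbreviation bedge :: "nat \<Rightarrow> nat \<Rightarrow> (nat + nat) set" where
  "bedge i j \<equiv> {Inl i, Inr j}"

lemma K33_copies_complete_bipartite:
  assumes "grid bedge m n"
  shows "K33_copies (complete_bipartite m n) = grid.XX bedge m n"
proof -
  interpret grid bedge m n by (rule assms)
  let ?G = "complete_bipartite m n" and ?H = "complete_bipartite 3 3"
  have eG: "edges ?G = E" by (auto simp: complete_bipartite_def E_def K_def)
  have vH: "verts ?H = Inl ` {..<3} \<union> Inr ` {..<3}" by (simp add: complete_bipartite_def)
  have eH: "{u, w} \<in> edges ?H \<longleftrightarrow> (u \<in> Inl ` {..<3} \<and> w \<in> Inr ` {..<3}) \<or> (u \<in> Inr ` {..<3} \<and> w \<in> Inl ` {..<3})" for u w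
    by (auto simp: complete_bipartite_def doubleton_eq_iff)
  show ?thesis
  proof (intro equalityI subsetI)
    fix X assume "X \<in> K33_copies ?G"
    then obtain H where H: "X = edges H" "subgraph H ?G" "graph_iso H ?H" unfolding K33_copies_def by blast
    obtain f where f: "bij_betw f (verts H) (verts ?H)"
      and fe: "\<And>u w. u \<in> verts H \<Longrightarrow> w \<in> verts H \<Longrightarrow> {u, w} \<in> edges H \<longleftrightarrow> {f u, f w} \<in> edges ?H"
      using H(3) unfolding graph_iso_def by blast
    define S where "S = {u \<in> verts H. f u \<in> Inl ` {..<3}}"
    define T where "T = {u \<in> verts H. f u \<in> Inr ` {..<3}}"
    have im: "f ` verts H = Inl ` {..<3} \<union> Inr ` {..<3}" using f vH by (simp add: bij_betw_def)
    have inj: "inj_on f (verts H)" using f by (simp add: bij_betw_def)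
    have "f ` S = f ` verts H \<inter> Inl ` {..<3}" unfolding S_def by auto
    then have "f ` S = Inl ` {..<3}" unfolding im by auto
    moreover have "inj_on f S" using inj by (rule inj_on_subset) (auto simp: S_def)
    ultimately have cS: "card S = 3" using card_image[of f S] card_image[of "Inl :: nat \<Rightarrow> nat + nat" "{..<3}"] by simp
    have "f ` T = f ` verts H \<inter> Inr ` {..<3}" unfolding T_def by auto
    then have "f ` T = Inr ` {..<3}" unfolding im by auto
    moreover have "inj_on f T" using inj by (rule inj_on_subset) (auto simp: T_def)
    ultimately have cT: "card T = 3" using card_image[of f T] card_image[of "Inr :: nat \<Rightarrow> nat + nat" "{..<3}"] by simp
    have "f u \<in> Inl ` {..<3} \<union> Inr ` {..<3}" if "u \<in> verts H" for u using im that by blast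
    then have ST: "verts H = S \<union> T" unfolding S_def T_def by blast
    have adj: "{u, w} \<in> edges H \<longleftrightarrow> (u \<in> S \<and> w \<in> T) \<or> (u \<in> T \<and> w \<in> S)" if "u \<in> verts H" "w \<in> verts H" for u w
      using fe[OF that] eH[of "f u" "f w"] that unfolding S_def T_def by simp
    have HE: "edges H \<subseteq> E" using H(2) eG unfolding subgraph_def by simp
    have sides: "\<exists>i j. i < m \<and> j < n \<and> ((u = Inl i \<and> w = Inr j) \<or> (u = Inr j \<and> w = Inl i))" if "u \<in> S" "w \<in> T" for u w
    proof -
      have "{u, w} \<in> E" using adj[of u w] that ST HE by blast
      then obtain i j where "{u, w} = bedge i j" "i < m" "j < n" using E_cases by blast
      then show ?thesis by (auto simp: doubleton_eq_iff)
    qed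
    have XST: "X = {{u, w} | u w. u \<in> S \<and> w \<in> T}"
    proof (intro equalityI subsetI)
      fix e assume e: "e \<in> X"
      then have "e \<subseteq> verts H" "card e = 2" using H(1,2) unfolding subgraph_def simple_graph_def by auto
      then obtain u w where uw: "e = {u, w}" "u \<in> verts H" "w \<in> verts H" by (auto simp: card_2_iff)
      then have "(u \<in> S \<and> w \<in> T) \<or> (u \<in> T \<and> w \<in> S)" using adj e H(1) by blast
      then show "e \<in> {{u, w} | u w. u \<in> S \<and> w \<in> T}" using uw(1) by (auto simp: insert_commute)
    next
      fix e assume "e \<in> {{u, w} | u w. u \<in> S \<and> w \<in> T}"
      then obtain u w where "e = {u, w}" "u \<in> S" "w \<in> T" by blast
      then show "e \<in> X" using adj[of u w] ST H(1) by blast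
    qed
    have split: "X \<in> XX" if L: "L \<subseteq> Inl ` {..<m}" and R: "R \<subseteq> Inr ` {..<n}" and "card L = 3" "card R = 3"
      and X: "X = {{u, w} | u w. u \<in> L \<and> w \<in> R}" for L R :: "(nat + nat) set"
    proof -
      obtain A where A: "A \<subseteq> {..<m}" "L = Inl ` A" using L by (meson subset_imageE)
      obtain B where B: "B \<subseteq> {..<n}" "R = Inr ` B" using R by (meson subset_imageE)
      have "X = K A B" unfolding X A(2) B(2) K_def by blast
      moreover have "card A = 3" "card B = 3"
        using \<open>card L = 3\<close> \<open>card R = 3\<close> A(2) B(2) by (simp_all add: card_image)
      ultimately show ?thesis using XX_I[OF A(1) B(1)] by simp
    qed
    \<comment> \<open>An isomorphism onto K33 may exchange the sides. The side of a single vertex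
      \<open>s0\<close> settles where all of \<open>T\<close> lies, and then where all of
      \<open>S\<close> lies.\<close>
    obtain s0 t0 where s0: "s0 \<in> S" and t0: "t0 \<in> T" using cS cT by (metis card.empty ex_in_conv zero_neq_numeral)
    show "X \<in> XX"
    proof (cases "s0 \<in> range Inl")
      case True
      have T': "T \<subseteq> Inr ` {..<n}" using sides[OF s0] True by force
      have S': "S \<subseteq> Inl ` {..<m}" using sides[OF _ t0] T' t0 by force
      show ?thesis by (rule split[OF S' T' cS cT XST])
    next
      case False
      have T': "T \<subseteq> Inl ` {..<m}" using sides[OF s0] False by force
      have S': "S \<subseteq> Inr ` {..<n}" using sides[OF _ t0] T' t0 by force
      have "X = {{u, w} | u w. u \<in> T \<and> w \<in> S}" unfolding XST by (auto simp: insert_commute)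
      then show ?thesis by (rule split[OF T' S' cT cS])
    qed
  next
    fix X assume "X \<in> XX"
    then obtain A B where X: "X = K A B" "A \<subseteq> {..<m}" "B \<subseteq> {..<n}" "card A = 3" "card B = 3" unfolding XX_def by blast
    let ?K = "(Inl ` A \<union> Inr ` B, X)"
    have "subgraph ?K ?G"
      unfolding subgraph_def simple_graph_def
    proof (intro conjI ballI)
      fix e assume "e \<in> edges ?K"
      then have "e \<in> K A B" using X(1) by simp
      then obtain i j where "e = bedge i j" "i \<in> A" "j \<in> B" using K_cases by blast
      then show "e \<subseteq> verts ?K" "card e = 2" by auto
    next
      show "verts ?K \<subseteq> verts ?G" using X(2,3) by (auto simp: complete_bipartite_def)
      show "edges ?K \<subseteq> edges ?G" unfolding eG using K_sub_E[OF X(2,3)] X(1) by simp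
    qed
    moreover have "graph_iso ?K ?H"
    proof -
      obtain a where a: "bij_betw a A {..<3::nat}"
        using finite_same_card_bij[of A "{..<3::nat}"] X(4) finite_left[OF X(2)] by auto
      obtain b where b: "bij_betw b B {..<3::nat}"
        using finite_same_card_bij[of B "{..<3::nat}"] X(5) finite_right[OF X(3)] by auto
      let ?f = "map_sum a b"
      have ia: "inj_on a A" "a ` A = {..<3}" and ib: "inj_on b B" "b ` B = {..<3}" using a b by (auto simp: bij_betw_def)
      have aA: "a i < 3" if "i \<in> A" for i using ia(2) that by blast
      have bB: "b i < 3" if "i \<in> B" for i using ib(2) that by blast
      have "inj_on ?f (Inl ` A \<union> Inr ` B)"
        by (rule inj_onI, elim UnE imageE) (simp_all add: inj_on_eq_iff[OF ia(1)] inj_on_eq_iff[OF ib(1)])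
      moreover have "?f ` (Inl ` A \<union> Inr ` B) = verts ?H"
      proof -
        have "?f ` Inl ` A = Inl ` a ` A" "?f ` Inr ` B = Inr ` b ` B" by (simp_all add: image_image)
        then show ?thesis unfolding vH image_Un using ia(2) ib(2) by simp
      qed
      ultimately have "bij_betw ?f (verts ?K) (verts ?H)" by (simp add: bij_betw_def)
      moreover have "{u, w} \<in> edges ?K \<longleftrightarrow> {?f u, ?f w} \<in> edges ?H" if "u \<in> verts ?K" "w \<in> verts ?K" for u w
      proof -
        have "{u, w} \<in> edges ?K \<longleftrightarrow> (u \<in> Inl ` A \<and> w \<in> Inr ` B) \<or> (u \<in> Inr ` B \<and> w \<in> Inl ` A)"
          by (auto simp: X(1) K_def doubleton_eq_iff)
        also have "\<dots> \<longleftrightarrow> {?f u, ?f w} \<in> edges ?H" 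
        proof -
          have "(?f u \<in> Inl ` {..<3} \<longleftrightarrow> u \<in> Inl ` A) \<and> (?f u \<in> Inr ` {..<3} \<longleftrightarrow> u \<in> Inr ` B)"
            if "u \<in> Inl ` A \<union> Inr ` B" for u
            using that by (elim UnE imageE) (auto simp: aA bB)
          then show ?thesis unfolding eH using that by simp
        qed
        finally show ?thesis .
      qed
      ultimately show ?thesis unfolding graph_iso_def by blast
    qed
    ultimately show "X \<in> K33_copies ?G" unfolding K33_copies_def by force
  qed
qed

theorem theorem6p5:
  fixes m n :: nat
  assumes "m \<ge> 3" and "n \<ge> 3"
  shows "(\<exists>!M. maximal_K33_matroid (complete_bipartite m n) M) \<longleftrightarrow>
    submodular_on (edges (complete_bipartite m n)) (val_K33 (complete_bipartite m n))"
proof -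
  interpret grid bedge m n by unfold_locales (use assms in \<open>auto simp: doubleton_eq_iff\<close>)
  let ?G = "complete_bipartite m n"
  have E: "edges ?G = E" by (auto simp: complete_bipartite_def E_def K_def)
  have XX: "K33_copies ?G = XX" by (rule K33_copies_complete_bipartite) unfold_locales
  have xm: "K33_matroid ?G N \<longleftrightarrow> xmat N" for N unfolding K33_matroid_def xmat_def E XX ..
  have "maximal_K33_matroid ?G M \<longleftrightarrow> xmat M \<and> (\<forall>N. xmat N \<and> M \<subseteq> N \<longrightarrow> N = M)" for M
    unfolding maximal_K33_matroid_def xm weak_le_def subset_iff ..
  then have "(\<exists>!M. maximal_K33_matroid ?G M) \<longleftrightarrow> (\<exists>!M. xmat M \<and> (\<forall>N. xmat N \<and> M \<subseteq> N \<longrightarrow> N = M))"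
    by simp
  also have "\<dots> \<longleftrightarrow> (\<exists>M. xmat M \<and> (\<forall>N. xmat N \<longrightarrow> N \<subseteq> M))"
  proof (rule unique_maximal_iff_greatest)
    show "finite (Pow E)" using finite_E by simp
    show "N \<subseteq> Pow E" if "xmat N" for N using that unfolding xmat_def matroid_on_def by blast
  qed
  also have "\<dots> \<longleftrightarrow> submodular_on E (val_min XX)" by (rule greatest_iff_submodular)
  also have "val_min XX = val_K33 ?G" by (rule ext) (simp add: val_K33_def XX)
  finally show ?thesis unfolding E .
qed

end
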